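(* Let $\mathbb H^1_e=\mathbb H^1\rtimes A$ be the extended Heisenberg group and let $Z=X_\alpha+X_0$ (where $X_0$ is the generator of $A$ and $X_\alpha$ is the horizontal left-invariant vector field in the $p$-direction). Then $\mathcal D^Z$ is not a CZ family for $(\mathbb H^1_e,d_{\mathbb H^1_e},\rho)$.
   Context: **Group setting.** $\mathbb H^1=\mathbb R^3$ with product $(q,p,\tau)(q',p',\tau')=(q+q',p+p',\tau+\tau'-\tfrac12(qp'-pq'))$ and Haar measure $dn=dq\,dp\,d\tau$; write $N=\mathbb H^1$. $A=(\mathbb R_+,\cdot)$ acts by $D_a(q,p,\tau)=(aq,ap,a^2\tau)$. $G=\mathbb H^1_e=\mathbb H^1\rtimes A$ has product $(n,a)(n',a')=(nD_a(n'),aa')$, identity $1_G=(0,0,0;1)$ and right Haar measure $d\rho=a^{-1}\,dq\,dp\,d\tau\,da$. In the Lie algebra of $G$: $X_0$ is the element with $\exp(tX_0)=(0,0,0;e^t)$; $X_\alpha$ and $X_{\alpha+\beta}$ are the left-invariant vector fields whose values at $1_G$ are $\partial_p$ and $\partial_q$ respectively, so $\exp(tX_\alpha)=(0,t,0;1)$ and $\exp(tX_{\alpha+\beta})=(t,0,0;1)$. (In the realization inside $\mathrm{Sp}(2,\mathbb R)$, $X_0$ is denoted $H_{1,0}$.) $d_N$ is the left-invariant Carnot–Carathéodory distance on $\mathbb H^1$ for which the left-invariant fields with values $\partial_p,\partial_q$ at the identity form an orthonormal horizontal frame, and $d_{\mathbb H^1_e}$ is the left-invariant Carnot–Carathéodory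 distance on $\mathbb H^1_e$ for which $X_0,X_\alpha,X_{\alpha+\beta}$ form an orthonormal horizontal frame. For $Z=X_\alpha+X_0$ one has $\exp(tZ)=(0,e^t-1,0;e^t)$. **Christ cubes.** Let $\mu_N=dn$ (the measure on $N$ associated with $\mu=\rho$), which is doubling on $(N,d_N)$. Fix a Christ decomposition of $(N,d_N,\mu_N)$: families $\mathcal Q_k$ ($k\in\mathbb Z$) of countably many pairwise disjoint open sets of $N$ ("cubes of generation $k$"), $\mathcal Q=\bigcup_k\mathcal Q_k$, and constants $\delta\in(0,1)$, $C_1,c>0$ such that: (i) $\mu_N(N\setminus\bigcup_{Q\in\mathcal Q_k}Q)=0$ for all $k$; (ii) each $Q\in\mathcal Q_k$ is contained in a unique $p_N(Q)\in\mathcal Q_{k-1}$ and is disjoint from every other element of $\mathcal Q_{k-1}$; (iii) for each $Q\in\mathcal Q_k$ there is $n_Q\in Q$ with $B_N(n_Q,c\delta^k)\subset Q\subset B_N(n_Q,C_1\delta^k)$; (iv) $\mu_N(p_N(Q))\le C_1\mu_N(Q)$ and $s_N(Q):=\{Q'\in\mathcal Q:p_N(Q')=Q\}$ has at most $C_1$ elements. It is assumed that $C_1\ge3$ and $\#s_N(Q)\ge2$ for all $Q$. **Cylinders.** For $E\subset N$, $r>1$, $a\in A$: $P_{r,E}(a)=\{(n,1)\exp(tZ):n\in E,\ t\in U_r(a)\}$, $U_r(a)=(\log(a/r),\log(ar))$. Fix $\gamma\ge5$ and $\lambda>e^3/\delta$. $P_{r,Q}(a)$ with $Q\in\mathcal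 Q_k$ is *admissible* if either $r>e$ and $ar^2\le\delta^k\le\lambda ar^\gamma$ ( *large* ), or $1<r\le e$ and $ae^2\log r\le\delta^k\le\lambda ae^2\log r$ ( *small* ). **The family $\mathcal D^Z$.** For an admissible $P=P_{r,Q}(a)$, the set of sons is $s(P)=\{P_{\sqrt r,Q}(a/\sqrt r),P_{\sqrt r,Q}(a\sqrt r)\}$ if both of these are admissible, and $s(P)=\{P_{r,Q'}(a):Q'\in s_N(Q)\}$ otherwise; $s^1(P)=s(P)$, $s^{m+1}(P)=\bigcup_{P'\in s^m(P)}s(P')$. Put $p^\downarrow(P)=P_{r^3,Q}(a/r^2)$, $p^\uparrow(P)=P_{r^2,Q}(ar)$, $p^\leftrightarrow(P)=P_{r,p_N(Q)}(a)$, and $\mathcal S(P)=\{P_{r,Q'}(a):Q'\in\mathcal Q_j\}$ if $Q\in\mathcal Q_j$. Fix a large admissible $P_0=P_{r_0,Q_0}(1)$ and define recursively $P_{k+1}=p^\leftrightarrow(P_k)$ whenever this is admissible; at the successive values of $k$ for which it is not, $P_{k+1}$ is alternately $p^\uparrow(P_k)$ and $p^\downarrow(P_k)$, starting with $p^\uparrow$. For $k\ge0$ let $\mathcal S_k=\mathcal S(P_k)$; let $\widetilde{\mathcal S}_k=\emptyset$ if $P_{k+1}=p^\leftrightarrow(P_k)$ and $\widetilde{\mathcal S}_k=\mathcal S(P_{k+1}\setminus P_k)$ otherwise, where, if $P_k=P_{r,Q}(a)$, $P_{k+1}\setminus P_k$ stands (up to a null set) for the cylinder $P_{r,Q}(ar^2)$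 when $P_{k+1}=p^\uparrow(P_k)$ and $P_{r^2,Q}(a/r^3)$ when $P_{k+1}=p^\downarrow(P_k)$. With $\widetilde{\mathcal S}_\ell^m=\bigcup_{P\in\widetilde{\mathcal S}_\ell}s^m(P)$, put $\mathcal D^Z_{-k}=\mathcal S_k\cup\widetilde{\mathcal S}_k\cup\bigcup_{\ell>k}\widetilde{\mathcal S}_\ell^{\ell-k}$ for $k\ge0$, $\mathcal D^Z_k=\bigcup_{P\in\mathcal D^Z_{k-1}}s(P)$ for $k\ge1$, and $\mathcal D^Z=\bigcup_{k\in\mathbb Z}\mathcal D^Z_k$. **CZ family.** A metric measure space $(X,d,\mu)$ with $\mu(X)=\infty$ has the CZP if there is $C_0\ge1$ such that for every $f\in L^1(\mu)$ and $\alpha>0$ there exist a countable family of sets $\mathcal E(f,\alpha)=\{E_j\}$, numbers $r_j>0$, points $x_j\in X$ and a decomposition $f=g+\sum_jb_j$ such that for every $j$: (a) $|g|\le C_0\alpha$ $\mu$-a.e.; (b) $b_j=0$ on $X\setminus E_j$; (c) $\sum_j\|b_j\|_1\le C_0\|f\|_1$ and $\int_{E_j}b_j\,d\mu=0$; (d) $E_j\subset B(x_j,C_0r_j)$; (e) $\sum_j\mu(E_j^* )\le\frac{C_0}{\alpha}\|f\|_1$, where $E_j^*=\{x:d(x,E_j)<r_j\}$. In this case $\mathcal E=\{E\in\mathcal E(f,\alpha):f\in L^1(\mu),\alpha>0\}$ is called a CZ family for $(X,d,\mu)$ (equivalently, $(X,d,\mu)$ has the CZP with respect to $\mathcal E$).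 *)

theory Defs
  imports "HOL-Analysis.Analysis"
begin

section \<open>Left-invariant fields, exponential map, Carnot--Caratheodory distance\<close>

text \<open>
  The groups below are open subsets of Euclidean spaces, so the Lie algebra is identified with the
  tangent space at the identity \<open>e\<close>.
\<close>

definition left_invariant_field ::
  "('a::real_normed_vector \<Rightarrow> 'a \<Rightarrow> 'a) \<Rightarrow> 'a \<Rightarrow> 'a \<Rightarrow> 'a \<Rightarrow> 'a" where
  "left_invariant_field mul e v g = vector_derivative (\<lambda>t. mul g (e + t *\<^sub>R v)) (at 0)"

text \<open>The time-one value of the integral curve through \<open>e\<close> of the left-invariant field.\<close>

definition lie_exp :: "('a::real_normed_vector \<Rightarrow> 'a \<Rightarrow> 'a) \<Rightarrow> 'a \<Rightarrow> 'a \<Rightarrow> 'a" where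
  "lie_exp mul e v = (THE g. \<exists>\<gamma>. \<gamma> 0 = e \<and>
      (\<forall>t::real. (\<gamma> has_vector_derivative left_invariant_field mul e v (\<gamma> t)) (at t)) \<and> g = \<gamma> 1)"

text \<open>
  The library's piecewise \<open>C\<^sup>1\<close> curves may have an unbounded derivative near an exceptional
  point. The length is therefore stated with \<open>has_integral\<close>, which discards the curves of infinite
  length; the totalised integral would give them length 0.
\<close>

definition horizontal_curve_length ::
  "'a::real_normed_vector set \<Rightarrow> ('a \<Rightarrow> 'a) list \<Rightarrow> (real \<Rightarrow> 'a) \<Rightarrow> real \<Rightarrow> bool" where
  "horizontal_curve_length S Xs \<gamma> L \<longleftrightarrow>
     \<gamma> piecewise_C1_differentiable_on {0..1} \<and> \<gamma> ` {0..1} \<subseteq> S \<and>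
     (\<exists>(u :: nat \<Rightarrow> real \<Rightarrow> real) T. finite T \<and>
        (\<forall>t\<in>{0..1} - T.
           (\<gamma> has_vector_derivative (\<Sum>i<length Xs. u i t *\<^sub>R (Xs ! i) (\<gamma> t))) (at t)) \<and>
        ((\<lambda>t. sqrt (\<Sum>i<length Xs. (u i t)\<^sup>2)) has_integral L) {0..1})"

text \<open>The distance on \<open>S\<close> for which the fields \<open>Xs\<close> form an orthonormal horizontal frame.\<close>

definition cc_dist ::
  "'a::real_normed_vector set \<Rightarrow> ('a \<Rightarrow> 'a) list \<Rightarrow> 'a \<Rightarrow> 'a \<Rightarrow> real" where
  "cc_dist S Xs x y = Inf {L. \<exists>\<gamma>. \<gamma> 0 = x \<and> \<gamma> 1 = y \<and> horizontal_curve_length S Xs \<gamma> L}"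


section \<open>The Heisenberg group and its extension\<close>

type_synonym heis = "real \<times> real \<times> real"

fun heis_mult :: "heis \<Rightarrow> heis \<Rightarrow> heis" where
  "heis_mult (q, p, \<tau>) (q', p', \<tau>') = (q + q', p + p', \<tau> + \<tau>' - (q * p' - p * q') / 2)"

fun heis_dil :: "real \<Rightarrow> heis \<Rightarrow> heis" where
  "heis_dil a (q, p, \<tau>) = (a * q, a * p, a\<^sup>2 * \<tau>)"

definition heis_dist :: "heis \<Rightarrow> heis \<Rightarrow> real" where
  "heis_dist = cc_dist UNIV
     [left_invariant_field heis_mult (0, 0, 0) (0, 1, 0),
      left_invariant_field heis_mult (0, 0, 0) (1, 0, 0)]"

definition heis_ball :: "heis \<Rightarrow> real \<Rightarrow> heis set" where
  "heis_ball x R = {y. heis_dist x y < R}"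

text \<open>The extended group is the subset \<open>eheis_carrier\<close> of the following type.\<close>

type_synonym eheis = "heis \<times> real"

definition eheis_carrier :: "eheis set" where
  "eheis_carrier = {g. snd g > 0}"

fun eheis_mult :: "eheis \<Rightarrow> eheis \<Rightarrow> eheis" where
  "eheis_mult (n, a) (n', a') = (heis_mult n (heis_dil a n'), a * a')"

abbreviation eheis_one :: eheis where
  "eheis_one \<equiv> ((0, 0, 0), 1)"

definition X_0 :: eheis where "X_0 = ((0, 0, 0), 1)"
definition X_alpha :: eheis where "X_alpha = ((0, 1, 0), 0)"
definition X_alpha_beta :: eheis where "X_alpha_beta = ((1, 0, 0), 0)"

definition Z_field :: eheis where "Z_field = X_alpha + X_0"

abbreviation eheis_exp :: "eheis \<Rightarrow> eheis" where
  "eheis_exp \<equiv> lie_exp eheis_mult eheis_one"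

definition eheis_dist :: "eheis \<Rightarrow> eheis \<Rightarrow> real" where
  "eheis_dist = cc_dist eheis_carrier
     (map (left_invariant_field eheis_mult eheis_one) [X_0, X_alpha, X_alpha_beta])"

definition rho :: "eheis measure" where
  "rho = density (restrict_space lborel eheis_carrier) (\<lambda>(n, a). ennreal (1 / a))"

lemma left_invariant_field_heis:
  "left_invariant_field heis_mult (0, 0, 0) (x, y, z) (q, p, \<tau>) =
     (x, y, z - (q * y - p * x) / 2)"
  unfolding left_invariant_field_def
  by (rule vector_derivative_at) (auto intro!: derivative_eq_intros has_vector_derivative_Pair
      simp flip: has_real_derivative_iff_has_vector_derivative)

lemma left_invariant_field_eheis:
  "left_invariant_field eheis_mult eheis_one ((x, y, z), w) ((q, p, \<tau>), a) =
     ((a * x, a * y, a\<^sup>2 * z - (q * (a * y) - p * (a * x)) / 2), a * w)"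
  unfolding left_invariant_field_def
  by (rule vector_derivative_at) (auto intro!: derivative_eq_intros has_vector_derivative_Pair
      simp flip: has_real_derivative_iff_has_vector_derivative)


lemma has_vector_derivative_eheis_iff:
  fixes \<gamma> :: "real \<Rightarrow> eheis"
  shows "(\<gamma> has_vector_derivative ((x, y, z), w)) (at t) \<longleftrightarrow>
     ((\<lambda>t. fst (fst (\<gamma> t))) has_real_derivative x) (at t) \<and>
     ((\<lambda>t. fst (snd (fst (\<gamma> t)))) has_real_derivative y) (at t) \<and>
     ((\<lambda>t. snd (snd (fst (\<gamma> t)))) has_real_derivative z) (at t) \<and>
     ((\<lambda>t. snd (\<gamma> t)) has_real_derivative w) (at t)" (is "?L \<longleftrightarrow> ?R")
proof
  assume ?L
  then have 1: "((\<lambda>t. fst (\<gamma> t)) has_vector_derivative (x, y, z)) (at t)"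
    and 2: "((\<lambda>t. snd (\<gamma> t)) has_vector_derivative w) (at t)"
    unfolding has_vector_derivative_def
    by (auto dest: has_derivative_fst has_derivative_snd)
  from 1 have 3: "((\<lambda>t. fst (fst (\<gamma> t))) has_vector_derivative x) (at t)"
    and 4: "((\<lambda>t. snd (fst (\<gamma> t))) has_vector_derivative (y, z)) (at t)"
    unfolding has_vector_derivative_def
    by (auto dest: has_derivative_fst has_derivative_snd)
  from 4 have 5: "((\<lambda>t. fst (snd (fst (\<gamma> t)))) has_vector_derivative y) (at t)"
    and 6: "((\<lambda>t. snd (snd (fst (\<gamma> t)))) has_vector_derivative z) (at t)"
    unfolding has_vector_derivative_def
    by (auto dest: has_derivative_fst has_derivative_snd)
  from 2 3 5 6 show ?R
    by (simp add: has_real_derivative_iff_has_vector_derivative)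
next
  assume ?R
  then have "((\<lambda>t. ((fst (fst (\<gamma> t)), fst (snd (fst (\<gamma> t))), snd (snd (fst (\<gamma> t)))), snd (\<gamma> t)))
      has_vector_derivative ((x, y, z), w)) (at t)"
    by (intro has_vector_derivative_Pair)
       (auto simp: has_real_derivative_iff_has_vector_derivative)
  then show ?L by simp
qed

lemma real_eq_if_same_derivative:
  fixes f g :: "real \<Rightarrow> real"
  assumes "\<And>t. (f has_real_derivative h t) (at t)"
    and "\<And>t. (g has_real_derivative h t) (at t)" and "f 0 = g 0"
  shows "f t = g t"
proof -
  have "((\<lambda>t. f t - g t) has_real_derivative 0) (at t)" for t
    using DERIV_diff[OF assms(1) assms(2), of t] by simp
  then have "f t - g t = f 0 - g 0"
    by (metis (no_types, lifting) DERIV_isconst_all)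
  with assms(3) show ?thesis by simp
qed

lemma eheis_exp_eqI:
  assumes "\<eta> 0 = eheis_one"
    and "\<And>t::real. (\<eta> has_vector_derivative left_invariant_field eheis_mult eheis_one v (\<eta> t)) (at t)"
  shows "eheis_exp v = \<eta> 1"
proof -
  obtain x y z w where v: "v = ((x, y, z), w)" by (metis prod.collapse)
  define Q where "Q = (\<lambda>g::eheis. fst (fst g))"
  define P where "P = (\<lambda>g::eheis. fst (snd (fst g)))"
  define T where "T = (\<lambda>g::eheis. snd (snd (fst g)))"
  define A where "A = (\<lambda>g::eheis. snd g)"
  have eq: "g = ((Q g, P g, T g), A g)" for g
    by (simp add: Q_def P_def T_def A_def)
  have fld: "left_invariant_field eheis_mult eheis_one v g =
     ((A g * x, A g * y, (A g)\<^sup>2 * z - (Q g * (A g * y) - P g * (A g * x)) / 2), A g * w)" for g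
    by (subst eq[of g]) (simp only: v left_invariant_field_eheis)
  have main: "\<gamma> t = \<eta> t"
    if \<gamma>0: "\<gamma> 0 = eheis_one"
      and \<gamma>: "\<And>t::real. (\<gamma> has_vector_derivative left_invariant_field eheis_mult eheis_one v (\<gamma> t)) (at t)"
    for \<gamma> t
  proof -
    have D: "((\<lambda>t. Q (\<xi> t)) has_real_derivative A (\<xi> t) * x) (at t) \<and>
        ((\<lambda>t. P (\<xi> t)) has_real_derivative A (\<xi> t) * y) (at t) \<and>
        ((\<lambda>t. T (\<xi> t)) has_real_derivative (A (\<xi> t))\<^sup>2 * z - (Q (\<xi> t) * (A (\<xi> t) * y) - P (\<xi> t) * (A (\<xi> t) * x)) / 2) (at t) \<and>
        ((\<lambda>t. A (\<xi> t)) has_real_derivative A (\<xi> t) * w) (at t)"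
      if "\<xi> = \<gamma> \<or> \<xi> = \<eta>" for \<xi> t
      using that \<gamma>[of t] assms(2)[of t]
      unfolding fld has_vector_derivative_eheis_iff Q_def P_def T_def A_def
      by (elim disjE) simp_all
    have A: "A (\<xi> t) = exp (w * t)" if \<xi>: "\<xi> = \<gamma> \<or> \<xi> = \<eta>" for \<xi> t
    proof -
      have "((\<lambda>t. A (\<xi> t) * exp (- w * t)) has_real_derivative 0) (at t)" for t
      proof -
        have "((\<lambda>t. A (\<xi> t)) has_real_derivative A (\<xi> t) * w) (at t)"
          using D[OF \<xi>] by blast
        then show ?thesis by (auto intro!: derivative_eq_intros)
      qed
      then have "A (\<xi> t) * exp (- w * t) = A (\<xi> 0) * exp (- w * 0)"
        by (metis (no_types, lifting) DERIV_isconst_all)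
      moreover have "A (\<xi> 0) = 1" using \<xi> \<gamma>0 assms(1) by (auto simp: A_def)
      ultimately show ?thesis by (simp add: exp_minus field_simps)
    qed
    have Q: "Q (\<gamma> t) = Q (\<eta> t)" for t
    proof (rule real_eq_if_same_derivative[where f = "\<lambda>t. Q (\<gamma> t)" and g = "\<lambda>t. Q (\<eta> t)" and
          h = "\<lambda>t. exp (w * t) * x"])
      fix t
      show "((\<lambda>t. Q (\<gamma> t)) has_real_derivative exp (w * t) * x) (at t)"
        using D[of \<gamma> t] A[of \<gamma> t] by simp
      show "((\<lambda>t. Q (\<eta> t)) has_real_derivative exp (w * t) * x) (at t)"
        using D[of \<eta> t] A[of \<eta> t] by simp
    qed (use \<gamma>0 assms(1) in auto)
    have P: "P (\<gamma> t) = P (\<eta> t)" for t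
    proof (rule real_eq_if_same_derivative[where f = "\<lambda>t. P (\<gamma> t)" and g = "\<lambda>t. P (\<eta> t)" and
          h = "\<lambda>t. exp (w * t) * y"])
      fix t
      show "((\<lambda>t. P (\<gamma> t)) has_real_derivative exp (w * t) * y) (at t)"
        using D[of \<gamma> t] A[of \<gamma> t] by simp
      show "((\<lambda>t. P (\<eta> t)) has_real_derivative exp (w * t) * y) (at t)"
        using D[of \<eta> t] A[of \<eta> t] by simp
    qed (use \<gamma>0 assms(1) in auto)
    have T: "T (\<gamma> t) = T (\<eta> t)" for t
    proof (rule real_eq_if_same_derivative[where f = "\<lambda>t. T (\<gamma> t)" and g = "\<lambda>t. T (\<eta> t)" and
          h = "\<lambda>t. (A (\<eta> t))\<^sup>2 * z - (Q (\<eta> t) * (A (\<eta> t) * y) - P (\<eta> t) * (A (\<eta> t) * x)) / 2"])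
      fix t
      show "((\<lambda>t. T (\<gamma> t)) has_real_derivative (A (\<eta> t))\<^sup>2 * z - (Q (\<eta> t) * (A (\<eta> t) * y) - P (\<eta> t) * (A (\<eta> t) * x)) / 2) (at t)"
        using D[of \<gamma> t] A[of \<gamma> t] A[of \<eta> t] Q[of t] P[of t] by simp
      show "((\<lambda>t. T (\<eta> t)) has_real_derivative (A (\<eta> t))\<^sup>2 * z - (Q (\<eta> t) * (A (\<eta> t) * y) - P (\<eta> t) * (A (\<eta> t) * x)) / 2) (at t)"
        using D[of \<eta> t] by simp
    qed (use \<gamma>0 assms(1) in auto)
    have "A (\<gamma> t) = A (\<eta> t)" using A[of \<gamma> t] A[of \<eta> t] by simp
    with Q P T show ?thesis by (metis eq)
  qed
  show ?thesis
    unfolding lie_exp_def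
  proof (rule the_equality)
    show "\<exists>\<gamma>. \<gamma> 0 = eheis_one \<and>
      (\<forall>t::real. (\<gamma> has_vector_derivative left_invariant_field eheis_mult eheis_one v (\<gamma> t)) (at t)) \<and>
      \<eta> 1 = \<gamma> 1"
      using assms by blast
  qed (use main in blast)
qed

lemma eheis_exp_X_0: "eheis_exp (t *\<^sub>R X_0) = ((0, 0, 0), exp t)"
  by (subst eheis_exp_eqI[where \<eta> = "\<lambda>s. ((0, 0, 0), exp (s * t))"])
     (auto simp: X_0_def left_invariant_field_eheis has_vector_derivative_eheis_iff
        intro!: derivative_eq_intros)

lemma eheis_exp_X_alpha: "eheis_exp (t *\<^sub>R X_alpha) = ((0, t, 0), 1)"
  by (subst eheis_exp_eqI[where \<eta> = "\<lambda>s. ((0, s * t, 0), 1)"])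
     (auto simp: X_alpha_def left_invariant_field_eheis has_vector_derivative_eheis_iff
        intro!: derivative_eq_intros)

lemma eheis_exp_X_alpha_beta: "eheis_exp (t *\<^sub>R X_alpha_beta) = ((t, 0, 0), 1)"
  by (subst eheis_exp_eqI[where \<eta> = "\<lambda>s. ((s * t, 0, 0), 1)"])
     (auto simp: X_alpha_beta_def left_invariant_field_eheis has_vector_derivative_eheis_iff
        intro!: derivative_eq_intros)

lemma eheis_exp_Z: "eheis_exp (t *\<^sub>R Z_field) = ((0, exp t - 1, 0), exp t)"
  by (subst eheis_exp_eqI[where \<eta> = "\<lambda>s. ((0, exp (s * t) - 1, 0), exp (s * t))"])
     (auto simp: Z_field_def X_0_def X_alpha_def left_invariant_field_eheis
        has_vector_derivative_eheis_iff intro!: derivative_eq_intros)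


section \<open>Christ cubes\<close>

definition cube_parent :: "(int \<Rightarrow> heis set set) \<Rightarrow> int \<Rightarrow> heis set \<Rightarrow> heis set" where
  "cube_parent \<Q> k Q = (THE Q'. Q' \<in> \<Q> (k - 1) \<and> Q \<subseteq> Q')"

definition cube_sons :: "(int \<Rightarrow> heis set set) \<Rightarrow> int \<Rightarrow> heis set \<Rightarrow> heis set set" where
  "cube_sons \<Q> k Q = {Q' \<in> \<Q> (k + 1). cube_parent \<Q> (k + 1) Q' = Q}"

definition christ_decomposition ::
  "(int \<Rightarrow> heis set set) \<Rightarrow> real \<Rightarrow> real \<Rightarrow> real \<Rightarrow> bool" where
  "christ_decomposition \<Q> \<delta> C\<^sub>1 c \<longleftrightarrow>
     0 < \<delta> \<and> \<delta> < 1 \<and> 0 < C\<^sub>1 \<and> 0 < c \<and>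
     (\<forall>k. countable (\<Q> k) \<and> disjoint (\<Q> k) \<and> (\<forall>Q\<in>\<Q> k. open Q)) \<and>
     (\<forall>k. - \<Union>(\<Q> k) \<in> null_sets lborel) \<and>
     (\<forall>k. \<forall>Q\<in>\<Q> k. (\<exists>!Q'. Q' \<in> \<Q> (k - 1) \<and> Q \<subseteq> Q') \<and>
        (\<forall>Q'\<in>\<Q> (k - 1). Q' \<noteq> cube_parent \<Q> k Q \<longrightarrow> Q \<inter> Q' = {})) \<and>
     (\<forall>k. \<forall>Q\<in>\<Q> k. \<exists>n\<in>Q. heis_ball n (c * \<delta> powi k) \<subseteq> Q \<and>
        Q \<subseteq> heis_ball n (C\<^sub>1 * \<delta> powi k)) \<and>
     (\<forall>k. \<forall>Q\<in>\<Q> k.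
        emeasure lborel (cube_parent \<Q> k Q) \<le> ennreal C\<^sub>1 * emeasure lborel Q \<and>
        finite (cube_sons \<Q> k Q) \<and> real (card (cube_sons \<Q> k Q)) \<le> C\<^sub>1)"


section \<open>Cylinders and the family of decomposition sets\<close>

text \<open>
  \<open>Cyl r k Q a\<close> stands for the cylinder over the cube \<open>Q\<close>, regarded as an element of
  generation \<open>k\<close>. The sons and the various parents are defined in terms of these parameters;
  \<open>cyl_set\<close> is the corresponding subset of the group.
\<close>

datatype cylinder = Cyl real int "heis set" real

definition cyl_region :: "real \<Rightarrow> heis set \<Rightarrow> real \<Rightarrow> eheis set" where
  "cyl_region r E a =
     {eheis_mult (n, 1) (eheis_exp (t *\<^sub>R Z_field)) | n t. n \<in> E \<and> t \<in> {ln (a / r)<..<ln (a * r)}}"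

fun cyl_set :: "cylinder \<Rightarrow> eheis set" where
  "cyl_set (Cyl r k Q a) = cyl_region r Q a"

fun large_admissible ::
  "(int \<Rightarrow> heis set set) \<Rightarrow> real \<Rightarrow> real \<Rightarrow> real \<Rightarrow> cylinder \<Rightarrow> bool" where
  "large_admissible \<Q> \<delta> \<gamma> lam (Cyl r k Q a) \<longleftrightarrow>
     Q \<in> \<Q> k \<and> a > 0 \<and> r > exp 1 \<and>
     a * r\<^sup>2 \<le> \<delta> powi k \<and> \<delta> powi k \<le> lam * a * r powr \<gamma>"

fun small_admissible ::
  "(int \<Rightarrow> heis set set) \<Rightarrow> real \<Rightarrow> real \<Rightarrow> cylinder \<Rightarrow> bool" where
  "small_admissible \<Q> \<delta> lam (Cyl r k Q a) \<longleftrightarrow>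
     Q \<in> \<Q> k \<and> a > 0 \<and> 1 < r \<and> r \<le> exp 1 \<and>
     a * exp 2 * ln r \<le> \<delta> powi k \<and> \<delta> powi k \<le> lam * a * exp 2 * ln r"

definition admissible ::
  "(int \<Rightarrow> heis set set) \<Rightarrow> real \<Rightarrow> real \<Rightarrow> real \<Rightarrow> cylinder \<Rightarrow> bool" where
  "admissible \<Q> \<delta> \<gamma> lam P \<longleftrightarrow> large_admissible \<Q> \<delta> \<gamma> lam P \<or> small_admissible \<Q> \<delta> lam P"

fun sons ::
  "(int \<Rightarrow> heis set set) \<Rightarrow> real \<Rightarrow> real \<Rightarrow> real \<Rightarrow> cylinder \<Rightarrow> cylinder set" where
  "sons \<Q> \<delta> \<gamma> lam (Cyl r k Q a) =
     (if admissible \<Q> \<delta> \<gamma> lam (Cyl (sqrt r) k Q (a / sqrt r)) \<and>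
         admissible \<Q> \<delta> \<gamma> lam (Cyl (sqrt r) k Q (a * sqrt r))
      then {Cyl (sqrt r) k Q (a / sqrt r), Cyl (sqrt r) k Q (a * sqrt r)}
      else {Cyl r (k + 1) Q' a | Q'. Q' \<in> cube_sons \<Q> k Q})"

definition sons_iter ::
  "(int \<Rightarrow> heis set set) \<Rightarrow> real \<Rightarrow> real \<Rightarrow> real \<Rightarrow> nat \<Rightarrow> cylinder \<Rightarrow> cylinder set" where
  "sons_iter \<Q> \<delta> \<gamma> lam m P = ((\<lambda>F. \<Union>P'\<in>F. sons \<Q> \<delta> \<gamma> lam P') ^^ m) {P}"

fun parent_down :: "cylinder \<Rightarrow> cylinder" where
  "parent_down (Cyl r k Q a) = Cyl (r ^ 3) k Q (a / r\<^sup>2)"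

fun parent_up :: "cylinder \<Rightarrow> cylinder" where
  "parent_up (Cyl r k Q a) = Cyl (r\<^sup>2) k Q (a * r)"

fun parent_side :: "(int \<Rightarrow> heis set set) \<Rightarrow> cylinder \<Rightarrow> cylinder" where
  "parent_side \<Q> (Cyl r k Q a) = Cyl r (k - 1) (cube_parent \<Q> k Q) a"

fun same_generation :: "(int \<Rightarrow> heis set set) \<Rightarrow> cylinder \<Rightarrow> cylinder set" where
  "same_generation \<Q> (Cyl r k Q a) = {Cyl r k Q' a | Q'. Q' \<in> \<Q> k}"

text \<open>
  The flag records which of the two vertical parents is used at the next stage at which the
  horizontal parent is not admissible: \<open>True\<close> stands for the upward one.
\<close>

fun chain_step ::
  "(int \<Rightarrow> heis set set) \<Rightarrow> real \<Rightarrow> real \<Rightarrow> real \<Rightarrow> cylinder \<times> bool \<Rightarrow> cylinder \<times> bool" where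
  "chain_step \<Q> \<delta> \<gamma> lam (P, up) =
     (if admissible \<Q> \<delta> \<gamma> lam (parent_side \<Q> P) then (parent_side \<Q> P, up)
      else if up then (parent_up P, False) else (parent_down P, True))"

definition chain ::
  "(int \<Rightarrow> heis set set) \<Rightarrow> real \<Rightarrow> real \<Rightarrow> real \<Rightarrow> cylinder \<Rightarrow> nat \<Rightarrow> cylinder \<times> bool" where
  "chain \<Q> \<delta> \<gamma> lam P\<^sub>0 k = (chain_step \<Q> \<delta> \<gamma> lam ^^ k) (P\<^sub>0, True)"

fun vertical_difference :: "cylinder \<times> bool \<Rightarrow> cylinder" where
  "vertical_difference (Cyl r k Q a, up) =
     (if up then Cyl r k Q (a * r\<^sup>2) else Cyl (r\<^sup>2) k Q (a / r ^ 3))"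

definition S_fam ::
  "(int \<Rightarrow> heis set set) \<Rightarrow> real \<Rightarrow> real \<Rightarrow> real \<Rightarrow> cylinder \<Rightarrow> nat \<Rightarrow> cylinder set" where
  "S_fam \<Q> \<delta> \<gamma> lam P\<^sub>0 k = same_generation \<Q> (fst (chain \<Q> \<delta> \<gamma> lam P\<^sub>0 k))"

definition S_tilde ::
  "(int \<Rightarrow> heis set set) \<Rightarrow> real \<Rightarrow> real \<Rightarrow> real \<Rightarrow> cylinder \<Rightarrow> nat \<Rightarrow> cylinder set" where
  "S_tilde \<Q> \<delta> \<gamma> lam P\<^sub>0 k =
     (if admissible \<Q> \<delta> \<gamma> lam (parent_side \<Q> (fst (chain \<Q> \<delta> \<gamma> lam P\<^sub>0 k))) then {}
      else same_generation \<Q> (vertical_difference (chain \<Q> \<delta> \<gamma> lam P\<^sub>0 k)))"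

text \<open>\<open>DZ_neg k\<close> is the family with index \<open>-k\<close>.\<close>

definition DZ_neg ::
  "(int \<Rightarrow> heis set set) \<Rightarrow> real \<Rightarrow> real \<Rightarrow> real \<Rightarrow> cylinder \<Rightarrow> nat \<Rightarrow> cylinder set" where
  "DZ_neg \<Q> \<delta> \<gamma> lam P\<^sub>0 k =
     S_fam \<Q> \<delta> \<gamma> lam P\<^sub>0 k \<union> S_tilde \<Q> \<delta> \<gamma> lam P\<^sub>0 k \<union>
     (\<Union>l\<in>{k<..}. \<Union>P\<in>S_tilde \<Q> \<delta> \<gamma> lam P\<^sub>0 l. sons_iter \<Q> \<delta> \<gamma> lam (l - k) P)"

fun DZ_pos ::
  "(int \<Rightarrow> heis set set) \<Rightarrow> real \<Rightarrow> real \<Rightarrow> real \<Rightarrow> cylinder \<Rightarrow> nat \<Rightarrow> cylinder set" where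
  "DZ_pos \<Q> \<delta> \<gamma> lam P\<^sub>0 0 = DZ_neg \<Q> \<delta> \<gamma> lam P\<^sub>0 0"
| "DZ_pos \<Q> \<delta> \<gamma> lam P\<^sub>0 (Suc k) = (\<Union>P\<in>DZ_pos \<Q> \<delta> \<gamma> lam P\<^sub>0 k. sons \<Q> \<delta> \<gamma> lam P)"

definition DZ_gen ::
  "(int \<Rightarrow> heis set set) \<Rightarrow> real \<Rightarrow> real \<Rightarrow> real \<Rightarrow> cylinder \<Rightarrow> int \<Rightarrow> cylinder set" where
  "DZ_gen \<Q> \<delta> \<gamma> lam P\<^sub>0 k =
     (if k \<le> 0 then DZ_neg \<Q> \<delta> \<gamma> lam P\<^sub>0 (nat (- k)) else DZ_pos \<Q> \<delta> \<gamma> lam P\<^sub>0 (nat k))"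

definition DZ ::
  "(int \<Rightarrow> heis set set) \<Rightarrow> real \<Rightarrow> real \<Rightarrow> real \<Rightarrow> cylinder \<Rightarrow> eheis set set" where
  "DZ \<Q> \<delta> \<gamma> lam P\<^sub>0 = (\<Union>k. cyl_set ` DZ_gen \<Q> \<delta> \<gamma> lam P\<^sub>0 k)"


section \<open>Calderon--Zygmund families\<close>

text \<open>
  The space is \<open>space M\<close>, with distance \<open>d\<close>. In \<open>enlarge\<close>, the condition is
  \<open>d(y, E) < r\<close>, with \<open>d(y, {}) = \<infinity>\<close>.
\<close>

definition enlarge :: "'a measure \<Rightarrow> ('a \<Rightarrow> 'a \<Rightarrow> real) \<Rightarrow> 'a set \<Rightarrow> real \<Rightarrow> 'a set" where
  "enlarge M d E r = {y \<in> space M. \<exists>z\<in>E. d y z < r}"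

text \<open>
  \<open>\<E>\<close> is the countable family of sets occurring in a decomposition of \<open>f\<close> at height \<open>\<alpha>\<close>.
  The enlargements are \<open>d\<close>-open; their measurability is spelled out because \<open>emeasure\<close> vanishes on
  sets that are not measurable. The identity between integrable functions is meant almost everywhere.
\<close>

definition CZ_decomposition ::
  "'a measure \<Rightarrow> ('a \<Rightarrow> 'a \<Rightarrow> real) \<Rightarrow> real \<Rightarrow> ('a \<Rightarrow> complex) \<Rightarrow> real \<Rightarrow> 'a set set \<Rightarrow> bool" where
  "CZ_decomposition M d C\<^sub>0 f \<alpha> \<E> \<longleftrightarrow>
     (\<exists>(J :: nat set) E r x g b.
        \<E> = E ` J \<and>
        (\<forall>j\<in>J. E j \<in> sets M \<and> r j > 0 \<and> x j \<in> space M \<and> integrable M (b j) \<and>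
           enlarge M d (E j) (r j) \<in> sets M) \<and>
        g \<in> borel_measurable M \<and>
        (AE y in M. ((\<lambda>j. b j y) has_sum (f y - g y)) J) \<and>
        (AE y in M. norm (g y) \<le> C\<^sub>0 * \<alpha>) \<and>
        (\<forall>j\<in>J. \<forall>y\<in>space M - E j. b j y = 0) \<and>
        (\<Sum>\<^sub>\<infinity>j\<in>J. \<integral>\<^sup>+y. ennreal (norm (b j y)) \<partial>M)
           \<le> ennreal C\<^sub>0 * (\<integral>\<^sup>+y. ennreal (norm (f y)) \<partial>M) \<and>
        (\<forall>j\<in>J. (LINT y:E j|M. b j y) = 0) \<and>
        (\<forall>j\<in>J. E j \<subseteq> {y \<in> space M. d (x j) y < C\<^sub>0 * r j}) \<and>
        (\<Sum>\<^sub>\<infinity>j\<in>J. emeasure M (enlarge M d (E j) (r j)))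
           \<le> ennreal (C\<^sub>0 / \<alpha>) * (\<integral>\<^sup>+y. ennreal (norm (f y)) \<partial>M))"

text \<open>
  \<open>\<E>s f \<alpha>\<close> is the family chosen for \<open>f\<close> and \<open>\<alpha>\<close>, and \<open>\<E>\<close> is the collection of all
  sets which are used.
\<close>

definition CZ_family :: "'a measure \<Rightarrow> ('a \<Rightarrow> 'a \<Rightarrow> real) \<Rightarrow> 'a set set \<Rightarrow> bool" where
  "CZ_family M d \<E> \<longleftrightarrow>
     (\<exists>C\<^sub>0\<ge>1. \<exists>\<E>s :: ('a \<Rightarrow> complex) \<Rightarrow> real \<Rightarrow> 'a set set.
        (\<forall>f \<alpha>. integrable M f \<longrightarrow> \<alpha> > 0 \<longrightarrow> CZ_decomposition M d C\<^sub>0 f \<alpha> (\<E>s f \<alpha>)) \<and>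
        \<E> = \<Union>{\<E>s f \<alpha> | f \<alpha>. integrable M f \<and> \<alpha> > 0})"

end

theory Submission
  imports Defs
begin

text \<open>
  In the coordinates \<open>(x, y, z) = (q, p - (a - 1), \<tau> + q (a - 1) / 2)\<close> the cylinders are products
  \<open>Q \<times> (a / r, a r)\<close>. Fix a small scale \<open>\<epsilon>\<close> and let \<open>\<phi>\<close> be a truncated logarithm of
  \<open>(1 + (x\<^sup>2 + y\<^sup>2 + \<bar>z\<bar>) / \<epsilon>\<^sup>2) (1 + \<bar>ln (a / \<epsilon>)\<bar>)\<close>, whose support \<open>W\<close> has measure a constant times
  \<open>\<epsilon>\<^sup>4\<close>. On a cylinder over a cube of size at most \<open>\<epsilon>\<close> this function oscillates by a prescribed small
  amount. A cylinder over a larger cube that meets \<open>W\<close> cannot occur in the decomposition of the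
  indicator function of a box of size \<open>\<epsilon>\<close> at a suitable height \<open>\<alpha>\<close>: it contains two points at height about \<open>\<epsilon>\<close>
  whose vertical displacement is of order \<open>\<epsilon>\<close> rather than \<open>\<epsilon>\<^sup>2\<close>, hence is contained only in balls of
  large radius \<open>C\<^sub>0 r\<close>, and then its enlargement, of measure at least about \<open>\<epsilon>\<^sup>4 r\<close>, is too large.
  Integrating the decomposition against \<open>\<phi>\<close>, the good part and the bad parts each give at most a
  quarter of the integral of the function, while the left hand side is at least three quarters of it.
\<close>

section \<open>The cylinders of the family\<close>

text \<open>The obstacle is a mismatch of scales. At height \<open>h\<close> horizontal
  displacements are measured in units of \<open>h\<close> and vertical ones in units of
  \<open>h^2\<close>. As the height tends to 0, the translation that the flow of \<open>Z\<close>
  applies to the base tends to \<open>(0, -1, 0)\<close> and not to the identity, and it conjugates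
  \<open>(X, 0, 0)\<close> into \<open>(X, 0, X)\<close> up to a vanishing relative error. A
  cylinder over a cube of size above \<epsilon> that comes down to height about \<epsilon> therefore
  spreads there without bound as \<epsilon> tends to 0. The constant \<open>C\<^sub>0\<close> comes
  from the assumed decomposition, so the oscillation of the test function has to be made small in
  terms of it. A logarithm achieves this for any fixed comparison factor, at the price of a support
  that is large relative to \<epsilon>, by an amount independent of \<epsilon>. All volumes involved
  scale like \<open>\<epsilon>^4\<close>; hence \<alpha> and the radius bound \<open>R\<close>
  depend only on \<open>C\<^sub>0\<close> and \<open>C\<^sub>1\<close>, and \<epsilon> can be chosen
  after them.\<close>

text \<open>
  Admissibility of the cylinders with \<open>r \<le> exp 1\<close> plays no role: their heights are comparable anyway.
\<close>

fun tame ::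
  "(int \<Rightarrow> heis set set) \<Rightarrow> real \<Rightarrow> real \<Rightarrow> real \<Rightarrow> cylinder \<Rightarrow> bool" where
  "tame \<Q> \<delta> \<gamma> lam (Cyl r k Q a) \<longleftrightarrow>
     Q \<in> \<Q> k \<and> a > 0 \<and> r > 1 \<and> (r \<le> exp 1 \<or> large_admissible \<Q> \<delta> \<gamma> lam (Cyl r k Q a))"

lemma admissible_imp_tame: "admissible \<Q> \<delta> \<gamma> lam P \<Longrightarrow> tame \<Q> \<delta> \<gamma> lam P"
proof (cases P)
  case (Cyl r k Q a)
  have "exp 1 > (1::real)" by simp
  then show "admissible \<Q> \<delta> \<gamma> lam P \<Longrightarrow> ?thesis"
    unfolding admissible_def Cyl by (auto simp del: one_less_exp_iff)
qed

lemma large_admissible_imp_tame: "large_admissible \<Q> \<delta> \<gamma> lam P \<Longrightarrow> tame \<Q> \<delta> \<gamma> lam P"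
  using admissible_imp_tame unfolding admissible_def by blast

lemma cube_parent_mem:
  assumes "christ_decomposition \<Q> \<delta> C\<^sub>1 c" "Q \<in> \<Q> k"
  shows "cube_parent \<Q> k Q \<in> \<Q> (k - 1)"
proof -
  have "\<exists>!Q'. Q' \<in> \<Q> (k - 1) \<and> Q \<subseteq> Q'"
    using assms unfolding christ_decomposition_def by (elim conjE) (simp only: simp_thms)
  from theI'[OF this] show ?thesis unfolding cube_parent_def by blast
qed

section \<open>Sons of large cylinders\<close>

text \<open>Used for \<open>s = sqrt r\<close> with \<open>r > exp 1\<close>: the halves of a large
  cylinder may be small cylinders, whose conditions involve \<open>ln s\<close> in place of powers
  of \<open>s\<close>. With \<sigma> = ln s both bounds follow from
  \<open>1 + x \<le> exp x\<close>.\<close>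

lemma small_halves_bound:
  fixes s :: real
  assumes "exp (1/2) \<le> s" "s \<le> exp 1"
  shows "s ^ 5 \<le> exp 5 * ln s" "exp 2 * ln s \<le> s ^ 3"
proof -
  have s0: "s > 0" using assms(1) by (meson exp_gt_zero less_le_trans)
  define \<sigma> where "\<sigma> = ln s"
  have s: "s = exp \<sigma>" using s0 by (simp add: \<sigma>_def)
  have \<sigma>: "1/2 \<le> \<sigma>" "\<sigma> \<le> 1" using assms unfolding s by simp_all
  have "(1 + 5 * (1 - \<sigma>)) \<le> exp (5 * (1 - \<sigma>))" by (metis exp_ge_add_one_self)
  moreover have "1 \<le> (1 + 5 * (1 - \<sigma>)) * \<sigma>"
  proof -
    have "0 \<le> (1 - \<sigma>) * (5 * \<sigma> - 1)" using \<sigma> by (intro mult_nonneg_nonneg) auto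
    then show ?thesis by (simp add: algebra_simps)
  qed
  ultimately have "1 \<le> exp (5 * (1 - \<sigma>)) * \<sigma>"
    using mult_right_mono[of "1 + 5 * (1 - \<sigma>)" "exp (5 * (1 - \<sigma>))" \<sigma>] \<sigma> by linarith
  then have "exp (5 * \<sigma>) * 1 \<le> exp (5 * \<sigma>) * (exp (5 * (1 - \<sigma>)) * \<sigma>)"
    by (intro mult_left_mono) auto
  also have "\<dots> = exp 5 * \<sigma>"
    by (simp add: mult.assoc[symmetric] flip: exp_add)
  finally show "s ^ 5 \<le> exp 5 * ln s"
    unfolding s by (simp flip: exp_of_nat_mult)
  have "\<sigma> \<le> exp (\<sigma> - 1)" using exp_ge_add_one_self[of "\<sigma> - 1"] by simp
  also have "\<dots> \<le> exp (3 * \<sigma> - 2)" using \<sigma> by simp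
  finally have "exp 2 * \<sigma> \<le> exp 2 * exp (3 * \<sigma> - 2)" by (intro mult_left_mono) auto
  then show "exp 2 * ln s \<le> s ^ 3"
    unfolding s by (simp flip: exp_of_nat_mult exp_add)
qed

lemma power_le_powr_of_ge_one:
  fixes r :: real
  assumes "1 \<le> r" "real m \<le> x"
  shows "r ^ m \<le> r powr x"
  using assms powr_mono[of "real m" x r] by (simp add: powr_realpow)

text \<open>With \<open>s = sqrt r\<close>, the hypotheses confine \<open>\<delta> powi k\<close> to
  the range from \<open>a * s^4\<close> to \<open>a * s^4 / \<delta>\<close>. For the lower half,
  \<open>(a / s) * s powr \<gamma>\<close> still reaches \<open>a * s^4\<close> because \<gamma> is
  at least 5. The factor \<open>1 / \<delta>\<close> is paid by \<open>lam\<close>; in the small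
  case the \<open>exp 3\<close> contained in \<open>lam\<close> covers the passage from
  \<open>exp 2\<close> to \<open>exp 5\<close>.\<close>

lemma halves_admissible:
  fixes \<Q> \<delta> \<gamma> lam r k Q a
  assumes \<delta>: "0 < \<delta>" "\<delta> < 1" and \<gamma>: "\<gamma> \<ge> 5" and lam: "lam > exp 3 / \<delta>"
    and P: "large_admissible \<Q> \<delta> \<gamma> lam (Cyl r k Q a)"
    and small: "\<delta> * \<delta> powi k < a * r\<^sup>2"
  shows "admissible \<Q> \<delta> \<gamma> lam (Cyl (sqrt r) k Q (a / sqrt r))"
    and "admissible \<Q> \<delta> \<gamma> lam (Cyl (sqrt r) k Q (a * sqrt r))"
proof -
  define D where "D = \<delta> powi k"
  define s where "s = sqrt r"
  have r: "r > exp 1" and a: "a > 0" and Q: "Q \<in> \<Q> k" and D1: "a * r\<^sup>2 \<le> D"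
    using P by (auto simp: D_def)
  have r1: "r > 1" using r one_less_exp_iff[of "1::real"] by (meson less_trans zero_less_one)
  have rs: "r = s\<^sup>2" using r1 by (simp add: s_def)
  have s1: "s > 1" using r1 by (simp add: s_def)
  have se: "exp (1/2) \<le> s"
  proof (rule power2_le_imp_le)
    show "(exp (1/2))\<^sup>2 \<le> s\<^sup>2" using r unfolding rs[symmetric] by (simp flip: exp_of_nat_mult)
  qed (use s1 in auto)
  have D1': "a * s ^ 4 \<le> D" using D1 unfolding rs by simp
  have D2: "D < a * s ^ 4 / \<delta>" using small \<delta> unfolding rs D_def[symmetric]
    by (simp add: field_simps)
  have lam1: "1 / \<delta> < lam"
  proof -
    have "1 / \<delta> \<le> exp 3 / \<delta>" using \<delta> by (simp add: divide_right_mono)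
    with lam show ?thesis by simp
  qed
  have lam0: "lam > 0" using lam1 \<delta> by (smt (verit) divide_pos_pos)
  have mono: "x \<le> y \<Longrightarrow> a * x \<le> a * y" for x y using a by simp
  have as: "a / s \<le> a * s"
  proof -
    have "1 / s \<le> 1" using s1 by simp
    then have "1 / s \<le> s" using s1 by linarith
    from mono[OF this] show ?thesis by simp
  qed
  have "admissible \<Q> \<delta> \<gamma> lam (Cyl s k Q (a / s)) \<and> admissible \<Q> \<delta> \<gamma> lam (Cyl s k Q (a * s))"
  proof (cases "s > exp 1")
    case True
    have p: "s ^ 5 \<le> s powr \<gamma>" by (rule power_le_powr_of_ge_one) (use s1 \<gamma> in auto)
    have "s * s ^ 4 \<le> s powr \<gamma>" using p by (simp add: power_Suc[symmetric] del: power_Suc)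
    then have "s ^ 4 \<le> s powr \<gamma> / s" using s1 by (simp add: field_simps)
    have u: "D \<le> lam * (a / s) * s powr \<gamma>"
    proof -
      have "D \<le> (1 / \<delta>) * (a * s ^ 4)" using D2 by simp
      also have "\<dots> \<le> lam * (a * (s powr \<gamma> / s))"
        using lam1 lam0 a s1 \<delta> \<open>s ^ 4 \<le> s powr \<gamma> / s\<close> by (intro mult_mono mono) auto
      finally show ?thesis by (simp add: field_simps)
    qed
    have v: "lam * (a / s) * s powr \<gamma> \<le> lam * (a * s) * s powr \<gamma>"
      using lam0 as by (intro mult_right_mono mult_left_mono) auto
    have "s \<le> s ^ 4" "s ^ 3 \<le> s ^ 4" using s1 power_increasing[of 1 4 s] power_increasing[of 3 4 s] by simp_all
    from mono[OF this(1)] mono[OF this(2)] D1'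
    have l: "a / s * s\<^sup>2 \<le> D" "a * s * s\<^sup>2 \<le> D"
      using s1 by (simp_all add: power2_eq_square power3_eq_cube mult_ac)
    show ?thesis using True u v l Q a s1 unfolding admissible_def D_def by simp
  next
    case False
    then have se1: "s \<le> exp 1" by simp
    have ln: "ln s > 0" using s1 by simp
    note b = small_halves_bound[OF se se1]
    have u: "D \<le> lam * (a / s) * exp 2 * ln s"
    proof -
      have "D \<le> (1 / \<delta>) * (a / s) * s ^ 5" using D2 s1 \<delta> by (simp add: eval_nat_numeral)
      also have "\<dots> \<le> (1 / \<delta>) * (a / s) * (exp 5 * ln s)"
        using b(1) a s1 \<delta> by (intro mult_left_mono) auto
      also have "\<dots> = (exp 3 / \<delta>) * ((a / s) * exp 2 * ln s)" 
        using exp_add[of "3::real" 2] by (simp add: field_simps)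
      also have "\<dots> \<le> lam * ((a / s) * exp 2 * ln s)"
        using lam a s1 ln by (intro mult_right_mono) auto
      finally show ?thesis by (simp add: mult.assoc)
    qed
    have v: "lam * (a / s) * exp 2 * ln s \<le> lam * (a * s) * exp 2 * ln s"
      using lam0 ln as by (intro mult_right_mono mult_left_mono) auto
    have l2: "a * s * exp 2 * ln s \<le> D"
    proof -
      have "a * s * (exp 2 * ln s) \<le> a * s * s ^ 3" using b(2) a s1 by (intro mult_left_mono) auto
      also have "\<dots> = a * s ^ 4" by (simp add: power4_eq_xxxx power3_eq_cube)
      finally show ?thesis using D1' by (simp add: mult.assoc)
    qed
    have l1: "a / s * exp 2 * ln s \<le> D"
    proof -
      have "a / s * exp 2 * ln s \<le> a * s * exp 2 * ln s" using ln as by (intro mult_right_mono) auto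
      with l2 show ?thesis by simp
    qed
    show ?thesis using u v l1 l2 Q a s1 se1 unfolding admissible_def D_def by simp
  qed
  then show "admissible \<Q> \<delta> \<gamma> lam (Cyl (sqrt r) k Q (a / sqrt r))"
    and "admissible \<Q> \<delta> \<gamma> lam (Cyl (sqrt r) k Q (a * sqrt r))" by (auto simp: s_def)
qed

text \<open>The critical case is a large cylinder whose base is subdivided. Its halves were not both
  admissible, so the contrapositive of \<open>halves_admissible\<close> yields
  \<open>a * r^2 \<le> \<delta> * \<delta> powi k\<close>, which is the lower condition for
  generation \<open>k + 1\<close>; the upper one persists because the size of the cubes
  decreases.\<close>

lemma sons_tame:
  assumes \<delta>: "0 < \<delta>" "\<delta> < 1" and \<gamma>: "\<gamma> \<ge> 5" and lam: "lam > exp 3 / \<delta>"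
    and P: "tame \<Q> \<delta> \<gamma> lam P" and P': "P' \<in> sons \<Q> \<delta> \<gamma> lam P"
  shows "tame \<Q> \<delta> \<gamma> lam P'"
proof -
  obtain r k Q a where PC: "P = Cyl r k Q a" by (cases P)
  show ?thesis
  proof (cases "admissible \<Q> \<delta> \<gamma> lam (Cyl (sqrt r) k Q (a / sqrt r)) \<and>
         admissible \<Q> \<delta> \<gamma> lam (Cyl (sqrt r) k Q (a * sqrt r))")
    case True
    then show ?thesis using P' admissible_imp_tame unfolding PC by (auto simp del: tame.simps)
  next
    case False
    then obtain Q' where Q': "P' = Cyl r (k + 1) Q' a" "Q' \<in> \<Q> (k + 1)"
      using P' unfolding PC by (auto simp: cube_sons_def simp del: admissible_def split: if_splits)
    show ?thesis
    proof (cases "r \<le> exp 1")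
      case True
      then show ?thesis using P Q' unfolding PC by simp
    next
      case r: False
      then have L: "large_admissible \<Q> \<delta> \<gamma> lam (Cyl r k Q a)" using P unfolding PC by simp
      have "a * r\<^sup>2 \<le> \<delta> * \<delta> powi k"
        using halves_admissible[OF \<delta> \<gamma> lam L] False by (meson not_le_imp_less)
      moreover have e: "\<delta> powi (k + 1) = \<delta> * \<delta> powi k" using \<delta> by (simp add: power_int_add_1')
      moreover have "\<delta> * \<delta> powi k \<le> \<delta> powi k" using \<delta> by (simp add: mult_le_cancel_right1)
      ultimately have "large_admissible \<Q> \<delta> \<gamma> lam (Cyl r (k + 1) Q' a)"
        using L Q' by auto
      then show ?thesis using large_admissible_imp_tame Q' by blast
    qed
  qed
qed

section \<open>Parents along the chain\<close>

text \<open>Since \<open>r > exp 1\<close>, the horizontal parent can fail only through its upper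
  condition. As \<open>lam * \<delta> \<ge> 1\<close>, this gives
  \<open>a * r powr \<gamma> \<le> \<delta> powi k\<close>, hence
  \<open>a * r^5 \<le> \<delta> powi k\<close>. The four vertical cylinders require this with the
  exponents 5, 4, 4 and 1, and the upper condition with exponents of \<open>r\<close> that are all
  at least \<gamma>.\<close>

lemma large_admissible_vertical:
  fixes \<Q> \<delta> \<gamma> lam r k Q a
  assumes C: "christ_decomposition \<Q> \<delta> C\<^sub>1 c" and \<gamma>: "\<gamma> \<ge> 5" and lam: "lam > exp 3 / \<delta>"
    and P: "large_admissible \<Q> \<delta> \<gamma> lam (Cyl r k Q a)"
    and n: "\<not> admissible \<Q> \<delta> \<gamma> lam (parent_side \<Q> (Cyl r k Q a))"
  shows "large_admissible \<Q> \<delta> \<gamma> lam (Cyl (r\<^sup>2) k Q (a * r))"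
    and "large_admissible \<Q> \<delta> \<gamma> lam (Cyl (r ^ 3) k Q (a / r\<^sup>2))"
    and "large_admissible \<Q> \<delta> \<gamma> lam (Cyl r k Q (a * r\<^sup>2))"
    and "large_admissible \<Q> \<delta> \<gamma> lam (Cyl (r\<^sup>2) k Q (a / r ^ 3))"
proof -
  define D where "D = \<delta> powi k"
  have \<delta>: "0 < \<delta>" "\<delta> < 1" using C by (auto simp: christ_decomposition_def)
  have r: "r > exp 1" and a: "a > 0" and Q: "Q \<in> \<Q> k" and D1: "a * r\<^sup>2 \<le> D"
    and D2: "D \<le> lam * a * r powr \<gamma>"
    using P by (auto simp: D_def)
  have r1: "r > 1" using r one_less_exp_iff[of "1::real"] by (meson less_trans zero_less_one)
  have D0: "D > 0" using \<delta> by (simp add: D_def)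
  have e: "\<delta> powi (k - 1) = D / \<delta>" using \<delta> by (simp add: power_int_diff D_def)
  have "D \<le> D / \<delta>" using \<delta> D0 by (simp add: field_simps mult_le_cancel_left1)
  then have "\<not> D / \<delta> \<le> lam * a * r powr \<gamma>"
    using n cube_parent_mem[OF C Q] r a D1 unfolding admissible_def by (auto simp: e)
  then have "lam * a * r powr \<gamma> * \<delta> < D" using \<delta> by (simp add: field_simps)
  moreover have "1 \<le> lam * \<delta>"
  proof -
    have "exp 3 < lam * \<delta>" using lam \<delta> by (simp add: field_simps)
    moreover have "1 < exp (3::real)" by simp
    ultimately show ?thesis by linarith
  qed
  then have "1 * (a * r powr \<gamma>) \<le> (lam * \<delta>) * (a * r powr \<gamma>)" using a by (intro mult_right_mono) auto
  ultimately have D3: "a * r powr \<gamma> \<le> D" by (simp add: mult_ac)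
  have "r ^ 5 \<le> r powr \<gamma>" by (rule power_le_powr_of_ge_one) (use r1 \<gamma> in auto)
  then have D5: "a * r ^ 5 \<le> D" using a D3 by (meson mult_left_mono order_trans less_imp_le)
  have lam0: "lam > 0" using lam \<delta> by (meson divide_pos_pos exp_gt_zero less_trans)
  have lo: "a * r ^ m \<le> D" if "m \<le> 5" for m
  proof -
    have "r ^ m \<le> r ^ 5" using r1 that by (intro power_increasing) auto
    then show ?thesis using a D5 by (meson mult_left_mono order_trans less_imp_le)
  qed
  have hi: "D \<le> lam * (a * r powr x)" if "\<gamma> \<le> x" for x
  proof -
    have "lam * (a * r powr \<gamma>) \<le> lam * (a * r powr x)"
      using lam0 a r1 that by (intro mult_left_mono powr_mono) auto
    with D2 show ?thesis by (simp add: mult_ac)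
  qed
  have rm: "r \<le> r ^ m" if "m \<ge> 1" for m using r1 that power_increasing[of 1 m r] by simp
  have pw: "(r ^ m) powr \<gamma> = r powr (real m * \<gamma>)" for m
    using r1 by (simp add: powr_powr flip: powr_realpow)
  have up: "D \<le> lam * (a * r) * (r\<^sup>2) powr \<gamma>"
    using hi[of "2 * \<gamma> + 1"] \<gamma> pw[of 2] r1 by (simp add: powr_add mult_ac)
  have dn: "D \<le> lam * (a / r\<^sup>2) * (r ^ 3) powr \<gamma>"
    using hi[of "3 * \<gamma> - 2"] \<gamma> pw[of 3] r1 powr_realpow[of r 2] by (simp add: powr_diff mult_ac)
  have vu: "D \<le> lam * (a * r\<^sup>2) * r powr \<gamma>"
    using hi[of "\<gamma> + 2"] \<gamma> r1 powr_realpow[of r 2] by (simp add: powr_add mult_ac)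
  have vd: "D \<le> lam * (a / r ^ 3) * (r\<^sup>2) powr \<gamma>"
    using hi[of "2 * \<gamma> - 3"] \<gamma> pw[of 2] r1 powr_realpow[of r 3] by (simp add: powr_diff mult_ac)
  have e1: "a * r * (r\<^sup>2)\<^sup>2 = a * r ^ 5" "a / r\<^sup>2 * (r ^ 3)\<^sup>2 = a * r ^ 4"
    "a * r\<^sup>2 * r\<^sup>2 = a * r ^ 4" "a / r ^ 3 * (r\<^sup>2)\<^sup>2 = a * r ^ 1"
    using r1 by (simp_all add: power2_eq_square eval_nat_numeral)
  show "large_admissible \<Q> \<delta> \<gamma> lam (Cyl (r\<^sup>2) k Q (a * r))"
    using up Q a r1 rm[of 2] r lo[of 5] unfolding D_def[symmetric] large_admissible.simps e1 by auto
  show "large_admissible \<Q> \<delta> \<gamma> lam (Cyl (r ^ 3) k Q (a / r\<^sup>2))"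
    using dn Q a r1 rm[of 3] r lo[of 4] unfolding D_def[symmetric] large_admissible.simps e1 by auto
  show "large_admissible \<Q> \<delta> \<gamma> lam (Cyl r k Q (a * r\<^sup>2))"
    using vu Q a r1 r lo[of 4] unfolding D_def[symmetric] large_admissible.simps e1 by auto
  show "large_admissible \<Q> \<delta> \<gamma> lam (Cyl (r\<^sup>2) k Q (a / r ^ 3))"
    using vd Q a r1 rm[of 2] r lo[of 1] unfolding D_def[symmetric] large_admissible.simps e1 by auto
qed

lemma chain_large_admissible:
  assumes C: "christ_decomposition \<Q> \<delta> C\<^sub>1 c" and \<gamma>: "\<gamma> \<ge> 5" and lam: "lam > exp 3 / \<delta>"
    and P: "large_admissible \<Q> \<delta> \<gamma> lam P\<^sub>0"
  shows "large_admissible \<Q> \<delta> \<gamma> lam (fst (chain \<Q> \<delta> \<gamma> lam P\<^sub>0 k))"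
proof (induction k)
  case 0
  then show ?case using P by (simp add: chain_def)
next
  case (Suc k)
  obtain r j Q a up where c: "chain \<Q> \<delta> \<gamma> lam P\<^sub>0 k = (Cyl r j Q a, up)"
    by (metis cylinder.exhaust surj_pair)
  have cS: "chain \<Q> \<delta> \<gamma> lam P\<^sub>0 (Suc k) = chain_step \<Q> \<delta> \<gamma> lam (Cyl r j Q a, up)"
    using c by (simp add: chain_def)
  have L: "large_admissible \<Q> \<delta> \<gamma> lam (Cyl r j Q a)" using Suc c by simp
  show ?case
  proof (cases "admissible \<Q> \<delta> \<gamma> lam (parent_side \<Q> (Cyl r j Q a))")
    case True
    \<comment> \<open>The horizontal parent keeps \<open>r > exp 1\<close>, so it can be admissible
      only as a large cylinder.\<close>
    have "\<not> small_admissible \<Q> \<delta> lam (parent_side \<Q> (Cyl r j Q a))" using L by simp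
    then show ?thesis using True unfolding cS
      by (simp add: admissible_def del: large_admissible.simps small_admissible.simps parent_side.simps)
  next
    case False
    then show ?thesis
      using large_admissible_vertical(1,2)[OF C \<gamma> lam L False] False unfolding cS
      by (simp del: large_admissible.simps parent_side.simps)
  qed
qed

lemma same_generation_large_admissible:
  assumes "large_admissible \<Q> \<delta> \<gamma> lam P" "P' \<in> same_generation \<Q> P"
  shows "large_admissible \<Q> \<delta> \<gamma> lam P'"
  using assms by (cases P) auto

lemma S_fam_tame:
  assumes C: "christ_decomposition \<Q> \<delta> C\<^sub>1 c" and \<gamma>: "\<gamma> \<ge> 5" and lam: "lam > exp 3 / \<delta>"
    and P: "large_admissible \<Q> \<delta> \<gamma> lam P\<^sub>0" and "P \<in> S_fam \<Q> \<delta> \<gamma> lam P\<^sub>0 k"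
  shows "tame \<Q> \<delta> \<gamma> lam P"
  using assms(5) chain_large_admissible[OF C \<gamma> lam P] same_generation_large_admissible
    large_admissible_imp_tame
  unfolding S_fam_def by blast

lemma S_tilde_tame:
  assumes C: "christ_decomposition \<Q> \<delta> C\<^sub>1 c" and \<gamma>: "\<gamma> \<ge> 5" and lam: "lam > exp 3 / \<delta>"
    and P: "large_admissible \<Q> \<delta> \<gamma> lam P\<^sub>0" and P': "P \<in> S_tilde \<Q> \<delta> \<gamma> lam P\<^sub>0 k"
  shows "tame \<Q> \<delta> \<gamma> lam P"
proof -
  obtain r j Q a up where c: "chain \<Q> \<delta> \<gamma> lam P\<^sub>0 k = (Cyl r j Q a, up)"
    by (metis cylinder.exhaust surj_pair)
  have L: "large_admissible \<Q> \<delta> \<gamma> lam (Cyl r j Q a)"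
    using chain_large_admissible[OF C \<gamma> lam P, of k] c by simp
  have n: "\<not> admissible \<Q> \<delta> \<gamma> lam (parent_side \<Q> (Cyl r j Q a))"
    and m: "P \<in> same_generation \<Q> (vertical_difference (Cyl r j Q a, up))"
    using P' unfolding S_tilde_def c by (auto split: if_splits)
  have "large_admissible \<Q> \<delta> \<gamma> lam (vertical_difference (Cyl r j Q a, up))"
    using large_admissible_vertical(3,4)[OF C \<gamma> lam L n] by (simp del: large_admissible.simps)
  then show ?thesis using m same_generation_large_admissible large_admissible_imp_tame by blast
qed

lemma sons_iter_tame:
  assumes "0 < \<delta>" "\<delta> < 1" "\<gamma> \<ge> 5" "lam > exp 3 / \<delta>"
    and P: "tame \<Q> \<delta> \<gamma> lam P" and "P' \<in> sons_iter \<Q> \<delta> \<gamma> lam m P"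
  shows "tame \<Q> \<delta> \<gamma> lam P'"
  using assms(6)
proof (induction m arbitrary: P')
  case 0
  then show ?case using P by (simp add: sons_iter_def)
next
  case (Suc m)
  then show ?case using sons_tame[OF assms(1-4)] by (auto simp: sons_iter_def)
qed

text \<open>This is what the geometric argument retains of the recursive construction: an inclusion
  of the family in the class of tame cylinders.\<close>

lemma DZ_tame:
  assumes C: "christ_decomposition \<Q> \<delta> C\<^sub>1 c" and \<gamma>: "\<gamma> \<ge> 5" and lam: "lam > exp 3 / \<delta>"
    and P: "large_admissible \<Q> \<delta> \<gamma> lam P\<^sub>0" and E: "E \<in> DZ \<Q> \<delta> \<gamma> lam P\<^sub>0"
  obtains P where "tame \<Q> \<delta> \<gamma> lam P" "E = cyl_set P"
proof -
  have \<delta>: "0 < \<delta>" "\<delta> < 1" using C by (auto simp: christ_decomposition_def)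
  have neg: "tame \<Q> \<delta> \<gamma> lam P" if "P \<in> DZ_neg \<Q> \<delta> \<gamma> lam P\<^sub>0 k" for P k
    using that S_fam_tame[OF C \<gamma> lam P] S_tilde_tame[OF C \<gamma> lam P] sons_iter_tame[OF \<delta> \<gamma> lam]
    unfolding DZ_neg_def by blast
  have pos: "tame \<Q> \<delta> \<gamma> lam P" if "P \<in> DZ_pos \<Q> \<delta> \<gamma> lam P\<^sub>0 k" for P k
    using that
  proof (induction k arbitrary: P)
    case 0
    then show ?case using neg by simp
  next
    case (Suc k)
    then show ?case using sons_tame[OF \<delta> \<gamma> lam] by auto
  qed
  obtain j P' where P': "P' \<in> DZ_gen \<Q> \<delta> \<gamma> lam P\<^sub>0 j" "E = cyl_set P'"
    using E unfolding DZ_def by blast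
  have "tame \<Q> \<delta> \<gamma> lam P'"
    using P'(1) neg pos unfolding DZ_gen_def by (meson)
  then show ?thesis using that P'(2) by blast
qed

section \<open>Horizontal curves and distances\<close>

text \<open>The fundamental theorem of calculus is applied up to time \<tau>, while \<open>L\<close>
  integrates the speed over all of \<open>{0..1}\<close>. The bound is thus uniform in \<tau> and
  controls the whole curve, not only its end point.\<close>

lemma has_integral_sqrt_speed_bound:
  fixes h :: "real \<Rightarrow> real"
  assumes cont: "continuous_on {0..1} h" and T: "finite T"
    and der: "\<And>t. t \<in> {0..1} - T \<Longrightarrow> (h has_real_derivative h' t) (at t)"
    and bd: "\<And>t. t \<in> {0..1} - T \<Longrightarrow> \<bar>h' t\<bar> \<le> M * s t"
    and s: "(s has_integral L) {0..1}" and s0: "\<And>t. 0 \<le> s t" and M: "0 \<le> M"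
    and \<tau>: "\<tau> \<in> {0..1}"
  shows "\<bar>h \<tau> - h 0\<bar> \<le> M * L"
proof -
  \<comment> \<open>The value 0 on the exceptional set makes the bound by \<open>M * s t\<close>
    valid at every point.\<close>
  define d where "d t = (if t \<in> T then 0 else h' t)" for t
  have sub: "{0..\<tau>} \<subseteq> {0..1}" using \<tau> by auto
  have "(d has_integral (h \<tau> - h 0)) {0..\<tau>}"
  proof (rule fundamental_theorem_of_calculus_strong[OF T])
    show "0 \<le> \<tau>" using \<tau> by simp
    show "(h has_vector_derivative d x) (at x)" if "x \<in> {0..\<tau>} - T" for x
      using der[of x] that sub
      by (auto simp: d_def has_real_derivative_iff_has_vector_derivative)
    show "continuous_on {0..\<tau>} h" using cont sub by (rule continuous_on_subset)
  qed
  moreover have si: "s integrable_on {0..\<tau>}"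
    using s sub by (meson has_integral_integrable integrable_subinterval_real)
  ultimately have "norm (integral {0..\<tau>} d) \<le> integral {0..\<tau>} (\<lambda>t. M * s t)"
    "integral {0..\<tau>} d = h \<tau> - h 0"
    using bd s0 M sub
    by - (rule integral_norm_bound_integral,
        auto intro!: integrable_on_mult_right simp: d_def integral_unique)
  then have "\<bar>h \<tau> - h 0\<bar> \<le> integral {0..\<tau>} (\<lambda>t. M * s t)" by simp
  also have "\<dots> = M * integral {0..\<tau>} s" by simp
  also have "\<dots> \<le> M * integral {0..1} s"
    using si s s0 sub M by (intro mult_left_mono integral_subset_le) auto
  finally show ?thesis using s by (simp add: integral_unique)
qed

abbreviation eheis_frame :: "(eheis \<Rightarrow> eheis) list" where
  "eheis_frame \<equiv> map (left_invariant_field eheis_mult eheis_one) [X_0, X_alpha, X_alpha_beta]"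

abbreviation heis_frame :: "(heis \<Rightarrow> heis) list" where
  "heis_frame \<equiv> [left_invariant_field heis_mult (0, 0, 0) (0, 1, 0),
      left_invariant_field heis_mult (0, 0, 0) (1, 0, 0)]"

lemma sum_length_eheis_frame:
  "(\<Sum>i<length eheis_frame. f i) = f 0 + f 1 + (f 2 :: 'a :: comm_monoid_add)"
  by (simp add: numeral_3_eq_3 numeral_2_eq_2)

lemma sum_length_heis_frame: "(\<Sum>i<length heis_frame. f i) = f 0 + (f 1 :: 'a :: comm_monoid_add)"
  by (simp add: numeral_2_eq_2)

lemma sum_eheis_frame:
  "(\<Sum>i<length eheis_frame. u i *\<^sub>R (eheis_frame ! i) ((q, p, \<tau>), a)) =
     ((a * u 2, a * u 1, (p * (a * u 2) - q * (a * u 1)) / 2), a * u (0::nat))"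
  unfolding sum_length_eheis_frame
  by (simp add: X_0_def X_alpha_def X_alpha_beta_def left_invariant_field_eheis)

lemma sum_heis_frame:
  "(\<Sum>i<length heis_frame. u i *\<^sub>R (heis_frame ! i) (q, p, \<tau>)) =
     (u 1, u (0::nat), (p * u 1 - q * u 0) / 2)"
  unfolding sum_length_heis_frame
  by (simp add: left_invariant_field_heis)

lemma has_vector_derivative_heis_iff:
  fixes \<gamma> :: "real \<Rightarrow> heis"
  shows "(\<gamma> has_vector_derivative (x, y, z)) (at t) \<longleftrightarrow>
     ((\<lambda>t. (\<gamma> t, 1::real)) has_vector_derivative ((x, y, z), 0)) (at t)"
proof
  assume "(\<gamma> has_vector_derivative (x, y, z)) (at t)"
  then show "((\<lambda>t. (\<gamma> t, 1::real)) has_vector_derivative ((x, y, z), 0)) (at t)"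
    by (intro has_vector_derivative_Pair) auto
next
  assume "((\<lambda>t. (\<gamma> t, 1::real)) has_vector_derivative ((x, y, z), 0)) (at t)"
  then show "(\<gamma> has_vector_derivative (x, y, z)) (at t)"
    unfolding has_vector_derivative_def by (auto dest: has_derivative_fst)
qed

text \<open>At height 1 the fields of \<open>X_alpha\<close> and \<open>X_alpha_beta\<close>
  restrict to the Heisenberg frame, so one set of curve estimates, made in the larger group, serves
  both distances.\<close>

lemma horizontal_curve_length_lift:
  assumes "horizontal_curve_length UNIV heis_frame \<gamma> L"
  shows "horizontal_curve_length eheis_carrier eheis_frame (\<lambda>t. (\<gamma> t, 1)) L"
proof -
  obtain u T where \<gamma>: "\<gamma> piecewise_C1_differentiable_on {0..1}" and T: "finite T"
    and der: "\<And>t. t \<in> {0..1} - T \<Longrightarrow>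
      (\<gamma> has_vector_derivative (\<Sum>i<length heis_frame. u i t *\<^sub>R (heis_frame ! i) (\<gamma> t))) (at t)"
    and L: "((\<lambda>t. sqrt (\<Sum>i<length heis_frame. (u i t)\<^sup>2)) has_integral L) {0..1}"
    using assms unfolding horizontal_curve_length_def by blast
  \<comment> \<open>The control along \<open>X_0\<close>, the first field of the larger frame, is
    zero; the other two move up by one index.\<close>
  define v where "v i t = (case i of 0 \<Rightarrow> 0 | Suc j \<Rightarrow> u j t)" for i :: nat and t :: real
  obtain S where S: "finite S" "continuous_on {0..1} \<gamma>" "\<gamma> C1_differentiable_on ({0..1} - S)"
    using \<gamma> unfolding piecewise_C1_differentiable_on_def by blast
  then obtain D where D: "\<And>t. t \<in> {0..1} - S \<Longrightarrow> (\<gamma> has_vector_derivative D t) (at t)"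
    "continuous_on ({0..1} - S) D"
    unfolding C1_differentiable_on_def by blast
  have "(\<lambda>t. (\<gamma> t, 1::real)) C1_differentiable_on ({0..1} - S)"
    unfolding C1_differentiable_on_def
    by (rule exI[of _ "\<lambda>t. (D t, 0)"])
      (use D in \<open>auto intro!: has_vector_derivative_Pair continuous_intros\<close>)
  then have "(\<lambda>t. (\<gamma> t, 1::real)) piecewise_C1_differentiable_on {0..1}"
    using S unfolding piecewise_C1_differentiable_on_def by (auto intro!: continuous_intros)
  moreover have "((\<lambda>t. (\<gamma> t, 1::real)) has_vector_derivative
      (\<Sum>i<length eheis_frame. v i t *\<^sub>R (eheis_frame ! i) (\<gamma> t, 1))) (at t)"
    if t: "t \<in> {0..1} - T" for t
  proof -
    obtain q p \<tau> where g: "\<gamma> t = (q, p, \<tau>)" by (metis prod.collapse)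
    show ?thesis
      using der[OF t] unfolding g sum_eheis_frame sum_heis_frame has_vector_derivative_heis_iff
      by (simp add: v_def numeral_2_eq_2)
  qed
  moreover have "((\<lambda>t. sqrt (\<Sum>i<length eheis_frame. (v i t)\<^sup>2)) has_integral L) {0..1}"
    using L unfolding sum_length_eheis_frame sum_length_heis_frame
    by (simp add: v_def numeral_2_eq_2)
  ultimately show ?thesis
    using T unfolding horizontal_curve_length_def eheis_carrier_def
    by (intro conjI exI[of _ v] exI[of _ T]) auto
qed

locale eheis_curve =
  fixes \<gamma> :: "real \<Rightarrow> eheis" and L :: real
  assumes \<gamma>: "horizontal_curve_length eheis_carrier eheis_frame \<gamma> L"
begin

definition "q t = fst (fst (\<gamma> t))"

definition "p t = fst (snd (fst (\<gamma> t)))"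

definition "\<tau> t = snd (snd (fst (\<gamma> t)))"

definition "a t = snd (\<gamma> t)"

lemma continuous: "continuous_on {0..1} q" "continuous_on {0..1} p" "continuous_on {0..1} \<tau>"
  "continuous_on {0..1} a"
proof -
  have "continuous_on {0..1} \<gamma>"
    using \<gamma> unfolding horizontal_curve_length_def piecewise_C1_differentiable_on_def by blast
  then show "continuous_on {0..1} q" "continuous_on {0..1} p" "continuous_on {0..1} \<tau>"
    "continuous_on {0..1} a"
    unfolding q_def p_def \<tau>_def a_def by (auto intro!: continuous_intros)
qed

lemma height_pos: "t \<in> {0..1} \<Longrightarrow> a t > 0"
  using \<gamma> unfolding horizontal_curve_length_def eheis_carrier_def a_def by blast

text \<open>The coefficients \<open>u0\<close>, \<open>u1\<close>, \<open>u2\<close> belong to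
  \<open>X_0\<close>, \<open>X_alpha\<close>, \<open>X_alpha_beta\<close>; the factor
  \<open>a t\<close> is the scaling of left-invariant fields with the height. The equation for
  \<tau> says that it changes at the rate of signed area swept out in the plane of \<open>q\<close>
  and \<open>p\<close>.\<close>

definition "control u0 u1 u2 T \<longleftrightarrow> finite T \<and>
    (\<forall>t\<in>{0..1} - T. (a has_real_derivative a t * u0 t) (at t)) \<and>
    (\<forall>t\<in>{0..1} - T. (p has_real_derivative a t * u1 t) (at t)) \<and>
    (\<forall>t\<in>{0..1} - T. (q has_real_derivative a t * u2 t) (at t)) \<and>
    (\<forall>t\<in>{0..1} - T. (\<tau> has_real_derivative (p t * (a t * u2 t) - q t * (a t * u1 t)) / 2) (at t)) \<and>
    ((\<lambda>t. sqrt ((u0 t)\<^sup>2 + (u1 t)\<^sup>2 + (u2 t)\<^sup>2)) has_integral L) {0..1}"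

lemma controlD:
  assumes "control u0 u1 u2 T"
  shows "finite T"
    "\<And>t. t \<in> {0..1} - T \<Longrightarrow> (a has_real_derivative a t * u0 t) (at t)"
    "\<And>t. t \<in> {0..1} - T \<Longrightarrow> (p has_real_derivative a t * u1 t) (at t)"
    "\<And>t. t \<in> {0..1} - T \<Longrightarrow> (q has_real_derivative a t * u2 t) (at t)"
    "\<And>t. t \<in> {0..1} - T \<Longrightarrow>
       (\<tau> has_real_derivative (p t * (a t * u2 t) - q t * (a t * u1 t)) / 2) (at t)"
    "((\<lambda>t. sqrt ((u0 t)\<^sup>2 + (u1 t)\<^sup>2 + (u2 t)\<^sup>2)) has_integral L) {0..1}"
  using assms unfolding control_def by blast+

lemma control_exists: "\<exists>u0 u1 u2 T. control u0 u1 u2 T"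
proof -
  obtain u T where T: "finite T"
    and der: "\<And>t. t \<in> {0..1} - T \<Longrightarrow>
      (\<gamma> has_vector_derivative (\<Sum>i<length eheis_frame. u i t *\<^sub>R (eheis_frame ! i) (\<gamma> t))) (at t)"
    and L: "((\<lambda>t. sqrt (\<Sum>i<length eheis_frame. (u i t)\<^sup>2)) has_integral L) {0..1}"
    using \<gamma> unfolding horizontal_curve_length_def by blast
  have eq: "\<gamma> t = ((q t, p t, \<tau> t), a t)" for t by (simp add: q_def p_def \<tau>_def a_def)
  have "((\<lambda>t. q t) has_real_derivative a t * u 2 t) (at t) \<and>
    ((\<lambda>t. p t) has_real_derivative a t * u 1 t) (at t) \<and>
    ((\<lambda>t. \<tau> t) has_real_derivative (p t * (a t * u 2 t) - q t * (a t * u 1 t)) / 2) (at t) \<and>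
    ((\<lambda>t. a t) has_real_derivative a t * u 0 t) (at t)" if "t \<in> {0..1} - T" for t
    using der[OF that] unfolding eq[of t] sum_eheis_frame has_vector_derivative_eheis_iff
    unfolding q_def p_def \<tau>_def a_def .
  moreover have "((\<lambda>t. sqrt ((u 0 t)\<^sup>2 + (u 1 t)\<^sup>2 + (u 2 t)\<^sup>2)) has_integral L) {0..1}"
    using L unfolding sum_length_eheis_frame .
  ultimately have "control (u 0) (u 1) (u 2) T" using T unfolding control_def by auto
  then show ?thesis by blast
qed

lemma length_nonneg: "0 \<le> L"
proof -
  obtain u0 u1 u2 T where "control u0 u1 u2 T" using control_exists by blast
  note T = controlD(1)[OF this] and u0 = controlD(2)[OF this] and u1 = controlD(3)[OF this]
    and u2 = controlD(4)[OF this] and d\<tau> = controlD(5)[OF this] and L = controlD(6)[OF this]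
  from L show ?thesis by (rule has_integral_nonneg) simp
qed

text \<open>The field of \<open>X_0\<close> is multiplicative in the height, so \<open>ln a\<close>
  has derivative \<open>u0\<close>, which the speed dominates.\<close>

lemma height_bound:
  assumes t: "t \<in> {0..1}"
  shows "\<bar>ln (a t) - ln (a 0)\<bar> \<le> L"
proof -
  obtain u0 u1 u2 T where "control u0 u1 u2 T" using control_exists by blast
  note T = controlD(1)[OF this] and u0 = controlD(2)[OF this] and u1 = controlD(3)[OF this]
    and u2 = controlD(4)[OF this] and d\<tau> = controlD(5)[OF this] and L = controlD(6)[OF this]
  have "\<bar>ln (a t) - ln (a 0)\<bar> \<le> 1 * L"
  proof (rule has_integral_sqrt_speed_bound[OF _ T _ _ L, where h' = u0])
    show "continuous_on {0..1} (\<lambda>t. ln (a t))"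
      using continuous(4) height_pos by (intro continuous_intros) force+
    show "((\<lambda>t. ln (a t)) has_real_derivative u0 t) (at t)" if "t \<in> {0..1} - T" for t
      using u0[OF that] height_pos[of t] that
      by (auto intro!: derivative_eq_intros)
    show "\<bar>u0 t\<bar> \<le> 1 * sqrt ((u0 t)\<^sup>2 + (u1 t)\<^sup>2 + (u2 t)\<^sup>2)" for t
      by (simp add: real_le_rsqrt)
  qed (use t in auto)
  then show ?thesis by simp
qed

text \<open>The third quantity is the vertical component of the inverse of the starting point times
  the current point. Its derivative contains \<open>p t - p 0\<close> and \<open>q t - q 0\<close>
  in place of \<open>p t\<close> and \<open>q t\<close>. These are already at most
  \<open>A * L\<close>, which makes the bound quadratic.\<close>

lemma displacement:
  assumes A: "\<And>t. t \<in> {0..1} \<Longrightarrow> a t \<le> A" and t: "t \<in> {0..1}"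
  shows "\<bar>q t - q 0\<bar> \<le> A * L" "\<bar>p t - p 0\<bar> \<le> A * L"
    "\<bar>\<tau> t - \<tau> 0 - (p 0 * (q t - q 0) - q 0 * (p t - p 0)) / 2\<bar> \<le> (A * L)\<^sup>2"
proof -
  obtain u0 u1 u2 T where "control u0 u1 u2 T" using control_exists by blast
  note T = controlD(1)[OF this] and u0 = controlD(2)[OF this] and u1 = controlD(3)[OF this]
    and u2 = controlD(4)[OF this] and d\<tau> = controlD(5)[OF this] and L = controlD(6)[OF this]
  define s where "s = (\<lambda>t. sqrt ((u0 t)\<^sup>2 + (u1 t)\<^sup>2 + (u2 t)\<^sup>2))"
  have s0: "0 \<le> s t" for t by (simp add: s_def)
  have us: "\<bar>u1 t\<bar> \<le> s t" "\<bar>u2 t\<bar> \<le> s t" for t by (auto simp: s_def real_le_rsqrt)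
  have A0: "A > 0" using A[of 0] height_pos[of 0] by simp
  have au: "\<bar>a t * u1 t\<bar> \<le> A * s t" "\<bar>a t * u2 t\<bar> \<le> A * s t" if "t \<in> {0..1}" for t
    using us[of t] A[OF that] height_pos[OF that] A0
    by (auto simp: abs_mult intro!: mult_mono)
  note bd = has_integral_sqrt_speed_bound[OF _ T _ _ L[folded s_def] s0]
  have q: "\<bar>q t - q 0\<bar> \<le> A * L" if "t \<in> {0..1}" for t
    by (rule bd[OF continuous(1) u2]) (use A0 au that in auto)
  have p: "\<bar>p t - p 0\<bar> \<le> A * L" if "t \<in> {0..1}" for t
    by (rule bd[OF continuous(2) u1]) (use A0 au that in auto)
  show "\<bar>q t - q 0\<bar> \<le> A * L" "\<bar>p t - p 0\<bar> \<le> A * L" using q p t by auto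
  define w where "w t = \<tau> t - \<tau> 0 - (p 0 * (q t - q 0) - q 0 * (p t - p 0)) / 2" for t
  have "\<bar>w t - w 0\<bar> \<le> (A * L * A) * L"
  proof (rule bd[where h' = "\<lambda>t. ((p t - p 0) * (a t * u2 t) - (q t - q 0) * (a t * u1 t)) / 2"])
    show "continuous_on {0..1} w"
      unfolding w_def by (intro continuous_intros continuous) auto
    show "(w has_real_derivative ((p t - p 0) * (a t * u2 t) - (q t - q 0) * (a t * u1 t)) / 2) (at t)"
      if "t \<in> {0..1} - T" for t
    proof -
      have "((\<lambda>t. (p 0 * (q t - q 0) - q 0 * (p t - p 0)) / 2) has_real_derivative
        (p 0 * (a t * u2 t) - q 0 * (a t * u1 t)) / 2) (at t)"
        using u1[OF that] u2[OF that] by (auto intro!: derivative_eq_intros)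
      moreover have "((\<lambda>t. \<tau> t - \<tau> 0) has_real_derivative
        (p t * (a t * u2 t) - q t * (a t * u1 t)) / 2) (at t)"
        using d\<tau>[OF that] by (auto intro!: derivative_eq_intros)
      ultimately have "(w has_real_derivative (p t * (a t * u2 t) - q t * (a t * u1 t)) / 2 -
        (p 0 * (a t * u2 t) - q 0 * (a t * u1 t)) / 2) (at t)"
        unfolding w_def by (rule DERIV_diff[rotated])
      moreover have "(p t * (a t * u2 t) - q t * (a t * u1 t)) / 2 -
        (p 0 * (a t * u2 t) - q 0 * (a t * u1 t)) / 2 =
        ((p t - p 0) * (a t * u2 t) - (q t - q 0) * (a t * u1 t)) / 2"
        by (simp add: field_simps)
      ultimately show ?thesis by simp
    qed
    show "\<bar>((p t - p 0) * (a t * u2 t) - (q t - q 0) * (a t * u1 t)) / 2\<bar> \<le> A * L * A * s t"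
      if "t \<in> {0..1} - T" for t
    proof -
      have "\<bar>(p t - p 0) * (a t * u2 t)\<bar> \<le> (A * L) * (A * s t)"
        "\<bar>(q t - q 0) * (a t * u1 t)\<bar> \<le> (A * L) * (A * s t)"
        using q[of t] p[of t] au[of t] that A0 length_nonneg
        unfolding abs_mult[of "_ - _"] by (auto intro!: mult_mono)
      then show ?thesis by (simp add: mult_ac abs_le_iff)
    qed
  qed (use t A0 length_nonneg in auto)
  then show "\<bar>\<tau> t - \<tau> 0 - (p 0 * (q t - q 0) - q 0 * (p t - p 0)) / 2\<bar> \<le> (A * L)\<^sup>2"
    by (simp add: w_def power2_eq_square mult_ac)
qed

end

section \<open>Explicit curves with given end points\<close>

text \<open>Linear motion in \<open>q\<close> and \<open>p\<close> is perturbed by multiples of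
  \<open>t * (1 - t)\<close> and \<open>t * (1 - t) * (1 - 2 * t)\<close>, which vanish at both ends
  but enclose area. The size \<open>s\<close> of the first perturbation is free: a missing vertical
  displacement \<open>z\<close> then costs \<open>\<bar>z\<bar> / s\<close>, and \<open>s\<close>
  can be matched to the height later.\<close>

lemma horizontal_path_exists:
  fixes q0 p0 t0 q1 p1 t1 s :: real
  assumes s: "s > 0"
  defines "x \<equiv> q1 - q0" and "y \<equiv> p1 - p0"
  defines "z \<equiv> t1 - t0 - (p0 * x - q0 * y) / 2"
  obtains q p \<tau> q' p' :: "real \<Rightarrow> real" where
    "q 0 = q0" "p 0 = p0" "\<tau> 0 = t0" "q 1 = q1" "p 1 = p1" "\<tau> 1 = t1"
    "\<And>t. (q has_real_derivative q' t) (at t)" "\<And>t. (p has_real_derivative p' t) (at t)"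
    "\<And>t. (\<tau> has_real_derivative (p t * q' t - q t * p' t) / 2) (at t)"
    "continuous_on UNIV q'" "continuous_on UNIV p'"
    "\<And>t. t \<in> {0..1} \<Longrightarrow> \<bar>q' t\<bar> \<le> \<bar>x\<bar> + s"
    "\<And>t. t \<in> {0..1} \<Longrightarrow> \<bar>p' t\<bar> \<le> 6 * \<bar>y\<bar> + 30 * \<bar>z\<bar> / s"
proof -
  define w where "w = 30 * z / s + 5 * y"
  have ws: "w * s = 30 * z + 5 * y * s" using s by (simp add: w_def field_simps)
  \<comment> \<open>\<open>w\<close> is chosen so that the area swept out by this polynomial curve is the missing displacement \<open>z\<close>.\<close>
  define q where "q = (\<lambda>t. q0 + x * t + s * (t - t^2))"
  define p where "p = (\<lambda>t. p0 + y * t + w * (t - 3 * t^2 + 2 * t^3))"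
  define q' where "q' = (\<lambda>t. x + s * (1 - 2 * t))"
  define p' where "p' = (\<lambda>t. y + w * (1 - 6 * t + 6 * t^2))"
  define \<tau> where "\<tau> = (\<lambda>t. t0 + (p0 * (q t - q0) - q0 * (p t - p0)) / 2 +
     (- s * y * t^3 / 3 + w * x * (t^3 - t^4) + w * s * (2 * t^3 / 3 - t^4 + 2 * t^5 / 5)) / 2)"
  have dq: "(q has_real_derivative q' t) (at t)" for t
    unfolding q_def q'_def by (auto intro!: derivative_eq_intros simp: algebra_simps)
  have dp: "(p has_real_derivative p' t) (at t)" for t
    unfolding p_def p'_def by (auto intro!: derivative_eq_intros simp: algebra_simps)
  have d\<tau>: "(\<tau> has_real_derivative (p t * q' t - q t * p' t) / 2) (at t)" for t
  proof -
    have "((\<lambda>t. (- s * y * t^3 / 3 + w * x * (t^3 - t^4) + w * s * (2 * t^3 / 3 - t^4 + 2 * t^5 / 5)) / 2)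
        has_real_derivative (- s * y * t^2 + w * x * (3 * t^2 - 4 * t^3)
          + w * s * (2 * t^2 - 4 * t^3 + 2 * t^4)) / 2) (at t)"
      by (auto intro!: derivative_eq_intros simp: field_simps)
    moreover have "((\<lambda>t. t0 + (p0 * (q t - q0) - q0 * (p t - p0)) / 2) has_real_derivative
        (p0 * q' t - q0 * p' t) / 2) (at t)"
      using dq[of t] dp[of t] by (auto intro!: derivative_eq_intros)
    ultimately have "(\<tau> has_real_derivative (p0 * q' t - q0 * p' t) / 2 +
        (- s * y * t^2 + w * x * (3 * t^2 - 4 * t^3) + w * s * (2 * t^2 - 4 * t^3 + 2 * t^4)) / 2) (at t)"
      unfolding \<tau>_def by (intro DERIV_add)
    moreover have "p0 * q' t - q0 * p' t +
        (- s * y * t^2 + w * x * (3 * t^2 - 4 * t^3) + w * s * (2 * t^2 - 4 * t^3 + 2 * t^4)) =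
        p t * q' t - q t * p' t"
      unfolding q_def p_def q'_def p'_def by algebra
    ultimately show ?thesis by (metis add_divide_distrib)
  qed
  have e: "\<tau> 1 = t1" using ws by (simp add: \<tau>_def q_def p_def z_def field_simps)
  have bq: "\<bar>q' t\<bar> \<le> \<bar>x\<bar> + s" if "t \<in> {0..1}" for t
  proof -
    have "\<bar>s * (1 - 2 * t)\<bar> \<le> s * 1"
      unfolding abs_mult using that s by (intro mult_mono) auto
    then show ?thesis unfolding q'_def by linarith
  qed
  have bp: "\<bar>p' t\<bar> \<le> 6 * \<bar>y\<bar> + 30 * \<bar>z\<bar> / s" if "t \<in> {0..1}" for t
  proof -
    have "0 \<le> t * (1 - t)" using that by simp
    moreover have "0 \<le> (2 * t - 1)^2" by simp
    ultimately have "\<bar>1 - 6 * t + 6 * t^2\<bar> \<le> 1"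
      by (simp add: abs_le_iff power2_eq_square algebra_simps)
    then have "\<bar>w * (1 - 6 * t + 6 * t^2)\<bar> \<le> \<bar>w\<bar> * 1"
      unfolding abs_mult by (intro mult_mono) auto
    moreover have "\<bar>w\<bar> \<le> 30 * \<bar>z\<bar> / s + 5 * \<bar>y\<bar>"
      using abs_triangle_ineq[of "30 * z / s" "5 * y"] s by (simp add: w_def abs_mult)
    ultimately show ?thesis unfolding p'_def by linarith
  qed
  show ?thesis
    by (rule that[of q p \<tau> q' p', OF _ _ _ _ _ e dq dp d\<tau> _ _ bq bp])
      (auto simp: q_def p_def \<tau>_def x_def y_def q'_def p'_def intro!: continuous_intros)
qed

text \<open>The height moves exponentially between its end values, so it never falls below
  \<open>m\<close> and contributes the constant speed \<open>\<bar>ln (a1 / a0)\<bar>\<close>. A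
  curve is produced, and not merely a bound for the distance, because the infimum over lengths
  yields curves only once their set is known to be nonempty.\<close>

lemma eheis_dist_curve:
  assumes "a0 > 0" "a1 > 0" "s > 0"
    and m: "m \<le> a0" "m \<le> a1" "m > 0"
  shows "\<exists>\<gamma> L. \<gamma> 0 = ((q0, p0, t0), a0) \<and> \<gamma> 1 = ((q1, p1, t1), a1) \<and>
     horizontal_curve_length eheis_carrier eheis_frame \<gamma> L \<and>
     L \<le> \<bar>ln (a1 / a0)\<bar> + (\<bar>q1 - q0\<bar> + s) / m +
       (6 * \<bar>p1 - p0\<bar> + 30 * \<bar>t1 - t0 - (p0 * (q1 - q0) - q0 * (p1 - p0)) / 2\<bar> / s) / m"
proof -
  obtain q p \<tau> q' p' :: "real \<Rightarrow> real" where
    e: "q 0 = q0" "p 0 = p0" "\<tau> 0 = t0" "q 1 = q1" "p 1 = p1" "\<tau> 1 = t1"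
    and d: "\<And>t. (q has_real_derivative q' t) (at t)" "\<And>t. (p has_real_derivative p' t) (at t)"
    "\<And>t. (\<tau> has_real_derivative (p t * q' t - q t * p' t) / 2) (at t)"
    and c: "continuous_on UNIV q'" "continuous_on UNIV p'"
    and b: "\<And>t. t \<in> {0..1} \<Longrightarrow> \<bar>q' t\<bar> \<le> \<bar>q1 - q0\<bar> + s"
    "\<And>t. t \<in> {0..1} \<Longrightarrow> \<bar>p' t\<bar> \<le>
       6 * \<bar>p1 - p0\<bar> + 30 * \<bar>t1 - t0 - (p0 * (q1 - q0) - q0 * (p1 - p0)) / 2\<bar> / s"
    using horizontal_path_exists[OF \<open>s > 0\<close>, of q0 p0 t0 q1 p1 t1] by metis
  define \<kappa> where "\<kappa> = ln (a1 / a0)"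
  define a where "a = (\<lambda>t. a0 * exp (\<kappa> * t))"
  have a: "a t > 0" for t using assms by (simp add: a_def)
  have a1: "a 1 = a1" using assms by (simp add: a_def \<kappa>_def)
  have am: "m \<le> a t" if t: "t \<in> {0..1}" for t
  proof (cases "\<kappa> \<ge> 0")
    case True
    then have "1 \<le> exp (\<kappa> * t)" using t by simp
    then have "a0 * 1 \<le> a t" unfolding a_def using assms by (intro mult_left_mono) auto
    then show ?thesis using m by simp
  next
    case False
    then have "\<kappa> * 1 \<le> \<kappa> * t" using t by (intro mult_left_mono_neg) auto
    then have "a 1 \<le> a t" unfolding a_def using assms by (intro mult_left_mono) auto
    then show ?thesis using m a1 by simp
  qed
  define \<gamma> where "\<gamma> = (\<lambda>t. ((q t, p t, \<tau> t), a t))"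
  define u where "u = (\<lambda>i t. if i = (0::nat) then \<kappa> else if i = 1 then p' t / a t else q' t / a t)"
  have cts: "continuous_on UNIV q" "continuous_on UNIV p" "continuous_on UNIV \<tau>"
    using d DERIV_isCont by (blast intro: continuous_at_imp_continuous_on)+
  have ca: "continuous_on UNIV a" unfolding a_def by (intro continuous_intros)
  have d\<gamma>: "(\<gamma> has_vector_derivative ((q' t, p' t, (p t * q' t - q t * p' t) / 2), a t * \<kappa>)) (at t)" for t
    unfolding has_vector_derivative_eheis_iff \<gamma>_def using d[of t]
    by (auto simp: a_def intro!: derivative_eq_intros)
  have "\<gamma> C1_differentiable_on {0..1}"
    unfolding C1_differentiable_on_def
    by (rule exI[of _ "\<lambda>t. ((q' t, p' t, (p t * q' t - q t * p' t) / 2), a t * \<kappa>)"])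
      (auto intro!: d\<gamma> continuous_intros continuous_on_subset[OF cts(1)]
        continuous_on_subset[OF cts(2)] continuous_on_subset[OF c(1)] continuous_on_subset[OF c(2)]
        continuous_on_subset[OF ca])
  then have C1: "\<gamma> piecewise_C1_differentiable_on {0..1}" by (rule C1_differentiable_imp_piecewise)
  define S where "S = (\<lambda>t. sqrt (\<Sum>i<length eheis_frame. (u i t)\<^sup>2))"
  have Seq: "S t = sqrt (\<kappa>\<^sup>2 + (p' t / a t)\<^sup>2 + (q' t / a t)\<^sup>2)" for t
    by (simp add: S_def u_def lessThan_Suc add_ac)
  have an: "a t \<noteq> 0" for t using a[of t] by simp
  have "continuous_on {0..1} S"
    unfolding Seq
    by (intro continuous_intros continuous_on_subset[OF c(1)] continuous_on_subset[OF c(2)]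
        continuous_on_subset[OF ca]) (use an in auto)
  then have int: "S integrable_on {0..1}" by (rule integrable_continuous_interval)
  let ?B = "\<bar>\<kappa>\<bar> + (\<bar>q1 - q0\<bar> + s) / m +
       (6 * \<bar>p1 - p0\<bar> + 30 * \<bar>t1 - t0 - (p0 * (q1 - q0) - q0 * (p1 - p0)) / 2\<bar> / s) / m"
  have SB: "S t \<le> ?B" if t: "t \<in> {0..1}" for t
  proof -
    have "S t \<le> sqrt (\<kappa>\<^sup>2) + sqrt ((p' t / a t)\<^sup>2) + sqrt ((q' t / a t)\<^sup>2)"
      unfolding Seq by (intro order_trans[OF sqrt_add_le_add_sqrt] add_right_mono sqrt_add_le_add_sqrt) auto
    also have "\<dots> = \<bar>\<kappa>\<bar> + \<bar>q' t\<bar> / a t + \<bar>p' t\<bar> / a t"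
      using a[of t] by simp
    also have "\<dots> \<le> ?B"
      using b[OF t] am[OF t] m \<open>s > 0\<close> by (intro add_mono frac_le) auto
    finally show ?thesis .
  qed
  have "integral {0..1} S \<le> integral {0..1} (\<lambda>t::real. ?B)"
    using int SB by (intro integral_le) auto
  then have "integral {0..1} S \<le> ?B" by simp
  moreover have "horizontal_curve_length eheis_carrier eheis_frame \<gamma> (integral {0..1} S)"
    unfolding horizontal_curve_length_def
  proof (intro conjI exI ballI)
    show "\<gamma> ` {0..1} \<subseteq> eheis_carrier" using a by (auto simp: \<gamma>_def eheis_carrier_def)
    show "((\<lambda>t. sqrt (\<Sum>i<length eheis_frame. (u i t)\<^sup>2)) has_integral integral {0..1} S) {0..1}"
      using int unfolding S_def by (rule integrable_integral)
    show "(\<gamma> has_vector_derivative (\<Sum>i<length eheis_frame. u i t *\<^sub>R (eheis_frame ! i) (\<gamma> t))) (at t)"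
      for t
      using d\<gamma>[of t] an[of t] unfolding \<gamma>_def sum_eheis_frame by (simp add: u_def)
  qed (use C1 in \<open>auto intro!: finite.emptyI\<close>)
  moreover have "\<gamma> 0 = ((q0, p0, t0), a0)" "\<gamma> 1 = ((q1, p1, t1), a1)"
    using e a1 by (auto simp: \<gamma>_def a_def)
  ultimately show ?thesis unfolding \<kappa>_def by blast
qed

lemma horizontal_curve_lengthI:
  assumes "\<gamma> piecewise_C1_differentiable_on {0..1}" "\<gamma> ` {0..1} \<subseteq> S"
    and "\<And>t. (\<gamma> has_vector_derivative (\<Sum>i<length Xs. u i t *\<^sub>R (Xs ! i) (\<gamma> t))) (at t)"
    and "((\<lambda>t. sqrt (\<Sum>i<length Xs. (u i t)\<^sup>2)) has_integral L) {0..1}"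
  shows "horizontal_curve_length S Xs \<gamma> L"
  unfolding horizontal_curve_length_def
  by (intro conjI exI[of _ u] exI[of _ "{}"] ballI finite.emptyI assms)

text \<open>Supplies the nonemptiness that turns \<open>heis_dist x y < R\<close> into a curve
  shorter than \<open>R\<close>.\<close>

lemma heis_dist_curve:
  "\<exists>\<gamma> L. \<gamma> 0 = (q0, p0, t0) \<and> \<gamma> 1 = (q1, p1, t1) \<and> horizontal_curve_length UNIV heis_frame \<gamma> L"
proof -
  obtain q p \<tau> q' p' :: "real \<Rightarrow> real" where
    e: "q 0 = q0" "p 0 = p0" "\<tau> 0 = t0" "q 1 = q1" "p 1 = p1" "\<tau> 1 = t1"
    and d: "\<And>t. (q has_real_derivative q' t) (at t)" "\<And>t. (p has_real_derivative p' t) (at t)"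
    "\<And>t. (\<tau> has_real_derivative (p t * q' t - q t * p' t) / 2) (at t)"
    and c: "continuous_on UNIV q'" "continuous_on UNIV p'"
    using horizontal_path_exists[of 1 q0 p0 t0 q1 p1 t1] by (metis zero_less_one)
  define \<gamma> where "\<gamma> = (\<lambda>t. (q t, p t, \<tau> t))"
  define u where "u = (\<lambda>i. if i = (0::nat) then p' else q')"
  have cts: "continuous_on UNIV q" "continuous_on UNIV p"
    using d DERIV_isCont by (blast intro: continuous_at_imp_continuous_on)+
  have d\<gamma>: "(\<gamma> has_vector_derivative (q' t, p' t, (p t * q' t - q t * p' t) / 2)) (at t)" for t
    unfolding has_vector_derivative_heis_iff has_vector_derivative_eheis_iff \<gamma>_def using d[of t]
    by auto
  have "\<gamma> C1_differentiable_on {0..1}"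
    unfolding C1_differentiable_on_def
    by (rule exI[of _ "\<lambda>t. (q' t, p' t, (p t * q' t - q t * p' t) / 2)"])
      (auto intro!: d\<gamma> continuous_intros continuous_on_subset[OF cts(1)]
        continuous_on_subset[OF cts(2)] continuous_on_subset[OF c(1)] continuous_on_subset[OF c(2)])
  then have C1: "\<gamma> piecewise_C1_differentiable_on {0..1}" by (rule C1_differentiable_imp_piecewise)
  have "(\<lambda>t. sqrt (\<Sum>i<length heis_frame. (u i t)\<^sup>2)) integrable_on {0..1}"
    by (rule integrable_continuous_interval)
      (auto simp: u_def lessThan_Suc intro!: continuous_intros continuous_on_subset[OF c(1)]
         continuous_on_subset[OF c(2)])
  then have int: "((\<lambda>t. sqrt (\<Sum>i<length heis_frame. (u i t)\<^sup>2)) has_integral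
      integral {0..1} (\<lambda>t. sqrt (\<Sum>i<length heis_frame. (u i t)\<^sup>2))) {0..1}"
    by (rule integrable_integral)
  have "(\<gamma> has_vector_derivative (\<Sum>i<length heis_frame. u i t *\<^sub>R (heis_frame ! i) (\<gamma> t))) (at t)"
    for t
    using d\<gamma>[of t] unfolding \<gamma>_def sum_heis_frame by (simp add: u_def)
  then have "horizontal_curve_length UNIV heis_frame \<gamma>
      (integral {0..1} (\<lambda>t. sqrt (\<Sum>i<length heis_frame. (u i t)\<^sup>2)))"
    using int by (intro horizontal_curve_lengthI[OF C1]) auto
  moreover have "\<gamma> 0 = (q0, p0, t0)" "\<gamma> 1 = (q1, p1, t1)" using e by (auto simp: \<gamma>_def)
  ultimately show ?thesis by blast
qed

section \<open>Distances in coordinates\<close>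

lemma eheis_dist_less_curve:
  assumes "snd x > 0" "snd y > 0" "eheis_dist x y < R"
  obtains \<gamma> L where "\<gamma> 0 = x" "\<gamma> 1 = y" "horizontal_curve_length eheis_carrier eheis_frame \<gamma> L" "L < R"
proof -
  obtain q0 p0 t0 a0 q1 p1 t1 a1 where xy: "x = ((q0, p0, t0), a0)" "y = ((q1, p1, t1), a1)"
    by (metis prod.collapse)
  let ?S = "{L. \<exists>\<gamma>. \<gamma> 0 = x \<and> \<gamma> 1 = y \<and> horizontal_curve_length eheis_carrier eheis_frame \<gamma> L}"
  have "?S \<noteq> {}"
    using eheis_dist_curve[of a0 a1 1 "min a0 a1" q0 p0 t0 q1 p1 t1] assms xy by auto
  moreover have "Inf ?S < R" using assms(3) unfolding eheis_dist_def cc_dist_def .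
  ultimately show ?thesis using cInf_lessD[of ?S R] that by blast
qed

lemma eheis_dist_le_length:
  assumes "\<gamma> 0 = x" "\<gamma> 1 = y" "horizontal_curve_length eheis_carrier eheis_frame \<gamma> L"
  shows "eheis_dist x y \<le> L"
  unfolding eheis_dist_def cc_dist_def
proof (rule cInf_lower)
  show "bdd_below {L. \<exists>\<gamma>. \<gamma> 0 = x \<and> \<gamma> 1 = y \<and> horizontal_curve_length eheis_carrier eheis_frame \<gamma> L}"
    by (rule bdd_belowI[of _ 0]) (use eheis_curve.length_nonneg eheis_curve.intro in blast)
qed (use assms in blast)

text \<open>
  The displacement is bounded in terms of the height of the second point, because the heights along
  a curve of length \<open>R\<close> are comparable up to the factor \<open>exp R\<close>.
\<close>

lemma eheis_dist_less_imp:
  assumes a: "a0 > 0" "a1 > 0" and d: "eheis_dist ((q0, p0, t0), a0) ((q1, p1, t1), a1) < R"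
  defines "M \<equiv> a1 * exp (2 * R) * R"
  shows "\<bar>q1 - q0\<bar> \<le> M" "\<bar>p1 - p0\<bar> \<le> M"
    "\<bar>t1 - t0 - (p0 * (q1 - q0) - q0 * (p1 - p0)) / 2\<bar> \<le> M\<^sup>2"
proof -
  obtain \<gamma> L where ends: "\<gamma> 0 = ((q0, p0, t0), a0)" "\<gamma> 1 = ((q1, p1, t1), a1)"
    and h: "horizontal_curve_length eheis_carrier eheis_frame \<gamma> L" and L: "L < R"
    using eheis_dist_less_curve[OF _ _ d] a by auto
  interpret eheis_curve \<gamma> L using h by unfold_locales
  have e: "q 0 = q0" "p 0 = p0" "\<tau> 0 = t0" "a 0 = a0" "q 1 = q1" "p 1 = p1" "\<tau> 1 = t1" "a 1 = a1"
    using ends by (auto simp: q_def p_def \<tau>_def a_def)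
  have A: "a t \<le> a1 * exp (2 * L)" if t: "t \<in> {0..1}" for t
  proof -
    have "ln (a t) \<le> ln a1 + 2 * L" using height_bound[OF t] height_bound[of 1] e by simp
    then have "exp (ln (a t)) \<le> exp (ln a1 + 2 * L)" by simp
    then show ?thesis using height_pos[OF t] a by (simp add: exp_add)
  qed
  have "a1 * exp (2 * L) * L \<le> a1 * exp (2 * R) * R"
    using a L length_nonneg by (intro mult_mono) auto
  then have M: "a1 * exp (2 * L) * L \<le> M" by (simp add: M_def)
  have M0: "0 \<le> a1 * exp (2 * L) * L" using a length_nonneg by simp
  show "\<bar>q1 - q0\<bar> \<le> M" "\<bar>p1 - p0\<bar> \<le> M" using displacement(1,2)[OF A, of 1] e M by auto
  have "(a1 * exp (2 * L) * L)\<^sup>2 \<le> M\<^sup>2" using M M0 by (rule power_mono)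
  then show "\<bar>t1 - t0 - (p0 * (q1 - q0) - q0 * (p1 - p0)) / 2\<bar> \<le> M\<^sup>2"
    using displacement(3)[OF A, of 1] e by simp
qed

lemma heis_dist_less_imp:
  assumes d: "heis_dist (q0, p0, t0) (q1, p1, t1) < R"
  shows "\<bar>q1 - q0\<bar> \<le> R" "\<bar>p1 - p0\<bar> \<le> R"
    "\<bar>t1 - t0 - (p0 * (q1 - q0) - q0 * (p1 - p0)) / 2\<bar> \<le> R\<^sup>2"
proof -
  let ?S = "{L. \<exists>\<gamma>. \<gamma> 0 = (q0, p0, t0) \<and> \<gamma> 1 = (q1, p1, t1) \<and> horizontal_curve_length UNIV heis_frame \<gamma> L}"
  have "?S \<noteq> {}"
    using heis_dist_curve[of q0 p0 t0 q1 p1 t1] by auto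
  moreover have "Inf ?S < R" using d unfolding heis_dist_def cc_dist_def .
  ultimately obtain \<gamma> L where ends: "\<gamma> 0 = (q0, p0, t0)" "\<gamma> 1 = (q1, p1, t1)"
    and h: "horizontal_curve_length UNIV heis_frame \<gamma> L" and L: "L < R"
    using cInf_lessD[of ?S R] by blast
  interpret eheis_curve "\<lambda>t. (\<gamma> t, 1)" L
    using horizontal_curve_length_lift[OF h] by unfold_locales
  have e: "q 0 = q0" "p 0 = p0" "\<tau> 0 = t0" "q 1 = q1" "p 1 = p1" "\<tau> 1 = t1" "a t = 1" for t
    using ends by (auto simp: q_def p_def \<tau>_def a_def)
  show "\<bar>q1 - q0\<bar> \<le> R" "\<bar>p1 - p0\<bar> \<le> R" using displacement(1,2)[of 1 1] e L by auto
  have "\<bar>t1 - t0 - (p0 * (q1 - q0) - q0 * (p1 - p0)) / 2\<bar> \<le> L\<^sup>2"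
    using displacement(3)[of 1 1] e by simp
  also have "L\<^sup>2 \<le> R\<^sup>2" using L length_nonneg by (intro power_mono) auto
  finally show "\<bar>t1 - t0 - (p0 * (q1 - q0) - q0 * (p1 - p0)) / 2\<bar> \<le> R\<^sup>2" .
qed

text \<open>Right multiplication by \<open>(s * x, 0, 0)\<close> follows the second field of the
  frame with constant control \<open>x\<close>. This locates a second point, displaced in the
  direction of \<open>q\<close>, in the inner ball of a cube.\<close>

lemma heis_dist_horizontal_line:
  "heis_dist (q, p, t) (heis_mult (q, p, t) (x, 0, 0)) \<le> \<bar>x\<bar>"
  unfolding heis_dist_def cc_dist_def
proof (rule cInf_lower)
  let ?\<gamma> = "\<lambda>s::real. (q + s * x, p, t + s * (p * x) / 2)"
  let ?u = "\<lambda>i s::real. if i = (1::nat) then x else 0"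
  have d: "(?\<gamma> has_vector_derivative (x, 0, p * x / 2)) (at s)" for s
    unfolding has_vector_derivative_heis_iff has_vector_derivative_eheis_iff
    by (auto intro!: derivative_eq_intros)
  have "?\<gamma> C1_differentiable_on {0..1}"
    unfolding C1_differentiable_on_def using d by (intro exI[of _ "\<lambda>_. (x, 0, p * x / 2)"]) auto
  then have C1: "?\<gamma> piecewise_C1_differentiable_on {0..1}" by (rule C1_differentiable_imp_piecewise)
  have "((\<lambda>s. sqrt (\<Sum>i<length heis_frame. (?u i s)\<^sup>2)) has_integral \<bar>x\<bar>) {0..1}"
    unfolding sum_length_heis_frame using has_integral_const_real[of "\<bar>x\<bar>" 0 1] by simp
  moreover have "(?\<gamma> has_vector_derivative (\<Sum>i<length heis_frame. ?u i s *\<^sub>R (heis_frame ! i) (?\<gamma> s))) (at s)"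
    for s
    unfolding sum_heis_frame using d[of s] by simp
  ultimately have "horizontal_curve_length UNIV heis_frame ?\<gamma> \<bar>x\<bar>"
    by (intro horizontal_curve_lengthI[OF C1, where u = ?u]) auto
  then show "\<bar>x\<bar> \<in> {L. \<exists>\<gamma>. \<gamma> 0 = (q, p, t) \<and> \<gamma> 1 = heis_mult (q, p, t) (x, 0, 0) \<and>
      horizontal_curve_length UNIV heis_frame \<gamma> L}"
    by (intro CollectI exI[of _ ?\<gamma>]) simp
  show "bdd_below {L. \<exists>\<gamma>. \<gamma> 0 = (q, p, t) \<and> \<gamma> 1 = heis_mult (q, p, t) (x, 0, 0) \<and>
      horizontal_curve_length UNIV heis_frame \<gamma> L}"
    by (rule bdd_belowI[of _ 0])
      (use eheis_curve.length_nonneg eheis_curve.intro horizontal_curve_length_lift in blast)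
qed

text \<open>
  The distance is taken from the varying point, as in the definition of the enlargement of a set.
\<close>

lemma eheis_dist_box:
  assumes h: "h > 0" and b: "1 \<le> b" and XYZ: "\<bar>X\<bar> \<le> 1/2" "\<bar>Y\<bar> \<le> 1/2" "\<bar>Z\<bar> \<le> 1/2"
  shows "eheis_dist (eheis_mult ((q, p, t), h) ((X, Y, Z), b)) ((q, p, t), h) \<le> ln b + 20"
proof -
  let ?q = "q + h * X" and ?p = "p + h * Y"
  let ?t = "t + h\<^sup>2 * Z - (q * (h * Y) - p * (h * X)) / 2"
  \<comment> \<open>Both the free parameter \<open>s\<close> and the lower height \<open>m\<close>
    are set to \<open>h\<close>, so all powers of \<open>h\<close> cancel; the constant terms add up
    to at most 1/2 + 1 + 3 + 15, below 20.\<close>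
  obtain \<gamma> L where \<gamma>: "\<gamma> 0 = ((?q, ?p, ?t), h * b)" "\<gamma> 1 = ((q, p, t), h)"
    "horizontal_curve_length eheis_carrier eheis_frame \<gamma> L"
    and L: "L \<le> \<bar>ln (h / (h * b))\<bar> + (\<bar>q - ?q\<bar> + h) / h +
       (6 * \<bar>p - ?p\<bar> + 30 * \<bar>t - ?t - (?p * (q - ?q) - ?q * (p - ?p)) / 2\<bar> / h) / h"
    using eheis_dist_curve[of "h * b" h h h ?q ?p ?t q p t] h b by (auto simp: mult_le_cancel_left1)
  have "t - ?t - (?p * (q - ?q) - ?q * (p - ?p)) / 2 = - (h\<^sup>2 * Z)"
    by (simp add: field_simps power2_eq_square)
  note z = this
  have "\<bar>ln (h / (h * b))\<bar> = ln b" using h b by (simp add: ln_div)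
  moreover have "(\<bar>q - ?q\<bar> + h) / h = \<bar>X\<bar> + 1"
    using h by (simp add: abs_mult add_divide_distrib)
  moreover have "(6 * \<bar>p - ?p\<bar> + 30 * \<bar>- (h\<^sup>2 * Z)\<bar> / h) / h = 6 * \<bar>Y\<bar> + 30 * \<bar>Z\<bar>"
    using h by (simp add: abs_mult add_divide_distrib power2_eq_square)
  ultimately have "L \<le> ln b + (\<bar>X\<bar> + 1) + (6 * \<bar>Y\<bar> + 30 * \<bar>Z\<bar>)"
    using L unfolding z by linarith
  with XYZ have "L \<le> ln b + 20" by linarith
  moreover have "eheis_dist ((?q, ?p, ?t), h * b) ((q, p, t), h) \<le> L"
    by (rule eheis_dist_le_length[OF \<gamma>])
  ultimately show ?thesis by simp
qed

section \<open>The measure of sheared boxes\<close>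

lemma emeasure_lborel_const_slices:
  fixes S :: "('a::euclidean_space \<times> 'b::euclidean_space) set"
  assumes S: "S \<in> sets borel" and A: "A \<in> sets borel"
    and sl: "\<And>x. x \<in> A \<Longrightarrow> emeasure lborel (Pair x -` S) = c" "\<And>x. x \<notin> A \<Longrightarrow> Pair x -` S = {}"
  shows "emeasure lborel S = c * emeasure lborel A"
proof -
  have "emeasure lborel S = emeasure (lborel \<Otimes>\<^sub>M lborel) S" by (simp add: lborel_prod)
  also have "\<dots> = (\<integral>\<^sup>+x. emeasure lborel (Pair x -` S) \<partial>lborel)"
    by (rule lborel.emeasure_pair_measure_alt) (use S in \<open>simp only: lborel_prod sets_lborel\<close>)
  also have "\<dots> = (\<integral>\<^sup>+x. c * indicator A x \<partial>lborel)"
    by (rule nn_integral_cong) (use sl in \<open>auto simp: indicator_def\<close>)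
  also have "\<dots> = c * emeasure lborel A" using A by (simp add: nn_integral_cmult_indicator)
  finally show ?thesis .
qed

text \<open>The centre in \<open>p\<close> may depend on \<open>q\<close> and \<open>a\<close>, and
  that in \<open>t\<close> on \<open>q\<close>, \<open>p\<close> and \<open>a\<close>. This covers
  both the boxes adapted to the flow of \<open>Z\<close> and left translates of boxes, with one
  volume formula.\<close>

definition sheared_box ::
  "real \<Rightarrow> real \<Rightarrow> (real \<Rightarrow> real \<Rightarrow> real) \<Rightarrow> real \<Rightarrow> (real \<Rightarrow> real \<Rightarrow> real \<Rightarrow> real) \<Rightarrow> real \<Rightarrow>
    real \<Rightarrow> real \<Rightarrow> eheis set" where
  "sheared_box q0 \<alpha> P \<beta> T \<kappa> a1 a2 = {((q, p, t), a) | q p t a.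
     \<bar>q - q0\<bar> \<le> \<alpha> \<and> \<bar>p - P q a\<bar> \<le> \<beta> \<and> \<bar>t - T q p a\<bar> \<le> \<kappa> \<and> a1 \<le> a \<and> a \<le> a2}"

text \<open>Shears do not change volume: every slice at fixed height has volume
  \<open>8 * \<alpha> * \<beta> * \<kappa>\<close>, and integrating \<open>1 / a\<close> over the
  heights gives the logarithm.\<close>

lemma rho_sheared_box:
  fixes P :: "real \<Rightarrow> real \<Rightarrow> real" and T :: "real \<Rightarrow> real \<Rightarrow> real \<Rightarrow> real"
  assumes P: "continuous_on UNIV (\<lambda>x. P (fst x) (snd x))"
    and T: "continuous_on UNIV (\<lambda>x. T (fst x) (fst (snd x)) (snd (snd x)))"
    and pos: "0 \<le> \<alpha>" "0 \<le> \<beta>" "0 \<le> \<kappa>" and a: "0 < a1" "a1 \<le> a2"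
  shows "sheared_box q0 \<alpha> P \<beta> T \<kappa> a1 a2 \<in> sets rho" (is "?S \<in> _")
    and "emeasure rho (sheared_box q0 \<alpha> P \<beta> T \<kappa> a1 a2) = ennreal (8 * \<alpha> * \<beta> * \<kappa> * ln (a2 / a1))"
proof -
  have cP: "continuous_on UNIV (\<lambda>x. P (f x) (g x))"
    if "continuous_on UNIV f" "continuous_on UNIV g" for f g :: "'a::topological_space \<Rightarrow> real"
    using continuous_on_compose2[OF P continuous_on_Pair[OF that]] by simp
  have cT: "continuous_on UNIV (\<lambda>x. T (f x) (g x) (h x))"
    if "continuous_on UNIV f" "continuous_on UNIV g" "continuous_on UNIV h"
    for f g h :: "'a::topological_space \<Rightarrow> real"
    using continuous_on_compose2[OF T continuous_on_Pair[OF that(1) continuous_on_Pair[OF that(2,3)]]]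
    by simp
  have S_eq: "?S = {x. \<bar>fst (fst x) - q0\<bar> \<le> \<alpha> \<and> \<bar>fst (snd (fst x)) - P (fst (fst x)) (snd x)\<bar> \<le> \<beta> \<and>
      \<bar>snd (snd (fst x)) - T (fst (fst x)) (fst (snd (fst x))) (snd x)\<bar> \<le> \<kappa> \<and> a1 \<le> snd x \<and> snd x \<le> a2}"
    unfolding sheared_box_def by force
  have "closed ?S"
    unfolding S_eq by (intro closed_Collect_conj closed_Collect_le continuous_intros cP cT)
  then have S: "?S \<in> sets borel" by simp
  have carr: "eheis_carrier \<in> sets borel"
  proof -
    have "open {g::eheis. 0 < snd g}" by (intro open_Collect_less continuous_intros)
    then show ?thesis unfolding eheis_carrier_def by simp
  qed
  have sub: "?S \<subseteq> eheis_carrier" using a by (auto simp: sheared_box_def eheis_carrier_def)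
  have Sr: "?S \<in> sets (restrict_space lborel eheis_carrier)"
    using S sub carr by (auto simp: sets_restrict_space_iff)
  then show "?S \<in> sets rho" by (simp add: rho_def)
  have m: "(\<lambda>x::eheis. ennreal (1 / snd x)) \<in> borel_measurable borel"
  proof -
    have [measurable]: "(snd :: eheis \<Rightarrow> real) \<in> borel_measurable borel"
      by (intro borel_measurable_continuous_onI continuous_intros)
    show ?thesis by measurable
  qed
  have slice: "emeasure lborel {n. (n, a) \<in> ?S} = ennreal (8 * \<alpha> * \<beta> * \<kappa>) * indicator {a1..a2} a" for a
  proof (cases "a \<in> {a1..a2}")
    case True
    let ?N = "{x. \<bar>fst x - q0\<bar> \<le> \<alpha> \<and> \<bar>fst (snd x) - P (fst x) a\<bar> \<le> \<beta> \<and>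
      \<bar>snd (snd x) - T (fst x) (fst (snd x)) a\<bar> \<le> \<kappa>}"
    have N: "{n. (n, a) \<in> ?S} = ?N" using True by (auto simp: sheared_box_def)
    have 1: "emeasure lborel {y. \<bar>fst y - P q a\<bar> \<le> \<beta> \<and> \<bar>snd y - T q (fst y) a\<bar> \<le> \<kappa>}
       = ennreal (2 * \<kappa>) * ennreal (2 * \<beta>)" (is "emeasure lborel ?Y = _") for q
    proof -
      have "closed ?Y" by (intro closed_Collect_conj closed_Collect_le continuous_intros cT)
      then have "emeasure lborel ?Y = ennreal (2 * \<kappa>) * emeasure lborel {P q a - \<beta>..P q a + \<beta>}"
      proof (intro emeasure_lborel_const_slices)
        fix p assume "p \<in> {P q a - \<beta>..P q a + \<beta>}"
        then have "Pair p -` ?Y = {T q p a - \<kappa>..T q p a + \<kappa>}" by (auto simp: abs_le_iff)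
        then show "emeasure lborel (Pair p -` ?Y) = ennreal (2 * \<kappa>)" using pos by simp
      qed (auto simp: abs_le_iff)
      then show ?thesis using pos by simp
    qed
    have "closed ?N" by (intro closed_Collect_conj closed_Collect_le continuous_intros cP cT)
    then have "emeasure lborel ?N = (ennreal (2 * \<kappa>) * ennreal (2 * \<beta>)) * emeasure lborel {q0 - \<alpha>..q0 + \<alpha>}"
    proof (intro emeasure_lborel_const_slices)
      fix q assume "q \<in> {q0 - \<alpha>..q0 + \<alpha>}"
      then have "Pair q -` ?N = {y. \<bar>fst y - P q a\<bar> \<le> \<beta> \<and> \<bar>snd y - T q (fst y) a\<bar> \<le> \<kappa>}"
        by (auto simp: abs_le_iff)
      then show "emeasure lborel (Pair q -` ?N) = ennreal (2 * \<kappa>) * ennreal (2 * \<beta>)" using 1 by simp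
    qed (auto simp: abs_le_iff)
    also have "\<dots> = ennreal (8 * \<alpha> * \<beta> * \<kappa>)"
      using pos by (simp add: ennreal_mult'[symmetric] mult_ac)
    finally show ?thesis using True N by simp
  next
    case False
    then have e: "{n. (n, a) \<in> ?S} = {}" by (auto simp: sheared_box_def)
    show ?thesis unfolding e using False by simp
  qed
  have "emeasure rho ?S = (\<integral>\<^sup>+x. ennreal (1 / snd x) * indicator ?S x \<partial>restrict_space lborel eheis_carrier)"
    unfolding rho_def using Sr m
    by (subst emeasure_density) (auto simp: case_prod_beta' intro!: measurable_restrict_space1)
  also have "\<dots> = (\<integral>\<^sup>+x. ennreal (1 / snd x) * indicator ?S x * indicator eheis_carrier x \<partial>lborel)"
    by (rule nn_integral_restrict_space) (use carr in simp)
  also have "\<dots> = (\<integral>\<^sup>+x. ennreal (1 / snd x) * indicator ?S x \<partial>(lborel \<Otimes>\<^sub>M lborel))"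
    unfolding lborel_prod using sub by (intro nn_integral_cong) (auto simp: indicator_def)
  also have "\<dots> = (\<integral>\<^sup>+a. (\<integral>\<^sup>+n. ennreal (1 / a) * indicator ?S (n, a) \<partial>lborel) \<partial>lborel)"
    by (subst lborel_pair.nn_integral_snd[symmetric])
      (use S m in \<open>simp_all add: lborel_prod measurable_lborel1 borel_measurable_times_ennreal\<close>)
  also have "\<dots> = (\<integral>\<^sup>+a. ennreal (8 * \<alpha> * \<beta> * \<kappa>) * (ennreal (1 / a) * indicator {a1..a2} a) \<partial>lborel)"
  proof (rule nn_integral_cong)
    fix a
    have "(\<lambda>n. (n, a)) -` ?S \<in> sets borel"
      using measurable_sets[OF _ S, of "\<lambda>n. (n, a)" borel] by simp
    then have mS: "{n. (n, a) \<in> ?S} \<in> sets borel" by (simp add: vimage_def)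
    have "(\<integral>\<^sup>+n. ennreal (1 / a) * indicator ?S (n, a) \<partial>lborel) =
        (\<integral>\<^sup>+n. ennreal (1 / a) * indicator {n. (n, a) \<in> ?S} n \<partial>lborel)"
      by (rule nn_integral_cong) (simp add: indicator_def)
    also have "\<dots> = ennreal (1 / a) * emeasure lborel {n. (n, a) \<in> ?S}"
      using mS by (simp add: nn_integral_cmult_indicator)
    finally show "(\<integral>\<^sup>+n. ennreal (1 / a) * indicator ?S (n, a) \<partial>lborel) =
        ennreal (8 * \<alpha> * \<beta> * \<kappa>) * (ennreal (1 / a) * indicator {a1..a2} a)"
      unfolding slice by (simp add: mult_ac)
  qed
  also have "\<dots> = ennreal (8 * \<alpha> * \<beta> * \<kappa>) * (\<integral>\<^sup>+a. ennreal (1 / a) * indicator {a1..a2} a \<partial>lborel)"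
    by (rule nn_integral_cmult) measurable
  also have "(\<integral>\<^sup>+a. ennreal (1 / a) * indicator {a1..a2} a \<partial>lborel) = ennreal (ln a2 - ln a1)"
    by (rule nn_integral_FTC_Icc)
      (use a in \<open>auto intro!: derivative_eq_intros simp: field_simps\<close>)
  also have "ln a2 - ln a1 = ln (a2 / a1)" using a by (simp add: ln_div)
  also have "ennreal (8 * \<alpha> * \<beta> * \<kappa>) * ennreal (ln (a2 / a1)) = ennreal (8 * \<alpha> * \<beta> * \<kappa> * ln (a2 / a1))"
    using pos a by (subst ennreal_mult) auto
  finally show "emeasure rho ?S = ennreal (8 * \<alpha> * \<beta> * \<kappa> * ln (a2 / a1))" .
qed

section \<open>Testing a Calderon--Zygmund decomposition\<close>

lemma sum_le_infsum_ennreal: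
  fixes f :: "'a \<Rightarrow> ennreal"
  assumes "finite F" "F \<subseteq> J"
  shows "sum f F \<le> infsum f J"
proof -
  have "infsum f J = (SUP F\<in>{F. finite F \<and> F \<subseteq> J}. sum f F)"
    by (rule nonneg_infsum_complete) simp
  then show ?thesis using assms by (auto intro!: SUP_upper)
qed

text \<open>
  Testing the decomposition against \<open>\<phi>\<close>: the good part contributes at most \<open>C\<^sub>0 \<alpha> \<mu>(W)\<close>, and since
  the bad parts have mean zero each of them only sees the oscillation of \<open>\<phi>\<close> on its support.
\<close>

lemma CZ_decomposition_duality:
  fixes f :: "'a \<Rightarrow> complex" and \<phi> :: "'a \<Rightarrow> real"
  assumes CZ: "CZ_decomposition M d C\<^sub>0 f \<alpha> \<E>" and C0: "C\<^sub>0 \<ge> 1" and \<alpha>: "\<alpha> > 0"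
    and f: "integrable M f" and \<phi>m: "\<phi> \<in> borel_measurable M"
    and \<phi>01: "\<And>y. 0 \<le> \<phi> y" "\<And>y. \<phi> y \<le> 1" and \<phi>W: "\<And>y. y \<in> space M - W \<Longrightarrow> \<phi> y = 0"
    and W: "W \<in> sets M" "emeasure M W < \<infinity>" and \<eta>: "\<eta> \<ge> 0"
    and osc: "\<And>E r x y z. E \<in> \<E> \<Longrightarrow> r > 0 \<Longrightarrow> x \<in> space M \<Longrightarrow>
      E \<subseteq> {y \<in> space M. d x y < C\<^sub>0 * r} \<Longrightarrow> enlarge M d E r \<in> sets M \<Longrightarrow>
      emeasure M (enlarge M d E r) \<le> ennreal (C\<^sub>0 / \<alpha>) * (\<integral>\<^sup>+y. ennreal (norm (f y)) \<partial>M) \<Longrightarrow>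
      y \<in> E \<Longrightarrow> z \<in> E \<Longrightarrow> \<bar>\<phi> y - \<phi> z\<bar> \<le> \<eta>"
  shows "norm (\<integral>y. f y * \<phi> y \<partial>M) \<le> C\<^sub>0 * \<alpha> * measure M W + \<eta> * C\<^sub>0 * (\<integral>y. norm (f y) \<partial>M)"
proof -
  from CZ[unfolded CZ_decomposition_def]
  obtain J :: "nat set" and E r x g b where *: "\<E> = E ` J \<and>
    (\<forall>j\<in>J. E j \<in> sets M \<and> r j > 0 \<and> x j \<in> space M \<and> integrable M (b j) \<and>
           enlarge M d (E j) (r j) \<in> sets M) \<and>
        g \<in> borel_measurable M \<and>
        (AE y in M. ((\<lambda>j. b j y) has_sum (f y - g y)) J) \<and>
        (AE y in M. norm (g y) \<le> C\<^sub>0 * \<alpha>) \<and>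
        (\<forall>j\<in>J. \<forall>y\<in>space M - E j. b j y = 0) \<and>
        (\<Sum>\<^sub>\<infinity>j\<in>J. \<integral>\<^sup>+y. ennreal (norm (b j y)) \<partial>M)
           \<le> ennreal C\<^sub>0 * (\<integral>\<^sup>+y. ennreal (norm (f y)) \<partial>M) \<and>
        (\<forall>j\<in>J. (LINT y:E j|M. b j y) = 0) \<and>
        (\<forall>j\<in>J. E j \<subseteq> {y \<in> space M. d (x j) y < C\<^sub>0 * r j}) \<and>
        (\<Sum>\<^sub>\<infinity>j\<in>J. emeasure M (enlarge M d (E j) (r j)))
           \<le> ennreal (C\<^sub>0 / \<alpha>) * (\<integral>\<^sup>+y. ennreal (norm (f y)) \<partial>M)"
    by (elim exE)
  then have \<E>: "\<E> = E ` J"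
    and J: "\<And>j. j \<in> J \<Longrightarrow> E j \<in> sets M \<and> r j > 0 \<and> x j \<in> space M \<and> integrable M (b j) \<and>
        enlarge M d (E j) (r j) \<in> sets M"
    and gm: "g \<in> borel_measurable M"
    and hs: "AE y in M. ((\<lambda>j. b j y) has_sum (f y - g y)) J"
    and gb: "AE y in M. norm (g y) \<le> C\<^sub>0 * \<alpha>"
    and b0: "\<And>j y. j \<in> J \<Longrightarrow> y \<in> space M - E j \<Longrightarrow> b j y = 0"
    and bsum: "(\<Sum>\<^sub>\<infinity>j\<in>J. \<integral>\<^sup>+y. ennreal (norm (b j y)) \<partial>M) \<le> ennreal C\<^sub>0 * (\<integral>\<^sup>+y. ennreal (norm (f y)) \<partial>M)"
    and bint: "\<And>j. j \<in> J \<Longrightarrow> (LINT y:E j|M. b j y) = 0"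
    and Eball: "\<And>j. j \<in> J \<Longrightarrow> E j \<subseteq> {y \<in> space M. d (x j) y < C\<^sub>0 * r j}"
    by blast+
  have Estar: "emeasure M (enlarge M d (E j) (r j))
      \<le> ennreal (C\<^sub>0 / \<alpha>) * (\<integral>\<^sup>+y. ennreal (norm (f y)) \<partial>M)" if "j \<in> J" for j
    using sum_le_infsum_ennreal[of "{j}" J "\<lambda>j. emeasure M (enlarge M d (E j) (r j))"] that *
    by (auto intro: order_trans)
  define F where "F = (\<integral>y. norm (f y) \<partial>M)"
  have F0: "0 \<le> F" by (simp add: F_def)
  have nnF: "(\<integral>\<^sup>+y. ennreal (norm (f y)) \<partial>M) = ennreal F"
    unfolding F_def using f by (intro nn_integral_eq_integral) auto
  \<comment> \<open>Extension by zero outside \<open>J\<close> turns sums over an arbitrary index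
    set into series, so that termwise integration applies.\<close>
  define \<beta> where "\<beta> j = (if j \<in> J then b j else (\<lambda>_. 0))" for j
  have \<beta>i: "integrable M (\<beta> j)" for j using J[of j] by (auto simp: \<beta>_def)
  define B where "B j = (\<integral>y. norm (\<beta> j y) \<partial>M)" for j
  have B0: "0 \<le> B j" for j by (simp add: B_def)
  have nnB: "(\<integral>\<^sup>+y. ennreal (norm (\<beta> j y)) \<partial>M) = ennreal (B j)" for j
    unfolding B_def using \<beta>i[of j] by (intro nn_integral_eq_integral) auto
  have partial: "(\<Sum>j<n. B j) \<le> C\<^sub>0 * F" for n
  proof -
    have "(\<Sum>j<n. ennreal (B j)) = (\<Sum>j\<in>{..<n} \<inter> J. \<integral>\<^sup>+y. ennreal (norm (b j y)) \<partial>M)"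
      unfolding nnB[symmetric] by (rule sum.mono_neutral_cong_right) (auto simp: \<beta>_def)
    also have "\<dots> \<le> (\<Sum>\<^sub>\<infinity>j\<in>J. \<integral>\<^sup>+y. ennreal (norm (b j y)) \<partial>M)"
      by (rule sum_le_infsum_ennreal) auto
    also have "\<dots> \<le> ennreal (C\<^sub>0 * F)"
      using bsum C0 F0 unfolding nnF by (simp add: ennreal_mult)
    finally have "ennreal (\<Sum>j<n. B j) \<le> ennreal (C\<^sub>0 * F)" using B0 by (simp add: sum_ennreal)
    then show ?thesis using C0 F0 by (simp add: ennreal_le_iff)
  qed
  have Bs: "summable B"
    by (rule bounded_imp_summable[of B "C\<^sub>0 * F"])
      (use B0 partial[of "Suc _"] in \<open>auto simp: lessThan_Suc_atMost\<close>)
  have Bsum: "(\<Sum>j. B j) \<le> C\<^sub>0 * F" using Bs partial by (rule suminf_le_const)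
  define h where "h j y = \<beta> j y * complex_of_real (\<phi> y)" for j y
  have bound: "norm (z * complex_of_real (\<phi> y)) \<le> norm z" for z :: complex and y
    using \<phi>01[of y] by (simp add: norm_mult mult_left_le)
  have hi: "integrable M (h j)" for j
    unfolding h_def using \<phi>m
    by (intro Bochner_Integration.integrable_bound[OF \<beta>i[of j]]) (use \<beta>i[of j] bound in auto)
  have nh: "(\<integral>y. norm (h j y) \<partial>M) \<le> B j" for j
    unfolding B_def by (intro integral_mono integrable_norm hi \<beta>i) (simp add: h_def bound)
  have snh: "summable (\<lambda>j. \<integral>y. norm (h j y) \<partial>M)"
    by (rule summable_comparison_test[OF _ Bs]) (use nh in auto)
  have hs': "AE y in M. summable (\<lambda>j. norm (\<beta> j y)) \<and> (\<lambda>j. \<beta> j y) sums (f y - g y)"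
    using hs
  proof (rule AE_mp, intro AE_I2 impI)
    fix y assume "((\<lambda>j. b j y) has_sum (f y - g y)) J"
    then have u: "((\<lambda>j. \<beta> j y) has_sum (f y - g y)) UNIV"
      by (subst has_sum_cong_neutral[where T = J and g = "\<lambda>j. b j y"]) (auto simp: \<beta>_def)
    then have "(\<lambda>j. \<beta> j y) summable_on UNIV" by (auto simp: summable_on_def)
    \<comment> \<open>For complex values the unconditional summability in \<open>has_sum\<close> is
      absolute, which termwise integration demands.\<close>
    then have "(\<lambda>j. norm (\<beta> j y)) summable_on UNIV"
      by (simp add: summable_on_iff_abs_summable_on_complex)
    then show "summable (\<lambda>j. norm (\<beta> j y)) \<and> (\<lambda>j. \<beta> j y) sums (f y - g y)"
      using u has_sum_imp_sums summable_on_imp_summable by blast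
  qed
  have sh: "AE y in M. summable (\<lambda>j. norm (h j y))"
    using hs'
  proof (rule AE_mp, intro AE_I2 impI)
    fix y assume "summable (\<lambda>j. norm (\<beta> j y)) \<and> (\<lambda>j. \<beta> j y) sums (f y - g y)"
    then show "summable (\<lambda>j. norm (h j y))"
      by (intro summable_comparison_test[of "\<lambda>j. norm (h j y)" "\<lambda>j. norm (\<beta> j y)"])
        (auto simp: h_def bound)
  qed
  have heq: "AE y in M. (\<Sum>j. h j y) = (f y - g y) * \<phi> y"
    using hs'
  proof (rule AE_mp, intro AE_I2 impI)
    fix y assume "summable (\<lambda>j. norm (\<beta> j y)) \<and> (\<lambda>j. \<beta> j y) sums (f y - g y)"
    then have "(\<lambda>j. h j y) sums ((f y - g y) * \<phi> y)" unfolding h_def by (intro sums_mult2) auto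
    then show "(\<Sum>j. h j y) = (f y - g y) * \<phi> y" by (simp add: sums_iff)
  qed
  have mh: "(\<lambda>y. (f y - g y) * complex_of_real (\<phi> y)) \<in> borel_measurable M"
    using f gm \<phi>m by measurable
  have "(\<integral>y. (f y - g y) * \<phi> y \<partial>M) = (\<integral>y. (\<Sum>j. h j y) \<partial>M)"
    using heq mh hi by (intro integral_cong_AE) auto
  also have "\<dots> = (\<Sum>j. \<integral>y. h j y \<partial>M)" by (rule integral_suminf[OF hi sh snh])
  finally have bad: "(\<integral>y. (f y - g y) * \<phi> y \<partial>M) = (\<Sum>j. \<integral>y. h j y \<partial>M)" .
  have hb: "norm (\<integral>y. h j y \<partial>M) \<le> \<eta> * B j" for j
  \<comment> \<open>The oscillation is measured against a reference point of \<open>E j\<close>; if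
    there is none, the integrand vanishes identically.\<close>
  proof (cases "j \<in> J \<and> E j \<noteq> {}")
    case False
    have "h j y = 0" if "y \<in> space M" for y
      using False b0[of j y] that by (cases "j \<in> J") (auto simp: h_def \<beta>_def)
    then have "(\<integral>y. h j y \<partial>M) = (\<integral>y. 0 \<partial>M)" by (intro Bochner_Integration.integral_cong) auto
    then show ?thesis using \<eta> B0 by simp
  next
    case True
    then obtain y0 where j: "j \<in> J" and y0: "y0 \<in> E j" by auto
    have "(\<integral>y. \<beta> j y \<partial>M) = (LINT y:E j|M. b j y)"
      unfolding set_lebesgue_integral_def
      by (intro Bochner_Integration.integral_cong) (use b0 j in \<open>auto simp: \<beta>_def indicator_def\<close>)
    then have z: "(\<integral>y. \<beta> j y \<partial>M) = 0" using bint j by simp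
    \<comment> \<open>Here the vanishing mean enters: \<phi> may be replaced by its difference from
      the constant \<open>\<phi> y0\<close>.\<close>
    have "(\<integral>y. h j y \<partial>M) = (\<integral>y. h j y \<partial>M) - (\<integral>y. \<beta> j y * complex_of_real (\<phi> y0) \<partial>M)"
      using z by simp
    also have "\<dots> = (\<integral>y. h j y - \<beta> j y * complex_of_real (\<phi> y0) \<partial>M)"
      using hi[of j] \<beta>i[of j] by (intro Bochner_Integration.integral_diff[symmetric]) auto
    finally have "norm (\<integral>y. h j y \<partial>M) = norm (\<integral>y. h j y - \<beta> j y * complex_of_real (\<phi> y0) \<partial>M)" by simp
    also have "\<dots> \<le> (\<integral>y. norm (h j y - \<beta> j y * complex_of_real (\<phi> y0)) \<partial>M)"
      by (rule integral_norm_bound)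
    also have "\<dots> \<le> (\<integral>y. \<eta> * norm (\<beta> j y) \<partial>M)"
    proof (rule integral_mono)
      show "integrable M (\<lambda>y. norm (h j y - \<beta> j y * complex_of_real (\<phi> y0)))"
        using hi[of j] \<beta>i[of j] by auto
      show "integrable M (\<lambda>y. \<eta> * norm (\<beta> j y))" using \<beta>i[of j] by auto
      fix y assume y: "y \<in> space M"
      show "norm (h j y - \<beta> j y * complex_of_real (\<phi> y0)) \<le> \<eta> * norm (\<beta> j y)"
      proof (cases "y \<in> E j")
        case True
        then have "\<bar>\<phi> y - \<phi> y0\<bar> \<le> \<eta>"
          using osc[of "E j" "r j" "x j" y y0] J[OF j] Eball[OF j] Estar[OF j] y0 j \<E> by auto
        then have "norm (complex_of_real (\<phi> y - \<phi> y0)) \<le> \<eta>" by (simp only: norm_of_real)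
        moreover have "h j y - \<beta> j y * complex_of_real (\<phi> y0) = \<beta> j y * complex_of_real (\<phi> y - \<phi> y0)"
          by (simp add: h_def algebra_simps)
        ultimately show ?thesis
          by (metis mult.commute mult_right_mono norm_ge_zero norm_mult)
      next
        case False
        then show ?thesis using b0[OF j] y j by (simp add: h_def \<beta>_def)
      qed
    qed
    finally show ?thesis by (simp add: B_def)
  qed
  have shs: "summable (\<lambda>j. norm (\<integral>y. h j y \<partial>M))"
    by (rule summable_comparison_test[OF _ summable_mult[OF Bs, of \<eta>]]) (use hb in auto)
  have "norm (\<Sum>j. \<integral>y. h j y \<partial>M) \<le> (\<Sum>j. norm (\<integral>y. h j y \<partial>M))" by (rule summable_norm[OF shs])
  also have "\<dots> \<le> (\<Sum>j. \<eta> * B j)" by (rule suminf_le[OF hb shs summable_mult[OF Bs]])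
  also have "\<dots> = \<eta> * (\<Sum>j. B j)" by (rule suminf_mult[OF Bs])
  also have "\<dots> \<le> \<eta> * (C\<^sub>0 * F)" using Bsum \<eta> by (rule mult_left_mono)
  finally have 1: "norm (\<integral>y. (f y - g y) * \<phi> y \<partial>M) \<le> \<eta> * C\<^sub>0 * F" unfolding bad by (simp add: mult_ac)
  have Wi: "integrable M (\<lambda>y. C\<^sub>0 * \<alpha> * indicator W y)" using W by auto
  have gphi: "AE y in M. norm (g y * complex_of_real (\<phi> y)) \<le> C\<^sub>0 * \<alpha> * indicator W y"
    using gb
  proof (rule AE_mp, intro AE_I2 impI)
    fix y assume y: "y \<in> space M" and gy: "norm (g y) \<le> C\<^sub>0 * \<alpha>"
    show "norm (g y * complex_of_real (\<phi> y)) \<le> C\<^sub>0 * \<alpha> * indicator W y"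
      using order_trans[OF bound gy] \<phi>W[of y] y by (cases "y \<in> W") auto
  qed
  have gi: "integrable M (\<lambda>y. g y * complex_of_real (\<phi> y))"
    by (rule Bochner_Integration.integrable_bound[OF Wi])
      (use gm \<phi>m gphi C0 \<alpha> in \<open>auto simp: abs_mult\<close>)
  have "norm (\<integral>y. g y * \<phi> y \<partial>M) \<le> (\<integral>y. norm (g y * complex_of_real (\<phi> y)) \<partial>M)"
    by (rule integral_norm_bound)
  also have "\<dots> \<le> (\<integral>y. C\<^sub>0 * \<alpha> * indicator W y \<partial>M)"
    by (rule integral_mono_AE) (use gi Wi gphi in auto)
  also have "\<dots> = C\<^sub>0 * \<alpha> * measure M W" using W sets.sets_into_space[OF W(1)]
    by (simp add: Int_absorb2)
  finally have 2: "norm (\<integral>y. g y * \<phi> y \<partial>M) \<le> C\<^sub>0 * \<alpha> * measure M W" .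
  have fi: "integrable M (\<lambda>y. f y * complex_of_real (\<phi> y))"
    by (rule Bochner_Integration.integrable_bound[OF f]) (use f \<phi>m bound in auto)
  have "(\<integral>y. f y * \<phi> y \<partial>M) = (\<integral>y. g y * \<phi> y \<partial>M) + (\<integral>y. (f y - g y) * \<phi> y \<partial>M)"
    using fi gi by (simp add: left_diff_distrib)
  then show ?thesis
    using 1 2 norm_triangle_ineq[of "\<integral>y. g y * \<phi> y \<partial>M" "\<integral>y. (f y - g y) * \<phi> y \<partial>M"]
    unfolding F_def by simp
qed

section \<open>The test function\<close>

text \<open>The flow of \<open>Z\<close> sends \<open>(x, y, z)\<close> at height 1 to
  \<open>(x, y + (h - 1), z - x * (h - 1) / 2)\<close> at height \<open>h\<close>, which is solved
  for the point of the cube.\<close>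

lemma cyl_region_iff:
  assumes "a > 0" "r > 1"
  shows "((q, p, t), h) \<in> cyl_region r Q a \<longleftrightarrow>
    (q, p - (h - 1), t + q * (h - 1) / 2) \<in> Q \<and> a / r < h \<and> h < a * r" (is "?L \<longleftrightarrow> ?R")
proof
  assume ?L
  then obtain x y z s where n: "(x, y, z) \<in> Q" and s: "ln (a / r) < s" "s < ln (a * r)"
    and e: "((q, p, t), h) = eheis_mult ((x, y, z), 1) (eheis_exp (s *\<^sub>R Z_field))"
    unfolding cyl_region_def by force
  have "h = exp s" "q = x" "p = y + (h - 1)" "t = z - x * (h - 1) / 2"
    using e by (auto simp: eheis_exp_Z)
  moreover have "a / r < exp s" "exp s < a * r"
    using s assms by (metis divide_pos_pos exp_less_mono exp_ln less_trans zero_less_one,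
      metis exp_less_mono exp_ln less_trans mult_pos_pos zero_less_one)
  ultimately show ?R using n by simp
next
  assume R: ?R
  then have h: "h > 0" using assms by (meson divide_pos_pos less_trans zero_less_one)
  show ?L
    unfolding cyl_region_def
  proof (intro CollectI exI conjI)
    show "((q, p, t), h) = eheis_mult ((q, p - (h - 1), t + q * (h - 1) / 2), 1) (eheis_exp (ln h *\<^sub>R Z_field))"
      using h by (simp add: eheis_exp_Z)
    show "ln h \<in> {ln (a / r)<..<ln (a * r)}" using R h assms by simp
  qed (use R in blast)
qed

text \<open>A quasi-triangle inequality through a common centre. The vertical components differ by
  an area formed from the small differences only, at most \<open>2 * \<rho>^2\<close>; the two given
  errors add another \<open>2 * \<rho>^2\<close>.\<close>

lemma heis_relative_displacement:
  fixes x0 y0 z0 x y z x' y' z' \<rho> :: real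
  assumes "\<bar>x - x0\<bar> \<le> \<rho>" "\<bar>y - y0\<bar> \<le> \<rho>" "\<bar>z - z0 - (y0 * (x - x0) - x0 * (y - y0)) / 2\<bar> \<le> \<rho>\<^sup>2"
    and "\<bar>x' - x0\<bar> \<le> \<rho>" "\<bar>y' - y0\<bar> \<le> \<rho>" "\<bar>z' - z0 - (y0 * (x' - x0) - x0 * (y' - y0)) / 2\<bar> \<le> \<rho>\<^sup>2"
  shows "\<bar>z' - z - (y * (x' - x) - x * (y' - y)) / 2\<bar> \<le> 4 * \<rho>\<^sup>2"
proof -
  have \<rho>: "0 \<le> \<rho>" using assms(1) by linarith
  define w1 where "w1 = z - z0 - (y0 * (x - x0) - x0 * (y - y0)) / 2"
  define w2 where "w2 = z' - z0 - (y0 * (x' - x0) - x0 * (y' - y0)) / 2"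
  have "\<bar>x' - x\<bar> \<le> 2 * \<rho>" "\<bar>y' - y\<bar> \<le> 2 * \<rho>" using assms by linarith+
  then have "\<bar>(y - y0) * (x' - x)\<bar> \<le> \<rho> * (2 * \<rho>)" "\<bar>(x - x0) * (y' - y)\<bar> \<le> \<rho> * (2 * \<rho>)"
    unfolding abs_mult using assms \<rho> by (auto intro!: mult_mono)
  then have AB: "\<bar>(y - y0) * (x' - x)\<bar> \<le> 2 * \<rho>\<^sup>2" "\<bar>(x - x0) * (y' - y)\<bar> \<le> 2 * \<rho>\<^sup>2"
    by (simp_all add: power2_eq_square)
  have w: "\<bar>w1\<bar> \<le> \<rho>\<^sup>2" "\<bar>w2\<bar> \<le> \<rho>\<^sup>2" using assms by (auto simp: w1_def w2_def)
  have "z' - z - (y * (x' - x) - x * (y' - y)) / 2 =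
      w2 - w1 - ((y - y0) * (x' - x) - (x - x0) * (y' - y)) / 2"
    unfolding w1_def w2_def by (simp add: field_simps)
  moreover have "\<bar>w2 - w1 - (A - B) / 2\<bar> \<le> 4 * \<rho>\<^sup>2"
    if "\<bar>A\<bar> \<le> 2 * \<rho>\<^sup>2" "\<bar>B\<bar> \<le> 2 * \<rho>\<^sup>2" for A B
    using that w by argo
  ultimately show ?thesis using AB by simp
qed

text \<open>Apart from the 1 this is comparable to the square of a homogeneous norm of the point
  dilated by \<open>1 / \<epsilon>\<close>; the 1 makes it insensitive to displacements below the
  scale \<epsilon>.\<close>

definition heis_gauge :: "real \<Rightarrow> heis \<Rightarrow> real" where
  "heis_gauge \<epsilon> n = 1 + (fst n / \<epsilon>)\<^sup>2 + (fst (snd n) / \<epsilon>)\<^sup>2 + \<bar>snd (snd n)\<bar> / \<epsilon>\<^sup>2"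

lemma heis_gauge_ge_one: "1 \<le> heis_gauge \<epsilon> n"
  unfolding heis_gauge_def by simp

text \<open>Noncommutativity adds the cross terms \<open>y * u\<close> and \<open>x * v\<close> to
  the vertical coordinate. They are at most \<open>y^2 + \<rho>^2\<close> and
  \<open>x^2 + \<rho>^2\<close>, so the quadratic part of the gauge absorbs them, and its constant
  term absorbs \<open>\<rho>^2\<close>. The 21 is 8 + 8 + 5 from the three coordinates.\<close>

lemma heis_gauge_comparable:
  assumes \<epsilon>: "\<epsilon> > 0" and C: "C \<ge> 0" and D: "D \<le> \<epsilon>"
    and n: "heis_dist n0 n < C * D" and n': "heis_dist n0 n' < C * D"
  shows "heis_gauge \<epsilon> n' \<le> (3 + 21 * C\<^sup>2) * heis_gauge \<epsilon> n"
proof -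
  obtain x0 y0 z0 x y z x' y' z' where e: "n0 = (x0, y0, z0)" "n = (x, y, z)" "n' = (x', y', z')"
    by (metis prod.collapse)
  define \<rho> where "\<rho> = C * D"
  note d = heis_dist_less_imp[OF n[unfolded e \<rho>_def[symmetric]]]
  note d' = heis_dist_less_imp[OF n'[unfolded e \<rho>_def[symmetric]]]
  have \<rho>: "0 \<le> \<rho>" using d(1) by linarith
  have \<rho>\<epsilon>: "\<rho>\<^sup>2 \<le> C\<^sup>2 * \<epsilon>\<^sup>2"
    using \<rho> mult_left_mono[OF D C] power_mono[of \<rho> "C * \<epsilon>" 2] by (simp add: \<rho>_def power_mult_distrib)
  define u v where "u = x' - x" and "v = y' - y"
  have u: "\<bar>u\<bar> \<le> 2 * \<rho>" and v: "\<bar>v\<bar> \<le> 2 * \<rho>" using d d' unfolding u_def v_def by linarith+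
  have u2: "u\<^sup>2 \<le> 4 * \<rho>\<^sup>2" and v2: "v\<^sup>2 \<le> 4 * \<rho>\<^sup>2"
    using power_mono[OF u, of 2] power_mono[OF v, of 2] by auto
  have w: "\<bar>z' - z - (y * u - x * v) / 2\<bar> \<le> 4 * \<rho>\<^sup>2"
    unfolding u_def v_def by (rule heis_relative_displacement[OF d d'])
  have sq: "2 * a * b \<le> a\<^sup>2 + b\<^sup>2" for a b :: real by (rule sum_squares_bound)
  have yu: "\<bar>y * u\<bar> \<le> y\<^sup>2 + \<rho>\<^sup>2" and xv: "\<bar>x * v\<bar> \<le> x\<^sup>2 + \<rho>\<^sup>2"
    using mult_left_mono[OF u, of "\<bar>y\<bar>"] mult_left_mono[OF v, of "\<bar>x\<bar>"] sq[of "\<bar>y\<bar>" \<rho>] sq[of "\<bar>x\<bar>" \<rho>]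
    by (auto simp: abs_mult)
  have z': "\<bar>z'\<bar> \<le> \<bar>z\<bar> + 5 * \<rho>\<^sup>2 + (x\<^sup>2 + y\<^sup>2) / 2"
  proof (rule abs_leI)
    note b = w[unfolded abs_le_iff, THEN conjunct1] w[unfolded abs_le_iff, THEN conjunct2]
      yu[unfolded abs_le_iff, THEN conjunct1] yu[unfolded abs_le_iff, THEN conjunct2]
      xv[unfolded abs_le_iff, THEN conjunct1] xv[unfolded abs_le_iff, THEN conjunct2]
    show "z' \<le> \<bar>z\<bar> + 5 * \<rho>\<^sup>2 + (x\<^sup>2 + y\<^sup>2) / 2" using b abs_ge_self[of z] abs_ge_minus_self[of z] by argo
    show "- z' \<le> \<bar>z\<bar> + 5 * \<rho>\<^sup>2 + (x\<^sup>2 + y\<^sup>2) / 2" using b abs_ge_self[of z] abs_ge_minus_self[of z] by argo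
  qed
  have "x'\<^sup>2 = x\<^sup>2 + 2 * x * u + u\<^sup>2" "y'\<^sup>2 = y\<^sup>2 + 2 * y * v + v\<^sup>2"
    unfolding u_def v_def by (simp_all add: power2_eq_square algebra_simps)
  then have xy': "x'\<^sup>2 \<le> 2 * x\<^sup>2 + 8 * \<rho>\<^sup>2" "y'\<^sup>2 \<le> 2 * y\<^sup>2 + 8 * \<rho>\<^sup>2"
    using sq[of x u] sq[of y v] u2 v2 by linarith+
  have g: "heis_gauge \<epsilon> (a, b, c) = (\<epsilon>\<^sup>2 + a\<^sup>2 + b\<^sup>2 + \<bar>c\<bar>) / \<epsilon>\<^sup>2" for a b c
    using \<epsilon> by (simp add: heis_gauge_def power_divide add_divide_distrib)
  have "\<epsilon>\<^sup>2 + x'\<^sup>2 + y'\<^sup>2 + \<bar>z'\<bar> \<le> 3 * (\<epsilon>\<^sup>2 + x\<^sup>2 + y\<^sup>2 + \<bar>z\<bar>) + 21 * C\<^sup>2 * \<epsilon>\<^sup>2"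
  proof -
    have "0 \<le> x\<^sup>2" "0 \<le> y\<^sup>2" "0 \<le> \<epsilon>\<^sup>2" "0 \<le> \<bar>z\<bar>" by auto
    then show ?thesis using z' xy' \<rho>\<epsilon> unfolding mult.assoc by argo
  qed
  also have "\<dots> \<le> 3 * (\<epsilon>\<^sup>2 + x\<^sup>2 + y\<^sup>2 + \<bar>z\<bar>) + 21 * C\<^sup>2 * (\<epsilon>\<^sup>2 + x\<^sup>2 + y\<^sup>2 + \<bar>z\<bar>)"
    by (intro add_left_mono mult_left_mono) auto
  finally have "\<epsilon>\<^sup>2 + x'\<^sup>2 + y'\<^sup>2 + \<bar>z'\<bar> \<le> (3 + 21 * C\<^sup>2) * (\<epsilon>\<^sup>2 + x\<^sup>2 + y\<^sup>2 + \<bar>z\<bar>)"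
    by (simp add: distrib_right)
  then show ?thesis unfolding e g times_divide_eq_right by (rule divide_right_mono) simp
qed

text \<open>On a cylinder \<open>ln h\<close> varies by less than \<open>2 * ln r\<close>. This is
  at most 2 if \<open>r \<le> exp 1\<close>. Otherwise \<open>a * r^2 \<le> \<epsilon>\<close> keeps
  \<open>ln h\<close> more than \<open>ln r\<close> below \<open>ln \<epsilon>\<close>, so the
  variation is less than twice the distance to \<open>ln \<epsilon>\<close>. Either way the factor 3
  results.\<close>

lemma height_comparable:
  fixes a r h h' \<epsilon> :: real
  assumes \<epsilon>: "\<epsilon> > 0" and a: "a > 0" and r: "r > 1" and ar: "r \<le> exp 1 \<or> a * r\<^sup>2 \<le> \<epsilon>"
    and h: "a / r < h" "h < a * r" and h': "a / r < h'" "h' < a * r"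
  shows "1 + \<bar>ln (h' / \<epsilon>)\<bar> \<le> 3 * (1 + \<bar>ln (h / \<epsilon>)\<bar>)"
proof -
  have r0: "r > 0" using r by simp
  have pos: "a / r > 0" "a * r > 0" using a r0 by simp_all
  have hp: "h > 0" "h' > 0" using h h' pos by linarith+
  have "ln (a / r) = ln a - ln r" "ln (a * r) = ln a + ln r" using a r0 by (simp_all add: ln_div ln_mult)
  then have l: "ln a - ln r < ln h" "ln h < ln a + ln r" "ln a - ln r < ln h'" "ln h' < ln a + ln r"
    using h h' hp pos by (metis ln_less_cancel_iff)+
  have lr: "ln r > 0" using r by simp
  have e: "ln (h / \<epsilon>) = ln h - ln \<epsilon>" "ln (h' / \<epsilon>) = ln h' - ln \<epsilon>" using hp \<epsilon> by (auto simp: ln_div)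
  show ?thesis
  proof (cases "r \<le> exp 1")
    case True
    then have "ln r \<le> 1" using r by (metis exp_gt_zero ln_exp ln_le_cancel_iff less_trans zero_less_one)
    then show ?thesis unfolding e using l lr by argo
  next
    case False
    then have "ln (a * r\<^sup>2) \<le> ln \<epsilon>" using ar a r \<epsilon> by simp
    then have "ln a + 2 * ln r \<le> ln \<epsilon>" using a r by (simp add: ln_mult ln_realpow)
    then show ?thesis unfolding e using l lr by argo
  qed
qed

text \<open>In these coordinates the integral curves of \<open>Z\<close> are vertical lines.\<close>

definition straighten :: "eheis \<Rightarrow> heis" where
  "straighten y = (fst (fst y), fst (snd (fst y)) - (snd y - 1), snd (snd (fst y)) + fst (fst y) * (snd y - 1) / 2)"

text \<open>On cylinders over cubes of size at most \<epsilon> each factor of the product varies by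
  a bounded ratio. The logarithm converts the ratio into a difference, division by \<open>L\<close>
  makes that small, and the function reaches 0 when the product reaches
  \<open>exp L\<close>.\<close>

definition log_bump :: "real \<Rightarrow> real \<Rightarrow> eheis \<Rightarrow> real" where
  "log_bump \<epsilon> L y = max 0 (1 - ln (heis_gauge \<epsilon> (straighten y) * (1 + \<bar>ln (snd y / \<epsilon>)\<bar>)) / L)"

lemma log_bump_factor_ge_one: "1 \<le> heis_gauge \<epsilon> n * (1 + \<bar>s\<bar>)"
  using mult_mono[OF heis_gauge_ge_one[of \<epsilon> n], of 1 "1 + \<bar>s\<bar>"] heis_gauge_ge_one[of \<epsilon> n] by simp

lemma log_bump_range: "L > 0 \<Longrightarrow> 0 \<le> log_bump \<epsilon> L y" "L > 0 \<Longrightarrow> log_bump \<epsilon> L y \<le> 1"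
  using log_bump_factor_ge_one[of \<epsilon> "straighten y" "ln (snd y / \<epsilon>)"] unfolding log_bump_def by auto

lemma log_bump_oscillation:
  assumes C: "christ_decomposition \<Q> \<delta> C\<^sub>1 c" and P: "tame \<Q> \<delta> \<gamma> lam (Cyl r k Q a)"
    and \<epsilon>: "\<epsilon> > 0" "\<delta> powi k \<le> \<epsilon>" and L: "L > 0"
    and yz: "y \<in> cyl_region r Q a" "z \<in> cyl_region r Q a"
  shows "\<bar>log_bump \<epsilon> L y - log_bump \<epsilon> L z\<bar> \<le> ln (3 * (3 + 21 * C\<^sub>1\<^sup>2)) / L"
proof -
  have Q: "Q \<in> \<Q> k" and a: "a > 0" and r: "r > 1"
    and lr: "r \<le> exp 1 \<or> a * r\<^sup>2 \<le> \<epsilon>" using P \<epsilon> by auto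
  have C1: "C\<^sub>1 > 0" using C by (simp add: christ_decomposition_def)
  obtain n0 where n0: "Q \<subseteq> heis_ball n0 (C\<^sub>1 * \<delta> powi k)"
    using C Q unfolding christ_decomposition_def by meson
  define K where "K = 3 * (3 + 21 * C\<^sub>1\<^sup>2)"
  have K: "K > 0" by (simp add: K_def add_pos_nonneg)
  define N where "N y = heis_gauge \<epsilon> (straighten y) * (1 + \<bar>ln (snd y / \<epsilon>)\<bar>)" for y
  have N1: "1 \<le> N y" for y unfolding N_def by (rule log_bump_factor_ge_one)
  have NK: "N y \<le> K * N z" if "y \<in> cyl_region r Q a" "z \<in> cyl_region r Q a" for y z
  proof -
    obtain q p t h where y: "y = ((q, p, t), h)" by (metis prod.collapse)
    obtain q' p' t' h' where z: "z = ((q', p', t'), h')" by (metis prod.collapse)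
    have Y: "straighten y \<in> Q" "a / r < snd y" "snd y < a * r"
      using that(1) unfolding y cyl_region_iff[OF a r] by (auto simp: straighten_def)
    have Z: "straighten z \<in> Q" "a / r < snd z" "snd z < a * r"
      using that(2) unfolding z cyl_region_iff[OF a r] by (auto simp: straighten_def)
    have "heis_gauge \<epsilon> (straighten y) \<le> (3 + 21 * C\<^sub>1\<^sup>2) * heis_gauge \<epsilon> (straighten z)"
      by (rule heis_gauge_comparable[OF \<epsilon>(1) less_imp_le[OF C1] \<epsilon>(2), of n0])
        (use n0 Y(1) Z(1) in \<open>auto simp: heis_ball_def\<close>)
    moreover have "1 + \<bar>ln (snd y / \<epsilon>)\<bar> \<le> 3 * (1 + \<bar>ln (snd z / \<epsilon>)\<bar>)"
      by (rule height_comparable[OF \<epsilon>(1) a r lr Z(2,3) Y(2,3)])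
    ultimately have "N y \<le> ((3 + 21 * C\<^sub>1\<^sup>2) * heis_gauge \<epsilon> (straighten z)) * (3 * (1 + \<bar>ln (snd z / \<epsilon>)\<bar>))"
      unfolding N_def using heis_gauge_ge_one[of \<epsilon> "straighten z"] by (intro mult_mono) auto
    then show ?thesis unfolding N_def K_def by (simp only: mult_ac)
  qed
  have ln_bound: "ln (N y) / L \<le> ln K / L + ln (N z) / L"
    if "y \<in> cyl_region r Q a" "z \<in> cyl_region r Q a" for y z
  proof -
    have "ln (N y) \<le> ln (K * N z)" using NK[OF that] N1[of y] N1[of z] K by (intro ln_mono) auto
    also have "\<dots> = ln K + ln (N z)" using K N1[of z] by (simp add: ln_mult)
    finally show ?thesis using L by (simp add: divide_right_mono flip: add_divide_distrib)
  qed
  have "log_bump \<epsilon> L x = max 0 (1 - ln (N x) / L)" for x unfolding log_bump_def N_def ..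
  \<comment> \<open>Truncation by \<open>max 0\<close> does not increase differences, and exchanging
    the two points gives the absolute value.\<close>
  then show ?thesis using ln_bound[OF yz] ln_bound[OF yz(2,1)] unfolding K_def[symmetric] by simp
qed

section \<open>Support and size of the test function\<close>

lemma rho_space: "space rho = eheis_carrier"
  unfolding rho_def by (simp add: space_restrict_space)

lemma log_bump_measurable: "log_bump \<epsilon> L \<in> borel_measurable rho"
proof -
  have [measurable]: "(\<lambda>y::eheis. fst (fst y)) \<in> borel_measurable borel"
    "(\<lambda>y::eheis. fst (snd (fst y))) \<in> borel_measurable borel"
    "(\<lambda>y::eheis. snd (snd (fst y))) \<in> borel_measurable borel"
    "(\<lambda>y::eheis. snd y) \<in> borel_measurable borel"
    by (intro borel_measurable_continuous_onI continuous_intros)+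
  have "log_bump \<epsilon> L \<in> borel_measurable borel"
    unfolding log_bump_def heis_gauge_def straighten_def fst_conv snd_conv by measurable
  then show ?thesis
    unfolding rho_def by (auto intro!: measurable_restrict_space1)
qed

abbreviation straight_box :: "real \<Rightarrow> real \<Rightarrow> eheis set" where
  "straight_box \<epsilon> B \<equiv> sheared_box 0 (B * \<epsilon>) (\<lambda>q a. a - 1) (B * \<epsilon>) (\<lambda>q p a. - (q * (a - 1) / 2)) (B * \<epsilon>\<^sup>2)
     (\<epsilon> * exp (- B)) (\<epsilon> * exp B)"

lemma straight_box_iff:
  assumes "\<epsilon> > 0" "snd y > 0"
  shows "y \<in> straight_box \<epsilon> B \<longleftrightarrow> \<bar>fst (straighten y)\<bar> \<le> B * \<epsilon> \<and> \<bar>fst (snd (straighten y))\<bar> \<le> B * \<epsilon> \<and>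
    \<bar>snd (snd (straighten y))\<bar> \<le> B * \<epsilon>\<^sup>2 \<and> \<bar>ln (snd y / \<epsilon>)\<bar> \<le> B"
proof -
  obtain q p t h where y: "y = ((q, p, t), h)" by (metis prod.collapse)
  have h: "h > 0" using assms y by simp
  have he: "0 < h / \<epsilon>" using assms h by simp
  have "\<epsilon> * exp (- B) \<le> h \<longleftrightarrow> exp (- B) \<le> h / \<epsilon>"
    using assms by (simp add: pos_le_divide_eq mult.commute)
  also have "\<dots> \<longleftrightarrow> - B \<le> ln (h / \<epsilon>)" by (metis exp_le_cancel_iff exp_ln he)
  finally have "\<epsilon> * exp (- B) \<le> h \<longleftrightarrow> - B \<le> ln (h / \<epsilon>)" .
  moreover have "h \<le> \<epsilon> * exp B \<longleftrightarrow> h / \<epsilon> \<le> exp B"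
    using assms by (simp add: pos_divide_le_eq mult.commute)
  then have "h \<le> \<epsilon> * exp B \<longleftrightarrow> ln (h / \<epsilon>) \<le> B" by (metis exp_le_cancel_iff exp_ln he)
  ultimately show ?thesis
    unfolding y sheared_box_def straighten_def by (auto simp: abs_le_iff)
qed

text \<open>The base contributes \<open>8 * B^3 * \<epsilon>^4\<close>, its vertical side being
  quadratic in \<epsilon>, and the heights contribute \<open>2 * B\<close>.\<close>

lemma rho_straight_box:
  assumes "\<epsilon> > 0" "B \<ge> 0"
  shows "straight_box \<epsilon> B \<in> sets rho" "emeasure rho (straight_box \<epsilon> B) = ennreal (16 * B ^ 4 * \<epsilon> ^ 4)"
proof -
  have c: "continuous_on UNIV (\<lambda>x::real \<times> real. snd x - 1)"
    "continuous_on UNIV (\<lambda>x::real \<times> real \<times> real. - (fst x * (snd (snd x) - 1) / 2))"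
    by (intro continuous_intros; simp)+
  have "\<epsilon> * exp B / (\<epsilon> * exp (- B)) = exp (2 * B)"
    using assms by (simp flip: exp_diff)
  then have "8 * (B * \<epsilon>) * (B * \<epsilon>) * (B * \<epsilon>\<^sup>2) * ln (\<epsilon> * exp B / (\<epsilon> * exp (- B))) = 16 * B ^ 4 * \<epsilon> ^ 4"
    by (simp add: eval_nat_numeral)
  then show "straight_box \<epsilon> B \<in> sets rho" "emeasure rho (straight_box \<epsilon> B) = ennreal (16 * B ^ 4 * \<epsilon> ^ 4)"
    using rho_sheared_box[OF c, of "B * \<epsilon>" "B * \<epsilon>" "B * \<epsilon>\<^sup>2" "\<epsilon> * exp (- B)" "\<epsilon> * exp B" 0] assms
    by auto
qed

text \<open>Both factors are at least 1, so a product below \<open>B = exp L\<close> bounds each of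
  them by \<open>B\<close>. The horizontal sides, \<open>sqrt B * \<epsilon>\<close>, are relaxed to
  \<open>B * \<epsilon>\<close> so that one parameter describes the box.\<close>

lemma log_bump_support:
  assumes \<epsilon>: "\<epsilon> > 0" and L: "L > 0" and y: "snd y > 0" "y \<notin> straight_box \<epsilon> (exp L)"
  shows "log_bump \<epsilon> L y = 0"
proof (rule ccontr)
  define B where "B = exp L"
  have B1: "B > 1" using L by (simp add: B_def)
  let ?G = "heis_gauge \<epsilon> (straighten y)" and ?H = "1 + \<bar>ln (snd y / \<epsilon>)\<bar>"
  assume "log_bump \<epsilon> L y \<noteq> 0"
  then have "ln (?G * ?H) < L" using L unfolding log_bump_def by (auto simp: max_def split: if_splits)
  moreover have "?G * ?H > 0" using log_bump_factor_ge_one[of \<epsilon> "straighten y" "ln (snd y / \<epsilon>)"] by linarith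
  ultimately have GH: "?G * ?H < B" unfolding B_def by (metis exp_less_mono exp_ln)
  have "?G * 1 \<le> ?G * ?H" "1 * ?H \<le> ?G * ?H"
    using heis_gauge_ge_one[of \<epsilon> "straighten y"] by (intro mult_left_mono mult_right_mono; simp)+
  then have G: "?G \<le> B" and H: "?H \<le> B" using GH by simp_all
  obtain x1 x2 x3 where n: "straighten y = (x1, x2, x3)" by (metis prod.collapse)
  have sq: "\<bar>u\<bar> \<le> B * \<epsilon>" if "(u / \<epsilon>)\<^sup>2 \<le> B" for u
  proof -
    have "B * 1 \<le> B * B" using B1 by (intro mult_left_mono) auto
    then have "(u / \<epsilon>)\<^sup>2 \<le> B\<^sup>2" using that by (simp add: power2_eq_square)
    then have "\<bar>u / \<epsilon>\<bar> \<le> B" using B1 by (simp add: abs_le_square_iff[symmetric])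
    then show ?thesis using \<epsilon> by (simp add: abs_divide field_simps)
  qed
  have nn: "0 \<le> (x1 / \<epsilon>)\<^sup>2" "0 \<le> (x2 / \<epsilon>)\<^sup>2" "0 \<le> \<bar>x3\<bar> / \<epsilon>\<^sup>2" using \<epsilon> by simp_all
  have "(x1 / \<epsilon>)\<^sup>2 \<le> B" "(x2 / \<epsilon>)\<^sup>2 \<le> B" "\<bar>x3\<bar> / \<epsilon>\<^sup>2 \<le> B"
    using G nn unfolding n heis_gauge_def fst_conv snd_conv by linarith+
  moreover from this(3) have "\<bar>x3\<bar> \<le> B * \<epsilon>\<^sup>2" using \<epsilon> by (simp add: field_simps)
  ultimately have "y \<in> straight_box \<epsilon> B"
    using H sq[of x1] sq[of x2] unfolding straight_box_iff[OF \<epsilon> y(1)] n by simp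
  then show False using y by (simp add: B_def)
qed

text \<open>On the box of parameter 1 the gauge is at most 4 and the height factor at most 2, whence
  the 8.\<close>

lemma log_bump_lower:
  assumes \<epsilon>: "\<epsilon> > 0" and L: "L > 0" and y: "y \<in> straight_box \<epsilon> 1"
  shows "1 - ln 8 / L \<le> log_bump \<epsilon> L y"
proof -
  have y0: "snd y > 0" using y \<epsilon> unfolding sheared_box_def
    by (auto intro: less_le_trans[of 0 "\<epsilon> * exp (- 1)"])
  obtain x1 x2 x3 where n: "straighten y = (x1, x2, x3)" by (metis prod.collapse)
  have b: "\<bar>x1\<bar> \<le> \<epsilon>" "\<bar>x2\<bar> \<le> \<epsilon>" "\<bar>x3\<bar> \<le> \<epsilon>\<^sup>2" and H: "\<bar>ln (snd y / \<epsilon>)\<bar> \<le> 1"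
    using y unfolding straight_box_iff[OF \<epsilon> y0] n by simp_all
  have "(x1 / \<epsilon>)\<^sup>2 \<le> 1" "(x2 / \<epsilon>)\<^sup>2 \<le> 1"
    using b \<epsilon> by (simp_all add: power_divide abs_le_square_iff[of _ \<epsilon>, symmetric])
  moreover have "\<bar>x3\<bar> / \<epsilon>\<^sup>2 \<le> 1" using b \<epsilon> by simp
  ultimately have G: "heis_gauge \<epsilon> (straighten y) \<le> 4" unfolding n heis_gauge_def by simp
  have "heis_gauge \<epsilon> (straighten y) * (1 + \<bar>ln (snd y / \<epsilon>)\<bar>) \<le> 4 * 2"
    using G H heis_gauge_ge_one[of \<epsilon> "straighten y"] by (intro mult_mono) auto
  moreover have "0 < heis_gauge \<epsilon> (straighten y) * (1 + \<bar>ln (snd y / \<epsilon>)\<bar>)"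
    using log_bump_factor_ge_one[of \<epsilon> "straighten y" "ln (snd y / \<epsilon>)"] by linarith
  ultimately have "ln (heis_gauge \<epsilon> (straighten y) * (1 + \<bar>ln (snd y / \<epsilon>)\<bar>)) \<le> ln 8"
    by (intro ln_mono) auto
  then show ?thesis unfolding log_bump_def using L by (simp add: divide_right_mono le_max_iff_disj)
qed

section \<open>Cylinders over large cubes\<close>

text \<open>Climbing from a point of \<open>E\<close> costs only the logarithm of the ratio of
  heights, so the enlargement contains a box of base size \<open>h\<close> over the heights from
  \<open>h\<close> to \<open>h * exp (r - 21)\<close>, whose measure is linear in \<open>r\<close>.
  One unit beyond the 20 of \<open>eheis_dist_box\<close> makes the distance strictly less than
  \<open>r\<close>.\<close>

lemma enlarge_radius_bound:
  assumes h: "h > 0" and y: "((q, p, t), h) \<in> E" and meas: "enlarge rho eheis_dist E r \<in> sets rho"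
    and b: "emeasure rho (enlarge rho eheis_dist E r) \<le> ennreal m" and m: "m \<ge> 0"
  shows "h ^ 4 * (r - 21) \<le> m"
proof (cases "r \<le> 21")
  case True
  then have "h ^ 4 * (r - 21) \<le> 0" using h by (simp add: mult_nonneg_nonpos)
  then show ?thesis using m by simp
next
  case False
  \<comment> \<open>This is the left translate, by the given point of \<open>E\<close>, of a box of
    half-width 1/2 in each base coordinate.\<close>
  let ?S = "sheared_box q (h / 2) (\<lambda>q' a. p) (h / 2) (\<lambda>q' p' a. t - (q * (p' - p) - p * (q' - q)) / 2) (h\<^sup>2 / 2)
    h (h * exp (r - 21))"
  have c: "continuous_on UNIV (\<lambda>x::real \<times> real. p)"
    "continuous_on UNIV (\<lambda>x::real \<times> real \<times> real. t - (q * (fst (snd x) - p) - p * (fst x - q)) / 2)"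
    by (intro continuous_intros; simp)+
  have "8 * (h / 2) * (h / 2) * (h\<^sup>2 / 2) * ln (h * exp (r - 21) / h) = h ^ 4 * (r - 21)"
    using h by (simp add: eval_nat_numeral)
  then have S: "emeasure rho ?S = ennreal (h ^ 4 * (r - 21))"
    using rho_sheared_box(2)[OF c, of "h / 2" "h / 2" "h\<^sup>2 / 2" h "h * exp (r - 21)" q] h False
    by (simp add: mult_le_cancel_left1)
  have "?S \<subseteq> enlarge rho eheis_dist E r"
  proof
    fix y' assume "y' \<in> ?S"
    then obtain q' p' t' a where y': "y' = ((q', p', t'), a)"
      and d: "\<bar>q' - q\<bar> \<le> h / 2" "\<bar>p' - p\<bar> \<le> h / 2" "\<bar>t' - (t - (q * (p' - p) - p * (q' - q)) / 2)\<bar> \<le> h\<^sup>2 / 2"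
      and a: "h \<le> a" "a \<le> h * exp (r - 21)"
      unfolding sheared_box_def by auto
    define X Y Z b where "X = (q' - q) / h" and "Y = (p' - p) / h"
      and "Z = (t' - (t - (q * (p' - p) - p * (q' - q)) / 2)) / h\<^sup>2" and "b = a / h"
    have XYZ: "\<bar>X\<bar> \<le> 1/2" "\<bar>Y\<bar> \<le> 1/2" "\<bar>Z\<bar> \<le> 1/2"
      using d h unfolding X_def Y_def Z_def abs_divide by (simp_all add: pos_divide_le_eq)
    have b: "1 \<le> b" using a(1) h by (simp add: b_def)
    have b': "b \<le> exp (r - 21)"
      using a(2) unfolding b_def pos_divide_le_eq[OF h] by (simp only: mult.commute)
    have m: "h * X = q' - q" "h * Y = p' - p" "h * b = a"
      "h\<^sup>2 * Z = t' - (t - (q * (p' - p) - p * (q' - q)) / 2)"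
      using h by (simp_all only: X_def Y_def Z_def b_def, simp_all)
    have e: "eheis_mult ((q, p, t), h) ((X, Y, Z), b) = y'"
      by (simp add: y' m)
    have "ln b \<le> r - 21" using b b' ln_mono[of b "exp (r - 21)"] by simp
    then have "eheis_dist y' ((q, p, t), h) < r"
      using eheis_dist_box[OF h b XYZ, of q p t] unfolding e by linarith
    then show "y' \<in> enlarge rho eheis_dist E r"
      using y h a unfolding enlarge_def rho_space eheis_carrier_def y' by auto
  qed
  from order_trans[OF emeasure_mono[OF this meas] b]
  have "ennreal (h ^ 4 * (r - 21)) \<le> ennreal m" unfolding S .
  then show ?thesis using m by (simp add: ennreal_le_iff)
qed

text \<open>
  The two points found here have the same height \<open>h\<close> and differ by \<open>(c \<epsilon> / 2, 0, 0)\<close> in the base, but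
  the shear of the flow of \<open>Z\<close> turns this into a vertical displacement of order \<open>c \<epsilon>\<close>, which is large
  compared with the square of the scale \<open>h \<approx> \<epsilon>\<close>.
\<close>

lemma large_cylinder_escapes_ball:
  assumes C: "christ_decomposition \<Q> \<delta> C\<^sub>1 c" and P: "tame \<Q> \<delta> \<gamma> lam (Cyl r k Q a)"
    and \<epsilon>: "\<epsilon> > 0" "\<epsilon> < \<delta> powi k"
    and y: "y \<in> cyl_region r Q a" and h: "snd y \<le> \<epsilon> * exp B" "\<epsilon> * exp B \<le> 1 / 2"
    and x: "x \<in> eheis_carrier" and ball: "cyl_region r Q a \<subseteq> {z. eheis_dist x z < R}"
  shows "c \<le> 16 * \<epsilon> * exp (2 * B + 4 * R) * R\<^sup>2"
proof -
  have Q: "Q \<in> \<Q> k" and a: "a > 0" and r: "r > 1" using P by auto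
  have c0: "c > 0" using C by (simp add: christ_decomposition_def)
  obtain n where n: "n \<in> Q" "heis_ball n (c * \<delta> powi k) \<subseteq> Q"
    using C Q unfolding christ_decomposition_def by meson
  obtain x0 y0 z0 where n0: "n = (x0, y0, z0)" by (metis prod.collapse)
  define H where "H = snd y"
  have Hr: "a / r < H" "H < a * r"
    using y cyl_region_iff[OF a r, of "fst (fst y)" "fst (snd (fst y))" "snd (snd (fst y))" "snd y" Q]
    by (simp_all add: H_def)
  have "0 < a / r" using a r by simp
  then have H0: "H > 0" using Hr by linarith
  \<comment> \<open>Half of \<open>c * \<epsilon>\<close> keeps the displaced point inside the inner
    ball of the cube.\<close>
  define X where "X = c * \<epsilon> / 2"
  have X0: "X > 0" using c0 \<epsilon> by (simp add: X_def)
  have "X < c * \<epsilon>" using c0 \<epsilon> by (simp add: X_def)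
  also have "c * \<epsilon> < c * \<delta> powi k" using c0 \<epsilon> by simp
  finally have Xd: "X < c * \<delta> powi k" .
  have "heis_dist n (heis_mult n (X, 0, 0)) < c * \<delta> powi k"
    using heis_dist_horizontal_line[of x0 y0 z0 X] Xd X0 unfolding n0 by simp
  then have n2: "(x0 + X, y0, z0 + y0 * X / 2) \<in> Q" using n(2) unfolding n0 heis_ball_def by auto
  have y1: "((x0, y0 + (H - 1), z0 - x0 * (H - 1) / 2), H) \<in> cyl_region r Q a"
    using n(1) Hr unfolding cyl_region_iff[OF a r] n0 by simp
  have y2: "((x0 + X, y0 + (H - 1), z0 + y0 * X / 2 - (x0 + X) * (H - 1) / 2), H) \<in> cyl_region r Q a"
    using n2 Hr unfolding cyl_region_iff[OF a r] by simp
  obtain qc pc tc ac where xc: "x = ((qc, pc, tc), ac)" by (metis prod.collapse)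
  have ac: "ac > 0" using x by (simp add: xc eheis_carrier_def)
  have d1: "eheis_dist ((qc, pc, tc), ac) ((x0, y0 + (H - 1), z0 - x0 * (H - 1) / 2), H) < R"
    and d2: "eheis_dist ((qc, pc, tc), ac)
      ((x0 + X, y0 + (H - 1), z0 + y0 * X / 2 - (x0 + X) * (H - 1) / 2), H) < R"
    using ball y1 y2 unfolding xc by auto
  define M where "M = H * exp (2 * R) * R"
  note b1 = eheis_dist_less_imp[OF ac H0 d1, folded M_def]
  note b2 = eheis_dist_less_imp[OF ac H0 d2, folded M_def]
  \<comment> \<open>The two points differ by \<open>(X, 0, 0)\<close> conjugated with
    \<open>(0, H - 1, 0)\<close>, that is, by \<open>(X, 0, X * (1 - H))\<close>. As
    \<open>H\<close> is at most 1/2, the vertical part is at least \<open>X / 2\<close>.\<close>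
  have "\<bar>z0 + y0 * X / 2 - (x0 + X) * (H - 1) / 2 - (z0 - x0 * (H - 1) / 2) -
      ((y0 + (H - 1)) * (x0 + X - x0) - x0 * (y0 + (H - 1) - (y0 + (H - 1)))) / 2\<bar> \<le> 4 * M\<^sup>2"
    by (rule heis_relative_displacement[OF b1 b2])
  moreover have "z0 + y0 * X / 2 - (x0 + X) * (H - 1) / 2 - (z0 - x0 * (H - 1) / 2) -
      ((y0 + (H - 1)) * (x0 + X - x0) - x0 * (y0 + (H - 1) - (y0 + (H - 1)))) / 2 = X * (1 - H)"
    by (simp add: field_simps)
  ultimately have "X * (1 - H) \<le> 4 * M\<^sup>2" by linarith
  moreover have "X * (1 / 2) \<le> X * (1 - H)" using X0 h by (intro mult_left_mono) (auto simp: H_def)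
  ultimately have "X / 2 \<le> 4 * M\<^sup>2" by simp
  also have "M\<^sup>2 \<le> ((\<epsilon> * exp B) * exp (2 * R) * R)\<^sup>2"
  proof -
    \<comment> \<open>The sign of \<open>R\<close> is left open here, hence the absolute
      values.\<close>
    have "\<bar>R\<bar> * (H * exp (2 * R)) \<le> \<bar>R\<bar> * ((\<epsilon> * exp B) * exp (2 * R))"
      using h by (intro mult_left_mono mult_right_mono) (auto simp: H_def)
    then have "\<bar>M\<bar> \<le> \<bar>(\<epsilon> * exp B) * exp (2 * R) * R\<bar>"
      using H0 \<epsilon> unfolding M_def by (simp add: abs_mult mult_ac)
    then show ?thesis by (simp add: abs_le_square_iff)
  qed
  also have "((\<epsilon> * exp B) * exp (2 * R) * R)\<^sup>2 = \<epsilon> * \<epsilon> * exp (2 * B + 4 * R) * R\<^sup>2"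
    by (simp add: power_mult_distrib exp_add power2_eq_square flip: exp_double) (simp flip: exp_add)
  \<comment> \<open>The forced displacement is linear in \<epsilon> and the allowance of the ball
    quadratic, so one factor \<epsilon> survives on the right after cancellation.\<close>
  finally have "c * \<epsilon> / 4 \<le> 4 * (\<epsilon> * \<epsilon> * exp (2 * B + 4 * R) * R\<^sup>2)" by (simp add: X_def)
  then have "\<epsilon> * c \<le> \<epsilon> * (16 * \<epsilon> * exp (2 * B + 4 * R) * R\<^sup>2)" by (simp add: mult_ac)
  then show ?thesis using \<epsilon> by simp
qed

section \<open>Choice of the constants and the contradiction\<close>

lemma vanishing_scale_exists:
  fixes A b c :: real
  assumes "c > 0" "A \<ge> 0"
  obtains \<epsilon> where "\<epsilon> > 0" "\<epsilon> * exp b \<le> 1 / 2" "\<epsilon> * A < c"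
proof -
  define \<epsilon> where "\<epsilon> = min (exp (- b) / 2) (c / (A + 1) / 2)"
  have "\<epsilon> > 0" using assms by (simp add: \<epsilon>_def)
  have "\<epsilon> * exp b \<le> exp (- b) / 2 * exp b"
    unfolding \<epsilon>_def by (intro mult_right_mono min.cobounded1) simp
  then have e: "\<epsilon> * exp b \<le> 1 / 2" by (simp add: exp_minus)
  have "\<epsilon> * A \<le> c / (A + 1) / 2 * (A + 1)"
    using assms unfolding \<epsilon>_def by (intro mult_mono min.cobounded2) auto
  also have "\<dots> = c / 2" using assms by (simp add: field_simps)
  finally have "\<epsilon> * A < c" using assms by linarith
  with \<open>\<epsilon> > 0\<close> e show ?thesis using that by blast
qed

theorem theorem6p9:
  fixes \<Q> :: "int \<Rightarrow> heis set set" and \<delta> C\<^sub>1 c \<gamma> lam r\<^sub>0 :: real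
    and k\<^sub>0 :: int and Q\<^sub>0 :: "heis set"
  assumes "christ_decomposition \<Q> \<delta> C\<^sub>1 c"
    and "C\<^sub>1 \<ge> 3"
    and "\<And>k Q. Q \<in> \<Q> k \<Longrightarrow> card (cube_sons \<Q> k Q) \<ge> 2"
    and "\<gamma> \<ge> 5"
    and "lam > exp 3 / \<delta>"
    and "large_admissible \<Q> \<delta> \<gamma> lam (Cyl r\<^sub>0 k\<^sub>0 Q\<^sub>0 1)"
  shows "\<not> CZ_family rho eheis_dist (DZ \<Q> \<delta> \<gamma> lam (Cyl r\<^sub>0 k\<^sub>0 Q\<^sub>0 1))"
proof
  note C = assms(1)
  assume "CZ_family rho eheis_dist (DZ \<Q> \<delta> \<gamma> lam (Cyl r\<^sub>0 k\<^sub>0 Q\<^sub>0 1))"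
  then obtain C\<^sub>0 and \<E>s :: "(eheis \<Rightarrow> complex) \<Rightarrow> real \<Rightarrow> eheis set set" where C0: "C\<^sub>0 \<ge> 1"
    and dec: "\<And>f \<alpha>. integrable rho f \<Longrightarrow> \<alpha> > 0 \<Longrightarrow> CZ_decomposition rho eheis_dist C\<^sub>0 f \<alpha> (\<E>s f \<alpha>)"
    and DZ: "DZ \<Q> \<delta> \<gamma> lam (Cyl r\<^sub>0 k\<^sub>0 Q\<^sub>0 1) = \<Union>{\<E>s f \<alpha> | f \<alpha>. integrable rho f \<and> \<alpha> > 0}"
    unfolding CZ_family_def by blast
  have c0: "c > 0" using C by (simp add: christ_decomposition_def)
  \<comment> \<open>The ratio by which the product inside the logarithm can vary on a cylinder over
    a small cube.\<close>
  define K where "K = 3 * (3 + 21 * C\<^sub>1\<^sup>2)"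
  have "9 \<le> K" by (simp add: K_def)
  then have lnK: "ln 8 \<le> ln K" "ln K > 0" by simp_all
  \<comment> \<open>This makes the oscillation \<open>ln K / L\<close> equal to
    \<open>1 / (4 * C\<^sub>0)\<close>. It also gives \<open>ln 8 / L \<le> 1 / 4\<close>, as 8 is
    less than \<open>K\<close>.\<close>
  define L where "L = 4 * C\<^sub>0 * ln K"
  have L: "L > 0" using lnK C0 by (simp add: L_def)
  define B where "B = exp L"
  have B: "B > 0" by (simp add: B_def)
  \<comment> \<open>A bound for \<open>C\<^sub>0 * r\<close> when the cylinder meets
    \<open>W\<close>: 21 is the offset from \<open>enlarge_radius_bound\<close>, and the other
    summand comes from heights at least \<open>\<epsilon> * exp (- B)\<close>, where \<epsilon>
    cancels.\<close>
  define R where "R = C\<^sub>0 * (21 + 64 * C\<^sub>0\<^sup>2 * B ^ 4 * exp (4 * B))"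
  have R: "R \<ge> 0" using C0 by (simp add: R_def B_def)
  obtain \<epsilon> where \<epsilon>: "\<epsilon> > 0" and \<epsilon>B: "\<epsilon> * exp B \<le> 1 / 2"
    and \<epsilon>R: "\<epsilon> * (16 * exp (2 * B + 4 * R) * R\<^sup>2) < c"
    using vanishing_scale_exists[OF c0, of "16 * exp (2 * B + 4 * R) * R\<^sup>2" B] by auto
  define \<phi> where "\<phi> = log_bump \<epsilon> L"
  define W U where "W = straight_box \<epsilon> B" and "U = straight_box \<epsilon> 1"
  define F where "F = 16 * \<epsilon> ^ 4"
  have F: "F > 0" using \<epsilon> by (simp add: F_def)
  have W: "W \<in> sets rho" "emeasure rho W = ennreal (B ^ 4 * F)"
    using rho_straight_box[OF \<epsilon> less_imp_le[OF B]] unfolding W_def F_def by (simp_all add: mult_ac)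
  have U: "U \<in> sets rho" "emeasure rho U = ennreal F"
    using rho_straight_box[OF \<epsilon>, of 1] unfolding U_def F_def by simp_all
  have mW: "measure rho W = B ^ 4 * F" and mU: "measure rho U = F"
    using W U F by (simp_all add: measure_def)
  define f :: "eheis \<Rightarrow> complex" where "f = indicator U"
  have f_eq: "f y = complex_of_real (indicator U y)" for y by (simp add: f_def indicator_def)
  have f: "integrable rho f"
    unfolding f_eq[abs_def] by (intro integrable_of_real integrable_real_indicator) (use U in auto)
  have nf: "norm (f y) = indicator U y" for y by (simp add: f_def indicator_def)
  have nnf: "(\<integral>\<^sup>+y. ennreal (norm (f y)) \<partial>rho) = ennreal F"
    unfolding nf using U by (simp add: ennreal_indicator)
  have intf: "(\<integral>y. norm (f y) \<partial>rho) = F"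
    unfolding nf using U mU sets.sets_into_space[OF U(1)] by (simp add: Int_absorb2)
  \<comment> \<open>With this height \<open>C\<^sub>0 * \<alpha> * measure rho W\<close> is a
    quarter of \<open>F\<close>, the norm of \<open>f\<close>.\<close>
  define \<alpha> where "\<alpha> = 1 / (4 * C\<^sub>0 * B ^ 4)"
  have \<alpha>: "\<alpha> > 0" using C0 B by (simp add: \<alpha>_def)
  have tame_of: "\<exists>r k Q a. tame \<Q> \<delta> \<gamma> lam (Cyl r k Q a) \<and> E = cyl_region r Q a" if "E \<in> \<E>s f \<alpha>" for E
  proof -
    have "E \<in> DZ \<Q> \<delta> \<gamma> lam (Cyl r\<^sub>0 k\<^sub>0 Q\<^sub>0 1)" unfolding DZ using that f \<alpha> by blast
    from DZ_tame[OF C assms(4-6) this] obtain P where P: "tame \<Q> \<delta> \<gamma> lam P" "E = cyl_set P" .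
    then show ?thesis by (cases P) (auto simp del: tame.simps)
  qed
  have osc: "\<bar>\<phi> y - \<phi> z\<bar> \<le> 1 / (4 * C\<^sub>0)"
    if E: "E \<in> \<E>s f \<alpha>" and r: "r > 0" and x: "x \<in> space rho"
      and ball: "E \<subseteq> {y \<in> space rho. eheis_dist x y < C\<^sub>0 * r}"
      and meas: "enlarge rho eheis_dist E r \<in> sets rho"
      and bd: "emeasure rho (enlarge rho eheis_dist E r) \<le> ennreal (C\<^sub>0 / \<alpha>) * (\<integral>\<^sup>+y. ennreal (norm (f y)) \<partial>rho)"
      and y: "y \<in> E" and z: "z \<in> E" for E r x y z
  proof -
    obtain s k Q a where P: "tame \<Q> \<delta> \<gamma> lam (Cyl s k Q a)" and Eq: "E = cyl_region s Q a"
      using tame_of[OF E] by blast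
    show ?thesis
    proof (cases "\<delta> powi k \<le> \<epsilon>")
      case True
      have "\<bar>\<phi> y - \<phi> z\<bar> \<le> ln K / L"
        unfolding \<phi>_def K_def using log_bump_oscillation[OF C P \<epsilon> True L] y z Eq by blast
      also have "\<dots> = 1 / (4 * C\<^sub>0)" using lnK C0 by (simp add: L_def)
      finally show ?thesis .
    next
      case False
      have "E \<inter> W = {}"
      proof (rule ccontr)
        assume "E \<inter> W \<noteq> {}"
        then obtain w where w: "w \<in> E" "w \<in> W" by blast
        obtain q p t h where wc: "w = ((q, p, t), h)" by (metis prod.collapse)
        have hl: "\<epsilon> * exp (- B) \<le> h" and hu: "h \<le> \<epsilon> * exp B"
          using w(2) unfolding W_def wc sheared_box_def by auto
        have h0: "h > 0" using hl \<epsilon> by (meson exp_gt_zero less_le_trans mult_pos_pos)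
        \<comment> \<open>Substituting \<open>F = 16 * \<epsilon>^4\<close> produces the constant 64
          that appears in \<open>R\<close>.\<close>
        have "ennreal (C\<^sub>0 / \<alpha>) * ennreal F = ennreal (4 * C\<^sub>0\<^sup>2 * B ^ 4 * F)"
          using C0 \<alpha> F B by (simp add: \<alpha>_def power2_eq_square mult_ac flip: ennreal_mult)
        then have "h ^ 4 * (r - 21) \<le> 4 * C\<^sub>0\<^sup>2 * B ^ 4 * F"
          using enlarge_radius_bound[OF h0 w(1)[unfolded wc] meas, of "4 * C\<^sub>0\<^sup>2 * B ^ 4 * F"] bd F C0 B
          unfolding nnf by simp
        then have hr: "h ^ 4 * (r - 21) \<le> \<epsilon> ^ 4 * (64 * C\<^sub>0\<^sup>2 * B ^ 4)" by (simp add: F_def mult_ac)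
        have r21: "r \<le> 21 + 64 * C\<^sub>0\<^sup>2 * B ^ 4 * exp (4 * B)"
        proof (cases "r \<le> 21")
          case True
          have "0 \<le> 64 * C\<^sub>0\<^sup>2 * B ^ 4 * exp (4 * B)" using B by simp
          then show ?thesis using True by linarith
        next
          case False
          have "(\<epsilon> * exp (- B)) ^ 4 * (r - 21) \<le> h ^ 4 * (r - 21)"
            using hl \<epsilon> False by (intro mult_right_mono power_mono) auto
          then have "\<epsilon> ^ 4 * (exp (- B) ^ 4 * (r - 21)) \<le> \<epsilon> ^ 4 * (64 * C\<^sub>0\<^sup>2 * B ^ 4)"
            using hr by (simp add: power_mult_distrib mult.assoc)
          then have "exp (- B) ^ 4 * (r - 21) \<le> 64 * C\<^sub>0\<^sup>2 * B ^ 4" using \<epsilon> by simp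
          then have "exp (4 * B) * (exp (- B) ^ 4 * (r - 21)) \<le> exp (4 * B) * (64 * C\<^sub>0\<^sup>2 * B ^ 4)"
            by (intro mult_left_mono) auto
          moreover have "exp (4 * B) * (exp (- B) ^ 4 * (r - 21)) = r - 21"
          proof -
            have e: "exp (- B) ^ 4 = exp (- (4 * B))" by (simp flip: exp_of_nat_mult)
            show ?thesis unfolding e by (simp add: exp_minus)
          qed
          ultimately have "r - 21 \<le> exp (4 * B) * (64 * C\<^sub>0\<^sup>2 * B ^ 4)" by linarith
          then show ?thesis by (simp add: mult_ac)
        qed
        then have rR: "C\<^sub>0 * r \<le> R" unfolding R_def using C0 by (intro mult_left_mono) auto
        have "E \<subseteq> {y. eheis_dist x y < R}" using ball rR by auto
        then have "c \<le> 16 * \<epsilon> * exp (2 * B + 4 * R) * R\<^sup>2"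
          using large_cylinder_escapes_ball[OF C P \<epsilon> _ w(1)[unfolded Eq] _ \<epsilon>B, of x R] False hu x wc
          unfolding Eq rho_space by auto
        then show False using \<epsilon>R by (simp add: mult_ac)
      qed
      then have "\<phi> v = 0" if "v \<in> E" for v
        using log_bump_support[OF \<epsilon> L, of v] that ball
        unfolding \<phi>_def W_def B_def rho_space eheis_carrier_def by blast
      then show ?thesis using y z C0 by simp
    qed
  qed
  have "norm (\<integral>y. f y * \<phi> y \<partial>rho) \<le> C\<^sub>0 * \<alpha> * measure rho W + 1 / (4 * C\<^sub>0) * C\<^sub>0 * (\<integral>y. norm (f y) \<partial>rho)"
  proof (rule CZ_decomposition_duality[OF dec[OF f \<alpha>] C0 \<alpha> f])
    show "\<phi> \<in> borel_measurable rho" unfolding \<phi>_def by (rule log_bump_measurable)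
    show "0 \<le> \<phi> y" "\<phi> y \<le> 1" for y unfolding \<phi>_def using log_bump_range[OF L] by auto
    show "\<phi> y = 0" if "y \<in> space rho - W" for y
      using log_bump_support[OF \<epsilon> L, of y] that
      unfolding \<phi>_def W_def B_def rho_space eheis_carrier_def by blast
    show "0 \<le> 1 / (4 * C\<^sub>0)" using C0 by simp
    show "emeasure rho W < \<infinity>" using W by simp
  qed (rule W(1), rule osc)
  \<comment> \<open>The good part and the bad parts contribute \<open>F / 4\<close> each.\<close>
  also have "\<dots> = F / 2" unfolding mW intf \<alpha>_def using C0 B by (simp add: field_simps)
  finally have upper: "norm (\<integral>y. f y * \<phi> y \<partial>rho) \<le> F / 2" .
  have "ln 8 / L \<le> 1 / 4"
  proof -
    have "ln 8 \<le> C\<^sub>0 * ln K" using lnK C0 mult_right_mono[of 1 C\<^sub>0 "ln K"] by linarith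
    then show ?thesis using L unfolding L_def by (simp add: field_simps)
  qed
  then have \<phi>U: "3 / 4 \<le> \<phi> y" if "y \<in> U" for y
    using log_bump_lower[OF \<epsilon> L, of y] that unfolding \<phi>_def U_def by linarith
  have \<phi>1: "\<bar>\<phi> y\<bar> \<le> 1" for y unfolding \<phi>_def using log_bump_range[OF L, of \<epsilon> y] by simp
  have iU: "integrable rho (indicator U :: eheis \<Rightarrow> real)" by (intro integrable_real_indicator) (use U in auto)
  have m\<phi>: "\<phi> \<in> borel_measurable rho" unfolding \<phi>_def by (rule log_bump_measurable)
  have iU\<phi>: "integrable rho (\<lambda>y. indicator U y * \<phi> y)"
    by (rule Bochner_Integration.integrable_bound[OF iU])
      (use U m\<phi> \<phi>1 in \<open>auto simp: indicator_def\<close>)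
  have "3 / 4 * F = (\<integral>y. indicator U y * (3 / 4) \<partial>rho)"
    using mU sets.sets_into_space[OF U(1)] by (simp add: Int_absorb2)
  also have "\<dots> \<le> (\<integral>y. indicator U y * \<phi> y \<partial>rho)"
    by (intro integral_mono integrable_mult_left iU iU\<phi>) (use \<phi>U in \<open>auto simp: indicator_def\<close>)
  finally have lower: "3 / 4 * F \<le> (\<integral>y. indicator U y * \<phi> y \<partial>rho)" .
  have "f y * \<phi> y = complex_of_real (indicator U y * \<phi> y)" for y by (simp add: f_def indicator_def)
  then have "(\<integral>y. f y * \<phi> y \<partial>rho) = complex_of_real (\<integral>y. indicator U y * \<phi> y \<partial>rho)"
    by (simp only: integral_complex_of_real)
  then have "norm (\<integral>y. f y * \<phi> y \<partial>rho) \<ge> 3 / 4 * F" using lower by simp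
  then show False using upper F by linarith
qed

end
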